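(* Let $0<p<1/2$, $\rho=(1-p)/p$, $g_\rho(x)=\rho^x-1$. Let $\mathcal{M}^\rho$ be the set of probability measures $\mu$ on $\mathbb{Z}$ for which there exists a randomized stopping time $\tau$ such that $S_\tau\sim\mu$ and $(S_{\tau\wedge t})_{t\in\mathbb{N}}$ is uniformly integrable. Let $$\widehat{\mathcal{M}}^\rho := \Big\{\mu \text{ measure on } \mathbb{Z}: \sum_{y\in\mathbb{Z}}\mu(\{y\})=1,\ \sum_{y\in\mathbb{Z}}|y|\,\mu(\{y\})<\infty,\ \sum_{y\in\mathbb{Z}} g_\rho(y)\,\mu(\{y\})= 0\Big\}.$$ Then $\mathcal{M}^\rho\supseteq\widehat{\mathcal{M}}^\rho$. Moreover, for every $\mu\in\widehat{\mathcal{M}}^\rho$ there exists a randomized Azéma--Yor stopping time $\tau_{AY}$ associated with $\mu$ such that $S_{\tau_{AY}}\sim\mu$.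
   Context: $(S_t)_{t\in\mathbb{N}}$ is the asymmetric simple random walk: $S_0=0$, with i.i.d. increments equal to $+1$ with probability $p$ and $-1$ with probability $1-p$. $(\mathcal{F}_t)$ is its natural filtration. The probability space is rich enough to carry, in addition, for each $t\in\mathbb{N}$ and each possible history $h=(s_0,\dots,s_t)$ of the walk, a $\{0,1\}$-valued Bernoulli random variable $\xi_t^h$ (a coin, with value $1$ meaning tail), all of these being mutually independent and independent of $(S_t)$; their success probabilities may be chosen freely. Put $\mathcal{G}_t=\mathcal{F}_t\vee\sigma(\xi_s^{(S_0,\dots,S_s)}, s\le t)$. A randomized stopping time is a $\{0,1,2,\dots\}\cup\{\infty\}$-valued stopping time with respect to $(\mathcal{G}_t)$ for some such choice of Bernoulli variables. On $\{\tau=\infty\}$, $S_\tau$ is understood as $\lim_{t\to\infty}S_t=-\infty$. Let $\widetilde S_t=g_\rho(S_t)$. Given $\mu\in\widehat{\mathcal{M}}^\rho$ define $$\psi_\mu(x)=\frac{\sum_{k\in\mathbb{Z},\,g_\rho(k)\ge x} g_\rho(k)\mu(\{k\})}{\sum_{k\in\mathbb{Z},\,g_\rho(k)\ge x}\mu(\{k\})},$$ with $\psi_\mu(x)=+\infty$ if the denominator vanishes, and, for $x\ge 0$, $$b_\mu(x)=\min\{g_\rho(k): k\in\mathbb{Z},\ \psi_\mu(g_\rho(k))\le x \text{ and } \psi_\mu(g_\rho(k)+)>x\},$$ where $\psi_\mu(y+)$ is the right limit at $y$. (The set is empty only if $x=0$ and the support of $\mu$ is unbounded below, in which case $b_\mu(0)$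 is undefined.) For $n\in\mathbb{N}=\{0,1,2,\dots\}$ let $x^n_1>x^n_2>\dots>x^n_{m_n}>x^n_{m_n+1}$ be the distinct values taken by $b_\mu$ on $[g_\rho(n),g_\rho(n+1)]$, so $x^n_1=b_\mu(g_\rho(n+1))$ and $x^n_{m_n+1}=b_\mu(g_\rho(n))$; if $n=0$ and the support of $\mu$ is unbounded below, the list $x^0_1>x^0_2>\cdots$ is infinite, there is no last element, and $m_0=\infty$. A randomized Azéma--Yor stopping time associated with $\mu$ is a randomized stopping time that, for some numbers $r^n_k\in[0,1]$ ($n\in\mathbb{N}$, $1\le k\le m_n$, $k$ finite), follows this rule. Whenever $\widetilde S$, not yet stopped, reaches a new running maximum $g_\rho(n)$ (with $n=0$ at time $0$): set the upper bound to $g_\rho(n+1)$ and the lower bound to $x^n_1$ (if $x^n_1=g_\rho(n+1)$, skip this level and start with lower bound $x^n_2$). If the upper bound is reached before the current lower bound, the running maximum is updated to $g_\rho(n+1)$ and the rule restarts with $n+1$. If the current lower bound $x^n_k$ with $k\le m_n$ is reached first (this occurs at once if the process is already there), toss a coin with probability of tail $r^n_k$: stop on tail; on head, continue with the same upper bound and the lower bound lowered to $x^n_{k+1}$. If $x^n_{m_n+1}$ is the current lower bound and is reached first, stop for sure. *)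

theory Defs
  imports "HOL-Probability.Probability"
begin

section \<open>The walk and its coins\<close>

definition history :: "(nat \<Rightarrow> 'a \<Rightarrow> int) \<Rightarrow> nat \<Rightarrow> 'a \<Rightarrow> int list" where
  "history S t \<omega> = map (\<lambda>s. S s \<omega>) [0..<Suc t]"

definition histories :: "'a measure \<Rightarrow> (nat \<Rightarrow> 'a \<Rightarrow> int) \<Rightarrow> int list set" where
  "histories M S = {history S t \<omega> | t \<omega>. \<omega> \<in> space M}"

text \<open>A history determines its time (its length minus one), so the coins \<open>\<xi>\<^sub>t\<^sup>h\<close> need only the
  index \<open>h\<close>. The value \<^const>\<open>True\<close> is the value 1, that is, tail; \<open>q h\<close> is its probability.\<close>

definition coin_family ::
  "'a measure \<Rightarrow> (nat \<Rightarrow> 'a \<Rightarrow> int) \<Rightarrow> (int list \<Rightarrow> real) \<Rightarrow> (int list \<Rightarrow> 'a \<Rightarrow> bool) \<Rightarrow> bool" where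
  "coin_family M S q \<xi> \<longleftrightarrow>
     (\<forall>h\<in>histories M S. 0 \<le> q h \<and> q h \<le> 1) \<and>
     (\<forall>h\<in>histories M S. distr M (count_space UNIV) (\<xi> h) = measure_pmf (bernoulli_pmf (q h))) \<and>
     prob_space.indep_vars M (\<lambda>_. count_space UNIV) \<xi> (histories M S) \<and>
     prob_space.indep_set M
       (sets (vimage_algebra (space M) (\<lambda>\<omega> t. S t \<omega>) (\<Pi>\<^sub>M t\<in>UNIV. count_space UNIV)))
       (sets (vimage_algebra (space M) (\<lambda>\<omega>. \<lambda>h\<in>histories M S. \<xi> h \<omega>)
         (\<Pi>\<^sub>M h\<in>histories M S. count_space UNIV)))"

locale simple_random_walk = prob_space M
  for M :: "'a measure" and S :: "nat \<Rightarrow> 'a \<Rightarrow> int" and p :: real +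
  assumes S_0: "\<omega> \<in> space M \<Longrightarrow> S 0 \<omega> = 0"
    and indep_increments: "indep_vars (\<lambda>_. count_space UNIV) (\<lambda>t \<omega>. S (Suc t) \<omega> - S t \<omega>) UNIV"
    and prob_up: "prob {\<omega> \<in> space M. S (Suc t) \<omega> - S t \<omega> = 1} = p"
    and prob_down: "prob {\<omega> \<in> space M. S (Suc t) \<omega> - S t \<omega> = -1} = 1 - p"

locale walk_with_coins = simple_random_walk +
  assumes coins_exist: "(\<And>h. 0 \<le> q h \<and> q h \<le> 1) \<Longrightarrow> \<exists>\<xi>. coin_family M S q \<xi>"

definition walk_filtration :: "'a measure \<Rightarrow> (nat \<Rightarrow> 'a \<Rightarrow> int) \<Rightarrow> nat \<Rightarrow> 'a measure" where
  "walk_filtration M S t = sigma (space M) (\<Union>s\<in>{..t}. {S s -` A \<inter> space M | A. True})"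

definition coin_filtration ::
  "'a measure \<Rightarrow> (nat \<Rightarrow> 'a \<Rightarrow> int) \<Rightarrow> (int list \<Rightarrow> 'a \<Rightarrow> bool) \<Rightarrow> nat \<Rightarrow> 'a measure" where
  "coin_filtration M S \<xi> t = sigma (space M)
     (sets (walk_filtration M S t) \<union>
      (\<Union>s\<in>{..t}. {(\<lambda>\<omega>. \<xi> (history S s \<omega>) \<omega>) -` A \<inter> space M | A. True}))"

section \<open>Randomized stopping times\<close>

text \<open>The library constant \<^const>\<open>stopping_time\<close> requires the index of the filtration and the
  values of the time to have the same type, hence the explicit condition here.\<close>

definition coin_stopping_time ::
  "'a measure \<Rightarrow> (nat \<Rightarrow> 'a \<Rightarrow> int) \<Rightarrow> (int list \<Rightarrow> 'a \<Rightarrow> bool) \<Rightarrow> ('a \<Rightarrow> enat) \<Rightarrow> bool" where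
  "coin_stopping_time M S \<xi> \<tau> \<longleftrightarrow>
     (\<forall>t. Measurable.pred (coin_filtration M S \<xi> t) (\<lambda>\<omega>. \<tau> \<omega> \<le> enat t))"

definition randomized_stopping_time ::
  "'a measure \<Rightarrow> (nat \<Rightarrow> 'a \<Rightarrow> int) \<Rightarrow> ('a \<Rightarrow> enat) \<Rightarrow> bool" where
  "randomized_stopping_time M S \<tau> \<longleftrightarrow>
     (\<exists>q \<xi>. coin_family M S q \<xi> \<and> coin_stopping_time M S \<xi> \<tau>)"

definition stopped_value :: "(nat \<Rightarrow> 'a \<Rightarrow> int) \<Rightarrow> ('a \<Rightarrow> enat) \<Rightarrow> 'a \<Rightarrow> ereal" where
  "stopped_value S \<tau> \<omega> = (case \<tau> \<omega> of enat t \<Rightarrow> ereal (of_int (S t \<omega>)) | \<infinity> \<Rightarrow> -\<infinity>)"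

definition stopped_walk :: "(nat \<Rightarrow> 'a \<Rightarrow> int) \<Rightarrow> ('a \<Rightarrow> enat) \<Rightarrow> nat \<Rightarrow> 'a \<Rightarrow> real" where
  "stopped_walk S \<tau> t \<omega> = of_int (S (the_enat (min (\<tau> \<omega>) (enat t))) \<omega>)"

text \<open>The law of the stopped value lives on the extended reals. Equality with the image of \<open>\<mu>\<close>
  forces \<open>\<tau> < \<infinity>\<close> almost surely.\<close>

definition embeds ::
  "'a measure \<Rightarrow> (nat \<Rightarrow> 'a \<Rightarrow> int) \<Rightarrow> ('a \<Rightarrow> enat) \<Rightarrow> int measure \<Rightarrow> bool" where
  "embeds M S \<tau> \<mu> \<longleftrightarrow>
     distr M borel (stopped_value S \<tau>) = distr \<mu> borel (\<lambda>k. ereal (of_int k))"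

definition uniformly_integrable :: "'a measure \<Rightarrow> (nat \<Rightarrow> 'a \<Rightarrow> real) \<Rightarrow> bool" where
  "uniformly_integrable M X \<longleftrightarrow>
     (\<forall>t. integrable M (X t)) \<and>
     (\<forall>\<epsilon>>0. \<exists>K. \<forall>t. (\<integral>\<omega>. \<bar>X t \<omega>\<bar> * indicator {\<omega>. \<bar>X t \<omega>\<bar> > K} \<omega> \<partial>M) < \<epsilon>)"

definition embeddable :: "'a measure \<Rightarrow> (nat \<Rightarrow> 'a \<Rightarrow> int) \<Rightarrow> int measure set" where
  "embeddable M S =
     {\<mu>. prob_space \<mu> \<and> sets \<mu> = UNIV \<and>
         (\<exists>\<tau>. randomized_stopping_time M S \<tau> \<and> embeds M S \<tau> \<mu> \<and>
              uniformly_integrable M (stopped_walk S \<tau>))}"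

section \<open>Centred measures and the barycentre function\<close>

definition g_rho :: "real \<Rightarrow> int \<Rightarrow> real" where
  "g_rho \<rho> k = \<rho> powi k - 1"

text \<open>The first sum is taken in the extended nonnegative reals, so that it implies that every
  \<open>\<mu> {y}\<close> is finite and passing to the real-valued \<^const>\<open>measure\<close> in the others loses nothing.\<close>

definition centred_measures :: "real \<Rightarrow> int measure set" where
  "centred_measures \<rho> =
     {\<mu>. sets \<mu> = UNIV \<and>
         (\<integral>\<^sup>+y. emeasure \<mu> {y} \<partial>count_space UNIV) = 1 \<and>
         (\<lambda>y. of_int \<bar>y\<bar> * measure \<mu> {y}) summable_on UNIV \<and>
         ((\<lambda>y. g_rho \<rho> y * measure \<mu> {y}) has_sum 0) UNIV}"

definition psi :: "real \<Rightarrow> int measure \<Rightarrow> real \<Rightarrow> ereal" where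
  "psi \<rho> \<mu> x =
     (let d = (\<Sum>\<^sub>\<infinity>k\<in>{k. g_rho \<rho> k \<ge> x}. measure \<mu> {k})
      in if d = 0 then \<infinity>
         else ereal ((\<Sum>\<^sub>\<infinity>k\<in>{k. g_rho \<rho> k \<ge> x}. g_rho \<rho> k * measure \<mu> {k}) / d))"

definition b_candidates :: "real \<Rightarrow> int measure \<Rightarrow> real \<Rightarrow> real set" where
  "b_candidates \<rho> \<mu> x =
     {g_rho \<rho> k | k. psi \<rho> \<mu> (g_rho \<rho> k) \<le> ereal x \<and> Lim (at_right (g_rho \<rho> k)) (psi \<rho> \<mu>) > ereal x}"

definition b_mu :: "real \<Rightarrow> int measure \<Rightarrow> real \<Rightarrow> real" where
  "b_mu \<rho> \<mu> x = (LEAST y. y \<in> b_candidates \<rho> \<mu> x)"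

section \<open>Randomized Azema--Yor stopping times\<close>

text \<open>Points at which \<^const>\<open>b_mu\<close> is undefined (no candidates) contribute no value.\<close>

definition ay_values :: "real \<Rightarrow> int measure \<Rightarrow> nat \<Rightarrow> real set" where
  "ay_values \<rho> \<mu> n =
     {b_mu \<rho> \<mu> x | x. g_rho \<rho> (int n) \<le> x \<and> x \<le> g_rho \<rho> (int n + 1) \<and> b_candidates \<rho> \<mu> x \<noteq> {}}"

text \<open>\<open>ay_bound \<rho> \<mu> n k\<close> is \<open>x\<^sup>n\<^sub>k\<close>, the \<open>k\<close>-th largest value, counted from \<open>k = 1\<close>;
  \<open>ay_m \<rho> \<mu> n\<close> is \<open>m\<^sub>n\<close>, one less than the number of values.\<close>

definition ay_bound :: "real \<Rightarrow> int measure \<Rightarrow> nat \<Rightarrow> nat \<Rightarrow> real" where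
  "ay_bound \<rho> \<mu> n k =
     (THE v. v \<in> ay_values \<rho> \<mu> n \<and> finite {w \<in> ay_values \<rho> \<mu> n. w \<ge> v} \<and>
             card {w \<in> ay_values \<rho> \<mu> n. w \<ge> v} = k)"

definition ay_m :: "real \<Rightarrow> int measure \<Rightarrow> nat \<Rightarrow> enat" where
  "ay_m \<rho> \<mu> n =
     (if finite (ay_values \<rho> \<mu> n) then enat (card (ay_values \<rho> \<mu> n) - 1) else \<infinity>)"

text \<open>Unless the process has been stopped, all coins tossed so far showed head, so the rule is in a
  state \<open>(n, k)\<close> that is a function of the path \<open>y\<close> of the transformed walk: the running maximum is
  \<open>g_rho \<rho> n\<close> and the lower bound is \<open>x\<^sup>n\<^sub>k\<close>. \<open>ay_state \<rho> \<mu> y t\<close> is the state after the arrival at \<open>y t\<close> and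
  before the toss at time \<open>t\<close>, if there is one. After a head the new lower bound lies strictly
  below the current position, so there is at most one toss at each time. States at times after the
  process has been stopped are irrelevant.\<close>

definition ay_first :: "real \<Rightarrow> int measure \<Rightarrow> nat \<Rightarrow> nat" where
  "ay_first \<rho> \<mu> n = (if ay_bound \<rho> \<mu> n 1 = g_rho \<rho> (int n + 1) then 2 else 1)"

fun ay_arrive :: "real \<Rightarrow> int measure \<Rightarrow> real \<Rightarrow> nat \<times> nat \<Rightarrow> nat \<times> nat" where
  "ay_arrive \<rho> \<mu> z (n, k) =
     (if z = g_rho \<rho> (int n + 1) then (Suc n, ay_first \<rho> \<mu> (Suc n)) else (n, k))"

fun ay_head :: "real \<Rightarrow> int measure \<Rightarrow> real \<Rightarrow> nat \<times> nat \<Rightarrow> nat \<times> nat" where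
  "ay_head \<rho> \<mu> z (n, k) =
     (if z = ay_bound \<rho> \<mu> n k \<and> enat k \<le> ay_m \<rho> \<mu> n then (n, Suc k) else (n, k))"

primrec ay_state :: "real \<Rightarrow> int measure \<Rightarrow> (nat \<Rightarrow> real) \<Rightarrow> nat \<Rightarrow> nat \<times> nat" where
  "ay_state \<rho> \<mu> y 0 = (0, ay_first \<rho> \<mu> 0)"
| "ay_state \<rho> \<mu> y (Suc t) = ay_arrive \<rho> \<mu> (y (Suc t)) (ay_head \<rho> \<mu> (y t) (ay_state \<rho> \<mu> y t))"

definition ay_toss :: "real \<Rightarrow> int measure \<Rightarrow> (nat \<Rightarrow> real) \<Rightarrow> nat \<Rightarrow> nat \<Rightarrow> nat \<Rightarrow> bool" where
  "ay_toss \<rho> \<mu> y t n k \<longleftrightarrow>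
     ay_state \<rho> \<mu> y t = (n, k) \<and> y t = ay_bound \<rho> \<mu> n k \<and> enat k \<le> ay_m \<rho> \<mu> n"

definition ay_sure_stop :: "real \<Rightarrow> int measure \<Rightarrow> (nat \<Rightarrow> real) \<Rightarrow> nat \<Rightarrow> bool" where
  "ay_sure_stop \<rho> \<mu> y t \<longleftrightarrow>
     (\<exists>n k. ay_state \<rho> \<mu> y t = (n, k) \<and> y t = ay_bound \<rho> \<mu> n k \<and> enat k = ay_m \<rho> \<mu> n + 1)"

text \<open>The coin tossed at time \<open>t\<close> is the one attached to the current history. Its tail probability has
  to be \<open>r n k\<close>. The infimum of the empty set is \<open>\<infinity>\<close>.\<close>

definition randomized_AY_time ::
  "'a measure \<Rightarrow> (nat \<Rightarrow> 'a \<Rightarrow> int) \<Rightarrow> real \<Rightarrow> int measure \<Rightarrow> ('a \<Rightarrow> enat) \<Rightarrow> bool" where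
  "randomized_AY_time M S \<rho> \<mu> \<tau> \<longleftrightarrow>
     (\<exists>q \<xi> (r :: nat \<Rightarrow> nat \<Rightarrow> real).
        coin_family M S q \<xi> \<and> coin_stopping_time M S \<xi> \<tau> \<and>
        (\<forall>n k. 1 \<le> k \<and> enat k \<le> ay_m \<rho> \<mu> n \<longrightarrow> 0 \<le> r n k \<and> r n k \<le> 1) \<and>
        (\<forall>\<omega>\<in>space M. let y = (\<lambda>t. g_rho \<rho> (S t \<omega>)) in
           (\<forall>t n k. ay_toss \<rho> \<mu> y t n k \<longrightarrow> q (history S t \<omega>) = r n k) \<and>
           \<tau> \<omega> = Inf (enat ` {t. ay_sure_stop \<rho> \<mu> y t \<or>
                                  (\<exists>n k. ay_toss \<rho> \<mu> y t n k) \<and> \<xi> (history S t \<omega>) \<omega>})))"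

end

theory Submission
  imports Defs
begin

text \<open>
  The process \<open>g (S t)\<close> is a martingale. Let \<open>F k\<close> and \<open>G k\<close> be the mass and the first moment of \<open>\<mu>\<close>
  above \<open>g k\<close>. If level \<open>n\<close> is reached unstopped with probability \<open>H\<close>, then the mass stopped before has
  to be the part of \<open>\<mu>\<close> below its upper \<open>H\<close>-quantile, and optional stopping forces the upper part to have
  barycentre \<open>g n\<close>. This determines \<open>H\<close> (\<open>reach n\<close>), hence the mass \<open>\<nu> n j\<close> to be stopped at \<open>j\<close> while
  the maximum is \<open>n\<close>, hence the tail probabilities. That these probabilities do produce \<open>\<nu>\<close> follows by testing
  the killed chain of positions and states with functions that live on a single state, respectively
  level, and are affine in \<open>g\<close> there: each identity is optional stopping for one excursion, and no division
  by the probability of reaching the state is needed.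

  Once the law is known to be \<open>\<mu>\<close>, uniform integrability follows from \<open>\<bar>S t\<bar> \<le> t\<close> and a finite mean of
  \<open>\<tau>\<close>. The drift of \<open>S\<close> reduces the latter to a bound on the mean of the negative part of the stopped walk,
  which comes from Jensen's inequality, because \<open>- s\<close> is convex in \<open>g s\<close>.
\<close>

text \<open>For the unstopped walk the harmonic functions are spanned by \<open>1\<close> and
  \<open>g\<close>. In level \<open>n\<close> the combination \<open>gap n = g (n + 1) - g\<close>
  vanishes at the exit to the next level, so its balance involves only the mass that enters the
  level and the mass that is stopped there. This is why the weights
  \<open>\<nu> n j * gap n j\<close>, rather than the masses themselves, add up along the lower
  bounds.

  Level 0 may have infinitely many lower bounds, so it is not exhausted by arriving at a last one,
  and sums over time and over position cannot be interchanged freely. Each single bound is reached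
  by induction, which gives lower estimates for the stopped mass on finite sets of positions;
  conservation of mass and of \<open>g\<close> supplies the matching upper estimates. The same
  squeeze shows that no mass stays in a level forever, and it also yields the law.

  All this is computed with a linear functional on functions of position and state. Probability
  enters only afterwards, when that functional is written as a finite sum over paths with products
  of walk and coin probabilities as weights.\<close>

lemma has_sum_minus:
  fixes f h :: "'b \<Rightarrow> real"
  assumes "(f has_sum a) A" "(h has_sum b) A"
  shows "((\<lambda>x. f x - h x) has_sum a - b) A"
  using has_sum_add[OF assms(1), of "\<lambda>x. - h x" "- b"] assms(2) by (simp add: has_sum_uminus)

lemma int_last_true:
  fixes P :: "int \<Rightarrow> bool"
  assumes "P a" "\<And>k. P k \<Longrightarrow> k \<le> c"
  shows "\<exists>k. P k \<and> \<not> P (k + 1)"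
proof (rule ccontr)
  assume *: "\<not> ?thesis"
  have "P (a + int i)" for i
  proof (induction i)
    case (Suc i)
    then show ?case using * by (metis add.assoc of_nat_Suc add.commute)
  qed (simp add: assms)
  from assms(2)[OF this[of "nat (c - a) + 1"]] assms(2)[OF assms(1)] show False
    by simp
qed

text \<open>Telescoping bounds the total loss by the initial stock plus all gains. With
  \<open>d t\<close> proportional to the mass present at time \<open>t\<close>, this bounds a mean
  sojourn time.\<close>

lemma summable_of_decrease:
  fixes a d u :: "nat \<Rightarrow> real"
  assumes "\<And>t. a (Suc t) \<le> a t - d t + u t" "\<And>t. 0 \<le> a t" "\<And>t. 0 \<le> d t" "\<And>t. 0 \<le> u t" "summable u"
  shows "summable d"
proof (rule summableI_nonneg_bounded[where x = "a 0 + suminf u"])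
  fix T
  have "(\<Sum>t<T. d t) \<le> a 0 - a T + (\<Sum>t<T. u t)"
  proof (induction T)
    case (Suc T)
    then show ?case using assms(1)[of T] by simp
  qed simp
  also have "\<dots> \<le> a 0 + suminf u"
    using assms(2)[of T] sum_le_suminf[OF assms(5), of "{..<T}"] assms(4) by simp
  finally show "(\<Sum>t<T. d t) \<le> a 0 + suminf u" .
qed (rule assms(3))

lemma sums_of_bounded:
  fixes f :: "nat \<Rightarrow> real"
  assumes "\<And>t. 0 \<le> f t" "\<And>T. (\<Sum>t<T. f t) \<le> C"
  shows "f sums suminf f" "suminf f \<le> C"
  using summableI_nonneg_bounded[OF assms] suminf_le_const[OF _ assms(2)] by auto

section \<open>The scale function of the walk\<close>

locale drift =
  fixes p \<rho> :: real
  assumes p_pos: "0 < p" and p_half: "p < 1 / 2" and rho: "\<rho> = (1 - p) / p"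
begin

abbreviation g :: "int \<Rightarrow> real" where "g \<equiv> g_rho \<rho>"

lemma rho_gt_1: "1 < \<rho>"
  using p_pos p_half by (simp add: rho field_simps)

lemma g_0 [simp]: "g 0 = 0"
  by (simp add: g_rho_def)

lemma g_add_1: "g (s + 1) = \<rho> * (g s + 1) - 1"
  using rho_gt_1 by (simp add: g_rho_def power_int_add_1')

lemma g_gt: "- 1 < g s"
  using rho_gt_1 by (simp add: g_rho_def)

lemma g_strict_mono: "strict_mono g"
  using rho_gt_1 by (auto simp: strict_mono_def g_rho_def intro: power_int_strict_increasing)

lemmas g_less_iff [simp] = strict_mono_less[OF g_strict_mono]
  and g_le_iff [simp] = strict_mono_less_eq[OF g_strict_mono]
  and g_eq_iff [simp] = strict_mono_eq[OF g_strict_mono]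

lemma g_neg_iff [simp]: "g i < 0 \<longleftrightarrow> i < 0"
  using g_less_iff[of i 0] by simp

lemma g_pos_iff [simp]: "0 < g i \<longleftrightarrow> 0 < i"
  using g_less_iff[of 0 i] by simp

lemma g_nonneg_iff [simp]: "0 \<le> g i \<longleftrightarrow> 0 \<le> i"
  using g_le_iff[of 0 i] by simp

lemma g_harmonic: "p * g (s + 1) + (1 - p) * g (s - 1) = g s"
proof -
  have a: "g (s + 1) = \<rho> * (g s + 1) - 1" "g s = \<rho> * (g (s - 1) + 1) - 1"
    using g_add_1[of s] g_add_1[of "s - 1"] by auto
  have b: "p * \<rho> = 1 - p"
    using p_pos by (simp add: rho)
  have "p * g (s + 1) = (p * \<rho>) * (g s + 1) - p"
    unfolding a(1) by (simp add: algebra_simps)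
  moreover have "p * g s = (p * \<rho>) * (g (s - 1) + 1) - p"
    by (subst a(2)) (simp add: algebra_simps)
  ultimately show ?thesis
    unfolding b by (simp add: algebra_simps)
qed

end

section \<open>The stopped mass at each level\<close>

locale centred = drift +
  fixes \<mu> :: "int measure"
  assumes centred: "\<mu> \<in> centred_measures \<rho>"
begin

section \<open>Tail masses and tail moments of the target measure\<close>

definition m :: "int \<Rightarrow> real" where "m k = measure \<mu> {k}"
definition F :: "int \<Rightarrow> real" where "F k = (\<Sum>\<^sub>\<infinity>j\<in>{k..}. m j)"
definition G :: "int \<Rightarrow> real" where "G k = (\<Sum>\<^sub>\<infinity>j\<in>{k..}. g j * m j)"

text \<open>That is, \<open>\<psi>\<^sub>\<mu>(g k) \<le> x\<close>.\<close>

definition bary_le :: "int \<Rightarrow> real \<Rightarrow> bool" where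
  "bary_le k x \<longleftrightarrow> 0 < F k \<and> G k \<le> x * F k"

lemma sets_mu: "sets \<mu> = UNIV" and space_mu: "space \<mu> = UNIV"
  using centred sets_eq_imp_space_eq[of \<mu> "count_space UNIV"] by (auto simp: centred_measures_def)

lemma emeasure_mu_UNIV: "emeasure \<mu> UNIV = 1"
proof -
  have "emeasure \<mu> UNIV = (\<integral>\<^sup>+y. emeasure \<mu> {y} \<partial>count_space UNIV)"
    by (rule emeasure_countable_singleton) (auto simp: sets_mu)
  then show ?thesis
    using centred by (simp add: centred_measures_def)
qed

lemma prob_space_mu: "prob_space \<mu>"
  by (rule prob_spaceI) (simp add: space_mu emeasure_mu_UNIV)

lemma m_nonneg [simp]: "0 \<le> m k"
  by (simp add: m_def)

lemma m_has_sum: "(m has_sum 1) UNIV"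
proof -
  interpret prob_space \<mu> by (rule prob_space_mu)
  have "(\<lambda>i. measure \<mu> {int_decode i}) sums measure \<mu> (\<Union>i. {int_decode i})"
    by (rule finite_measure_UNION) (auto simp: sets_mu disjoint_family_on_def inj_eq[OF inj_int_decode])
  moreover have "(\<Union>i. {int_decode i}) = UNIV"
    using surj_int_decode by auto
  ultimately have "(\<lambda>i. m (int_decode i)) sums 1"
    using prob_space by (simp add: m_def space_mu)
  then have "((\<lambda>i. m (int_decode i)) has_sum 1) UNIV"
    by (rule sums_nonneg_imp_has_sum) simp
  then show ?thesis
    by (simp add: has_sum_reindex_bij_betw[OF bij_int_decode])
qed

lemma gm_has_sum: "((\<lambda>k. g k * m k) has_sum 0) UNIV"
  using centred by (simp add: centred_measures_def m_def)

lemma absm_summable: "(\<lambda>k. \<bar>of_int k\<bar> * m k) summable_on UNIV"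
  using centred by (simp add: centred_measures_def m_def)

lemma m_summable [simp]: "m summable_on A"
  using m_has_sum summable_on_subset_banach has_sum_imp_summable by blast

lemma gm_summable [simp]: "(\<lambda>k. g k * m k) summable_on A"
  using gm_has_sum summable_on_subset_banach has_sum_imp_summable by blast

lemma F_nonneg [simp]: "0 \<le> F k"
  unfolding F_def by (rule infsum_nonneg) simp

lemma F_rec: "F k = m k + F (k + 1)"
proof -
  have "{k..} = {k} \<union> {k + 1..}" by auto
  then show ?thesis
    unfolding F_def by (simp only:) (subst infsum_Un_disjoint, auto)
qed

lemma G_rec: "G k = g k * m k + G (k + 1)"
proof -
  have "{k..} = {k} \<union> {k + 1..}" by auto
  then show ?thesis
    unfolding G_def by (simp only:) (subst infsum_Un_disjoint, auto)
qed

lemma F_antimono: "j \<le> k \<Longrightarrow> F k \<le> F j"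
  unfolding F_def by (rule infsum_mono2) auto

lemma F_below: "(m has_sum 1 - F k) {..<k}"
proof -
  have "(m has_sum (infsum m {..<k} + F k)) ({..<k} \<union> {k..})"
    unfolding F_def by (rule has_sum_Un_disjoint) auto
  moreover have "{..<k} \<union> {k..} = UNIV" by auto
  ultimately have "infsum m {..<k} + F k = 1"
    using m_has_sum has_sum_unique by metis
  then have "infsum m {..<k} = 1 - F k" by simp
  then show ?thesis
    by (metis has_sum_infsum m_summable)
qed

lemma G_below: "((\<lambda>k. g k * m k) has_sum - G k) {..<k}"
proof -
  let ?f = "\<lambda>k. g k * m k"
  have "(?f has_sum (infsum ?f {..<k} + G k)) ({..<k} \<union> {k..})"
    unfolding G_def by (rule has_sum_Un_disjoint) auto
  moreover have "{..<k} \<union> {k..} = UNIV" by auto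
  ultimately have "infsum ?f {..<k} + G k = 0"
    using gm_has_sum has_sum_unique by metis
  then have "infsum ?f {..<k} = - G k" by simp
  then show ?thesis
    by (metis has_sum_infsum gm_summable)
qed

lemma G_ge: "g k * F k \<le> G k"
  unfolding F_def G_def
  by (subst infsum_cmult_right'[symmetric], rule infsum_mono)
    (auto intro!: mult_right_mono summable_on_cmult_right)

text \<open>For \<open>k \<ge> 0\<close> all terms are nonnegative; for \<open>k < 0\<close> the
  complementary moment, which is \<open>- G k\<close>, has only nonpositive terms.\<close>

lemma G_nonneg [simp]: "0 \<le> G k"
proof (cases "0 \<le> k")
  case True
  then have "0 \<le> g k * F k"
    by (intro mult_nonneg_nonneg) auto
  then show ?thesis
    using G_ge[of k] by linarith
next
  case False
  have "- G k \<le> 0"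
    using False by (intro has_sum_mono[OF G_below, of "\<lambda>_. 0"]) (auto simp: mult_nonpos_nonneg less_imp_le)
  then show ?thesis by simp
qed

text \<open>The barycentre of a tail is at least its left end (\<open>G_ge\<close>), so
  \<open>g k < g (k + 1) \<le> x\<close>. The atom added at \<open>k\<close> lies below
  \<open>x\<close> and cannot lift the barycentre above \<open>x\<close>.\<close>

lemma bary_le_pred:
  assumes "bary_le (k + 1) x"
  shows "bary_le k x"
proof -
  have F: "0 < F (k + 1)" and G: "G (k + 1) \<le> x * F (k + 1)"
    using assms by (auto simp: bary_le_def)
  have "g (k + 1) * F (k + 1) \<le> x * F (k + 1)"
    using G_ge[of "k + 1"] G by linarith
  then have "g (k + 1) \<le> x" using F by simp
  then have "g k \<le> x" using g_le_iff[of k "k + 1"] by linarith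
  then have "g k * m k \<le> x * m k" by (rule mult_right_mono) simp
  moreover have "0 < F k"
    using F F_rec[of k] m_nonneg[of k] by linarith
  ultimately show ?thesis
    using G F_rec[of k] G_rec[of k] by (simp add: bary_le_def algebra_simps)
qed

lemma bary_le_antimono:
  assumes "bary_le k x" "j \<le> k"
  shows "bary_le j x"
  using assms(2)
proof (induction j rule: int_le_induct)
  case (step i)
  then show ?case using bary_le_pred[of "i - 1" x] by simp
qed (rule assms(1))

lemma bary_le_mono: "bary_le k x \<Longrightarrow> x \<le> y \<Longrightarrow> bary_le k y"
  unfolding bary_le_def by (meson mult_right_mono F_nonneg order_trans)

lemma bary_le_imp: "bary_le k x \<Longrightarrow> g k \<le> x"
  using G_ge[of k] mult_right_le_imp_le[of "g k" "F k" x] unfolding bary_le_def by linarith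

lemma F_gt: "\<epsilon> > 0 \<Longrightarrow> \<exists>k<0. 1 - \<epsilon> < F k"
proof -
  assume "\<epsilon> > 0"
  then obtain A where A: "finite A" "dist (sum m A) 1 < \<epsilon>"
    using has_sum_finite_approximation[OF m_has_sum, of "\<epsilon> / 2"] by (smt (verit) field_sum_of_halves)
  define k where "k = Min (insert (- 1) A)"
  have "k \<le> - 1" "A \<subseteq> {k..}"
    using A(1) by (auto simp: k_def)
  then have "sum m A \<le> F k"
    unfolding F_def using A(1) by (intro finite_sum_le_infsum) auto
  with A(2) \<open>k \<le> - 1\<close> show ?thesis
    by (intro exI[of _ k]) (auto simp: dist_real_def)
qed

text \<open>Since \<open>g > - 1\<close> and the total moment is 0,
  \<open>G k \<le> 1 - F k\<close>. This is at most \<open>x * F k\<close> once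
  \<open>F k > 1 / (1 + x)\<close>, and \<open>F k\<close> tends to 1 as \<open>k\<close>
  falls.\<close>

lemma bary_le_exists:
  assumes "0 < x"
  shows "\<exists>k. bary_le k x"
proof -
  obtain k where k: "k < 0" "1 - x / (1 + x) < F k"
    using F_gt[of "x / (1 + x)"] assms by auto
  have "1 - x / (1 + x) = 1 / (1 + x)"
    using assms by (simp add: field_simps)
  then have k2: "1 < (1 + x) * F k"
    using k(2) assms by (simp add: field_simps)
  have "- 1 * m j \<le> g j * m j" for j
    using g_gt[of j] by (intro mult_right_mono) auto
  then have "- 1 * (1 - F k) \<le> - G k"
    by (intro has_sum_mono[OF has_sum_cmult_right[OF F_below] G_below]) simp
  then have "G k \<le> x * F k"
    using k2 by (simp add: algebra_simps)
  moreover have "0 < F k"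
    using k2 F_nonneg[of k] by (cases "F k = 0") (auto simp: less_le)
  ultimately show ?thesis
    unfolding bary_le_def by blast
qed

lemma bary_last_exists:
  assumes "0 < n"
  shows "\<exists>k. bary_le k (g n) \<and> \<not> bary_le (k + 1) (g n)"
proof -
  obtain a where "bary_le a (g n)"
    using bary_le_exists[of "g n"] assms by auto
  then show ?thesis
    by (rule int_last_true[where c = n]) (use bary_le_imp in force)
qed

section \<open>The barycentre function and the values of \<open>b_mu\<close> in terms of
  exponents\<close>

lemma psi_eq: "psi \<rho> \<mu> (g k) = (if F k = 0 then \<infinity> else ereal (G k / F k))"
proof -
  have "{j. g k \<le> g j} = {k..}" by auto
  then show ?thesis
    by (simp add: psi_def F_def G_def m_def Let_def)
qed

lemma psi_le_iff: "psi \<rho> \<mu> (g k) \<le> ereal x \<longleftrightarrow> bary_le k x"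
  using F_nonneg[of k] by (simp add: psi_eq bary_le_def divide_le_eq order.strict_iff_order)

text \<open>No value of \<open>g\<close> lies strictly between \<open>g k\<close> and
  \<open>g (k + 1)\<close>, so \<open>psi\<close> is constant just to the right of
  \<open>g k\<close>.\<close>

lemma psi_right_limit: "Lim (at_right (g k)) (psi \<rho> \<mu>) = psi \<rho> \<mu> (g (k + 1))"
proof (rule tendsto_Lim)
  have "psi \<rho> \<mu> x = psi \<rho> \<mu> (g (k + 1))" if "g k < x" "x < g (k + 1)" for x
  proof -
    have "{j. x \<le> g j} = {j. g (k + 1) \<le> g j}"
    proof -
      have "x \<le> g j \<longleftrightarrow> g (k + 1) \<le> g j" for j
      proof
        assume "x \<le> g j"
        then have "g k < g j" using that by linarith
        then show "g (k + 1) \<le> g j" by simp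
      qed (use that in linarith)
      then show ?thesis by simp
    qed
    then show ?thesis by (simp only: psi_def)
  qed
  then have "eventually (\<lambda>x. psi \<rho> \<mu> x = psi \<rho> \<mu> (g (k + 1))) (at_right (g k))"
    unfolding eventually_at_right_field by (intro exI[of _ "g (k + 1)"]) auto
  then show "(psi \<rho> \<mu> \<longlongrightarrow> psi \<rho> \<mu> (g (k + 1))) (at_right (g k))"
    by (rule tendsto_eventually)
qed simp

lemma b_candidates_eq: "b_candidates \<rho> \<mu> x = {g k |k. bary_le k x \<and> \<not> bary_le (k + 1) x}"
  by (simp add: b_candidates_def psi_right_limit psi_le_iff[symmetric] not_le)

text \<open>By monotonicity \<open>bary_le\<close> switches off at most once, so the minimum in
  \<open>b_mu\<close> is taken over at most one point.\<close>

lemma bary_last_unique: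
  assumes "bary_le i x" "\<not> bary_le (i + 1) x" "bary_le j x" "\<not> bary_le (j + 1) x"
  shows "i = j"
proof (rule antisym)
  show "i \<le> j"
    using assms(1,4) bary_le_antimono[of i x "j + 1"] by (cases "i \<le> j") auto
  show "j \<le> i"
    using assms(2,3) bary_le_antimono[of j x "i + 1"] by (cases "j \<le> i") auto
qed

lemma b_mu_eq:
  assumes "bary_le k x" "\<not> bary_le (k + 1) x"
  shows "b_mu \<rho> \<mu> x = g k"
proof -
  have "b_candidates \<rho> \<mu> x = {g k}"
    using assms by (auto simp: b_candidates_eq dest: bary_last_unique[OF assms])
  then show ?thesis
    by (simp add: b_mu_def Least_equality)
qed

text \<open>The exponents of the possible lower bounds at level \<open>n\<close>.\<close>

definition V :: "nat \<Rightarrow> int set" where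
  "V n = {k. \<exists>x. g n \<le> x \<and> x \<le> g (int n + 1) \<and> bary_le k x \<and> \<not> bary_le (k + 1) x}"

lemma ay_values_eq: "ay_values \<rho> \<mu> n = g ` V n"
proof (intro equalityI subsetI)
  fix v assume "v \<in> ay_values \<rho> \<mu> n"
  then obtain x where x: "v = b_mu \<rho> \<mu> x" "g n \<le> x" "x \<le> g (int n + 1)" "b_candidates \<rho> \<mu> x \<noteq> {}"
    unfolding ay_values_def by auto
  then obtain k where k: "bary_le k x" "\<not> bary_le (k + 1) x"
    by (auto simp: b_candidates_eq)
  then have "k \<in> V n"
    using x(2,3) unfolding V_def by auto
  then show "v \<in> g ` V n"
    using x(1) b_mu_eq[OF k] by auto
next
  fix v assume "v \<in> g ` V n"
  then obtain k x where k: "v = g k" "g n \<le> x" "x \<le> g (int n + 1)" "bary_le k x" "\<not> bary_le (k + 1) x"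
    unfolding V_def by auto
  have c: "b_candidates \<rho> \<mu> x \<noteq> {}"
    unfolding b_candidates_eq using k(4,5) by blast
  have "v = b_mu \<rho> \<mu> x"
    using k(1) b_mu_eq[OF k(4,5)] by simp
  then show "v \<in> ay_values \<rho> \<mu> n"
    unfolding ay_values_def by (intro CollectI exI[of _ x] conjI k(2,3) c)
qed

lemma V_le: "k \<in> V n \<Longrightarrow> k \<le> int n + 1"
  unfolding V_def by (auto dest!: bary_le_imp) (metis g_le_iff order_trans)

text \<open>The exponent of \<open>b_mu\<close> at \<open>g n\<close>. It may fail to exist for
  \<open>n = 0\<close>, which is why its properties are stated for positive levels and
  \<open>reach\<close> and \<open>filled\<close> treat \<open>n = 0\<close> separately.\<close>

definition bi :: "nat \<Rightarrow> int" where
  "bi n = (SOME k. bary_le k (g n) \<and> \<not> bary_le (k + 1) (g n))"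

lemma bi:
  assumes "0 < n"
  shows "bary_le (bi n) (g n)" "\<not> bary_le (bi n + 1) (g n)"
  using someI_ex[OF bary_last_exists[of "int n"]] assms unfolding bi_def by auto

lemma bi_le: "0 < n \<Longrightarrow> bi n \<le> n"
  using bary_le_imp[OF bi(1)] by simp

lemma bi_mono: "0 < n \<Longrightarrow> bi n \<le> bi (Suc n)"
proof (rule ccontr)
  assume n: "0 < n" and "\<not> ?thesis"
  then have "bary_le (bi (Suc n) + 1) (g n)"
    using bi(1) bary_le_antimono by (meson not_le zless_imp_add1_zle)
  then show False
    using bi(2)[of "Suc n"] bary_le_mono[of _ "g n" "g (int (Suc n))"] by auto
qed

lemma bi_in_V: "0 < n \<Longrightarrow> bi n \<in> V n" "bi (Suc n) \<in> V n"
proof -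
  show "0 < n \<Longrightarrow> bi n \<in> V n"
    unfolding V_def using bi[of n] by (intro CollectI exI[of _ "g n"]) auto
  show "bi (Suc n) \<in> V n"
    unfolding V_def using bi[of "Suc n"] by (intro CollectI exI[of _ "g (int n + 1)"]) (auto simp: add.commute)
qed

text \<open>The probability of reaching level \<open>n\<close> unstopped. The equation that determines it is
  \<open>reach_mult\<close> below; the case distinction avoids the quotient \<open>0 / 0\<close>.\<close>

definition reach :: "nat \<Rightarrow> real" where
  "reach n =
     (if n = 0 then 1 else if bi n = n then F n else (G (bi n) - g (bi n) * F (bi n)) / (g n - g (bi n)))"

lemma reach_0 [simp]: "reach 0 = 1"
  by (simp add: reach_def)

text \<open>The mass left for level \<open>n\<close> consists of everything above
  \<open>bi n\<close> and the part \<open>reach n - F (bi n + 1)\<close> of the atom at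
  \<open>bi n\<close>. The equation says that its moment is \<open>g n * reach n\<close>.\<close>

lemma reach_mult:
  assumes "0 < n"
  shows "reach n * (g n - g (bi n)) = G (bi n) - g (bi n) * F (bi n)"
proof (cases "bi n = n")
  case True
  \<comment> \<open>Here \<open>G n = g n * F n\<close> and both sides vanish, so the equation
    leaves \<open>reach n\<close> free. The value \<open>F n\<close> makes \<open>filled n n\<close>
    zero: position \<open>n\<close> cannot be occupied before level \<open>n\<close> is
    entered.\<close>
  then show ?thesis
    using bi(1)[OF assms] G_ge[of "bi n"] by (auto simp: bary_le_def)
next
  case False
  then show ?thesis
    using assms by (simp add: reach_def)
qed

text \<open>The tail from \<open>bi n\<close> has barycentre at most \<open>g n\<close>, the tail
  from the next point does not; put into \<open>reach_mult\<close>, each fact gives one bound. Hence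
  the atom at \<open>bi n\<close> is the only one that is split.\<close>

lemma reach_bounds:
  assumes "0 < n"
  shows "F (bi n + 1) \<le> reach n" "reach n \<le> F (bi n)"
proof -
  let ?b = "bi n"
  have "F (?b + 1) \<le> reach n \<and> reach n \<le> F ?b"
  proof (cases "?b = n")
    case True
    then show ?thesis
      using assms F_antimono[of "int n" "int n + 1"] by (simp add: reach_def)
  next
    case False
    then have pos: "0 < g n - g ?b"
      using bi_le[OF assms] by simp
    have "G ?b \<le> g n * F ?b"
      using bi(1)[OF assms] by (simp add: bary_le_def)
    then have "reach n * (g n - g ?b) \<le> F ?b * (g n - g ?b)"
      unfolding reach_mult[OF assms] by (simp add: algebra_simps)
    moreover have "g n * F (?b + 1) \<le> G (?b + 1)"
    proof (cases "F (?b + 1) = 0")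
      case False
      then show ?thesis
        using bi(2)[OF assms] F_nonneg[of "?b + 1"] by (auto simp: bary_le_def)
    qed simp
    then have "F (?b + 1) * (g n - g ?b) \<le> reach n * (g n - g ?b)"
      unfolding reach_mult[OF assms] using F_rec[of ?b] G_rec[of ?b] by (simp add: algebra_simps)
    ultimately show ?thesis
      using pos by (auto dest: mult_right_le_imp_le)
  qed
  then show "F (?b + 1) \<le> reach n" "reach n \<le> F ?b" by auto
qed

lemma reach_nonneg: "0 \<le> reach n"
  using reach_bounds(1)[of n] order_trans[OF F_nonneg] by (cases "n = 0") auto

text \<open>The mass of position \<open>j\<close> that is filled before level \<open>n\<close> is reached.\<close>

definition filled :: "nat \<Rightarrow> int \<Rightarrow> real" where
  "filled n j =
     (if n = 0 then 0 else if j < bi n then m j else if j = bi n then F j - reach n else 0)"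

definition \<nu> :: "nat \<Rightarrow> int \<Rightarrow> real" where
  "\<nu> n j = filled (Suc n) j - filled n j"

lemma filled_0 [simp]: "filled 0 j = 0"
  by (simp add: filled_def)

lemma filled_nonneg: "0 \<le> filled n j"
  using reach_bounds(2)[of n] by (auto simp: filled_def)

text \<open>With the same split atom the right-hand side of \<open>reach_mult\<close> stays the same
  while the factor of \<open>reach\<close> grows.\<close>

lemma reach_antimono_aux:
  assumes "0 < n" "bi (Suc n) = bi n"
  shows "reach (Suc n) \<le> reach n"
proof -
  let ?b = "bi n"
  have *: "reach (Suc n) * (g (int n + 1) - g ?b) = reach n * (g n - g ?b)"
    using reach_mult[OF assms(1)] reach_mult[of "Suc n"] assms(2) by (simp add: add.commute)
  have "g n < g (int n + 1)" "g ?b \<le> g n"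
    using bi_le[OF assms(1)] by (simp_all del: g_less_iff add: g_less_iff)
  then have "reach n * (g n - g ?b) \<le> reach n * (g (int n + 1) - g ?b)" "0 < g (int n + 1) - g ?b"
    using reach_nonneg[of n] by (auto intro!: mult_left_mono)
  with * show ?thesis
    using mult_right_le_imp_le[of "reach (Suc n)" "g (int n + 1) - g ?b" "reach n"] by linarith
qed

lemma \<nu>_nonneg: "0 \<le> \<nu> n j"
proof (cases "n = 0")
  case True
  then show ?thesis
    using filled_nonneg[of "Suc n" j] by (simp add: \<nu>_def)
next
  case False
  then have n: "0 < n" by simp
  note bi_mono[OF n] reach_bounds[OF n] reach_bounds[of "Suc n"] reach_antimono_aux[OF n] F_rec[of "bi n"]
  then show ?thesis
    using n by (auto simp: \<nu>_def filled_def)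
qed

text \<open>Membership in \<open>V n\<close> means that the half-open interval from
  \<open>psi\<close> at \<open>g j\<close> to \<open>psi\<close> at \<open>g (j + 1)\<close> meets
  the interval from \<open>g n\<close> to \<open>g (n + 1)\<close>. Positive mass gives one
  inequality between the ends (\<open>up\<close>) and the other (\<open>low\<close>); what remains
  is to find a common point.\<close>

lemma \<nu>_in_V:
  assumes "\<nu> n j \<noteq> 0"
  shows "j \<in> V n"
proof -
  have "0 < \<nu> n j"
    using assms \<nu>_nonneg[of n j] by simp
  then have pos: "0 < filled (Suc n) j"
    using filled_nonneg[of n j] by (simp add: \<nu>_def)
  then have le: "j \<le> bi (Suc n)"
    by (auto simp: filled_def split: if_splits)
  have up: "bary_le j (g (int n + 1))"
    using bary_le_antimono[OF bi(1) le] by (simp add: add.commute)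
  have Fj: "0 < F j" using up by (simp add: bary_le_def)
  have low: "\<not> bary_le (j + 1) (g n)"
  proof (cases "n = 0")
    case True
    show ?thesis
    proof
      assume "bary_le (j + 1) (g n)"
      then have 1: "0 < F (j + 1)" "G (j + 1) = 0"
        using True G_nonneg[of "j + 1"] by (auto simp: bary_le_def)
      have "g (j + 1) * F (j + 1) \<le> 0"
        using G_ge[of "j + 1"] 1 by simp
      then have j: "j < 0"
        using 1(1) by (smt (verit) g_pos_iff mult_pos_pos)
      \<comment> \<open>As \<open>G (j + 1) = 0\<close>, an atom at \<open>j < 0\<close> would make
        \<open>G j\<close> negative. Without an atom, \<open>j\<close> could carry mass only as the
        split point \<open>bi (Suc n)\<close>, which \<open>bary_le (j + 1)\<close>
        excludes.\<close>
      have "m j = 0"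
      proof (rule ccontr)
        assume "m j \<noteq> 0"
        then have "g j * m j < 0"
          using j m_nonneg[of j] by (intro mult_neg_pos) (simp, simp add: less_le)
        then show False
          using G_rec[of j] 1(2) G_nonneg[of j] by simp
      qed
      then have "j = bi (Suc n)"
        using le pos by (auto simp: filled_def split: if_splits)
      then show False
        using bi(2)[of "Suc n"] bary_le_mono[OF \<open>bary_le (j + 1) (g n)\<close>, of "g (int (Suc n))"] by simp
    qed
  next
    case False
    then have n: "0 < n" by simp
    have "bi n \<le> j"
    proof (rule ccontr)
      assume "\<not> ?thesis"
      then show False
        using assms bi_mono[OF n] n by (auto simp: \<nu>_def filled_def)
    qed
    then show ?thesis
      using bi(2)[OF n] bary_le_antimono[of "j + 1" "g n" "bi n + 1"] by auto
  qed
  show ?thesis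
  proof (cases "bary_le j (g n)")
    case True
    then show ?thesis
      unfolding V_def using low by (intro CollectI exI[of _ "g n"]) auto
  next
    case False
    show ?thesis
    proof (cases "bary_le (j + 1) (g (int n + 1))")
      case False
      then show ?thesis
        unfolding V_def using up by (intro CollectI exI[of _ "g (int n + 1)"]) auto
    next
      case True
      have j_less: "j < bi (Suc n)"
        using True bi(2)[of "Suc n"] le by (cases "j = bi (Suc n)") (auto simp: add.commute)
      then have mj: "0 < m j"
        using pos by (auto simp: filled_def split: if_splits)
      \<comment> \<open>The common point is now \<open>psi\<close> at \<open>g j\<close>: since
        \<open>j\<close> carries an atom, \<open>psi\<close> is strictly larger one step
        further.\<close>
      define x where "x = G j / F j"
      have "bary_le j x"
        using Fj by (simp add: bary_le_def x_def)
      moreover have "g n \<le> x"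
        using False Fj by (simp add: bary_le_def x_def field_simps)
      moreover have "x \<le> g (int n + 1)"
        using up Fj by (simp add: bary_le_def x_def field_simps)
      moreover have "\<not> bary_le (j + 1) x"
      proof
        assume *: "bary_le (j + 1) x"
        then have "g (j + 1) \<le> x" by (rule bary_le_imp)
        then have "g j < x" using g_less_iff[of j "j + 1"] by linarith
        then have "g j * m j < x * m j" using mj by simp
        moreover have "G (j + 1) \<le> x * F (j + 1)" using * by (simp add: bary_le_def)
        ultimately have "G j < x * F j"
          using G_rec[of j] F_rec[of j] by (simp add: algebra_simps)
        then show False using Fj by (simp add: x_def)
      qed
      ultimately show ?thesis
        unfolding V_def by blast
    qed
  qed
qed

lemma filled_has_sum: "(filled n has_sum 1 - reach n) UNIV"
proof (cases "n = 0")
  case False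
  have "(filled n has_sum (1 - F (bi n)) + (F (bi n) - reach n)) ({..<bi n} \<union> {bi n})"
  proof (rule has_sum_Un_disjoint)
    show "(filled n has_sum 1 - F (bi n)) {..<bi n}"
      using False by (intro has_sum_cong[THEN iffD1, OF _ F_below]) (auto simp: filled_def)
    show "(filled n has_sum F (bi n) - reach n) {bi n}"
      using False by (auto intro!: has_sum_finiteI simp: filled_def)
  qed auto
  then have "(filled n has_sum 1 - reach n) ({..<bi n} \<union> {bi n})"
    by simp
  then show ?thesis
    by (rule has_sum_cong_neutral[THEN iffD1, rotated -1]) (auto simp: filled_def)
qed (simp add: filled_def[abs_def])

text \<open>What optional stopping demands on entry to level \<open>n\<close>: the moment of the
  mass stopped before and \<open>g n\<close> times the remaining mass cancel.\<close>

lemma filled_g_has_sum: "((\<lambda>j. g j * filled n j) has_sum - (g n * reach n)) UNIV"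
proof (cases "n = 0")
  case False
  then have n: "0 < n" by simp
  let ?f = "\<lambda>j. g j * filled n j"
  have "(?f has_sum (- G (bi n)) + g (bi n) * (F (bi n) - reach n)) ({..<bi n} \<union> {bi n})"
  proof (rule has_sum_Un_disjoint)
    show "(?f has_sum - G (bi n)) {..<bi n}"
      using False by (intro has_sum_cong[THEN iffD1, OF _ G_below]) (auto simp: filled_def)
    show "(?f has_sum g (bi n) * (F (bi n) - reach n)) {bi n}"
      using False by (auto intro!: has_sum_finiteI simp: filled_def)
  qed auto
  moreover have "(- G (bi n)) + g (bi n) * (F (bi n) - reach n) = - (g n * reach n)"
    using reach_mult[OF n] by (simp add: algebra_simps)
  ultimately have "(?f has_sum - (g n * reach n)) ({..<bi n} \<union> {bi n})"
    by simp
  then show ?thesis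
    by (rule has_sum_cong_neutral[THEN iffD1, rotated -1]) (auto simp: filled_def)
qed (simp add: filled_def[abs_def])

lemma \<nu>_has_sum: "(\<nu> n has_sum reach n - reach (Suc n)) UNIV"
  using has_sum_minus[OF filled_has_sum[of "Suc n"] filled_has_sum[of n]]
  unfolding \<nu>_def[abs_def] by simp

definition gap :: "nat \<Rightarrow> int \<Rightarrow> real" where "gap n j = g (int n + 1) - g j"

lemma gap_nonneg: "j \<le> int n + 1 \<Longrightarrow> 0 \<le> gap n j"
  and gap_pos: "j \<le> int n \<Longrightarrow> 0 < gap n j"
  by (auto simp: gap_def)

text \<open>Optional stopping for the stay in level \<open>n\<close>, which starts with mass
  \<open>reach n\<close> at \<open>n\<close>; mass that leaves upwards has weight 0.\<close>

lemma \<nu>_gap_has_sum: "((\<lambda>j. \<nu> n j * gap n j) has_sum reach n * gap n n) UNIV"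
proof -
  have "((\<lambda>j. g (int n + 1) * \<nu> n j - (g j * filled (Suc n) j - g j * filled n j)) has_sum
    g (int n + 1) * (reach n - reach (Suc n)) - (- (g (Suc n) * reach (Suc n)) - (- (g n * reach n)))) UNIV"
    by (intro has_sum_minus has_sum_cmult_right \<nu>_has_sum filled_g_has_sum)
  moreover have "g (int n + 1) * \<nu> n j - (g j * filled (Suc n) j - g j * filled n j) = \<nu> n j * gap n j" for j
    by (simp add: \<nu>_def gap_def algebra_simps)
  moreover have "g (int n + 1) * (reach n - reach (Suc n)) - (- (g (Suc n) * reach (Suc n)) - (- (g n * reach n)))
      = reach n * gap n n"
    by (simp add: gap_def algebra_simps)
  ultimately show ?thesis by simp
qed

text \<open>In level \<open>n\<close> the walk cannot stand above \<open>n\<close>. If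
  \<open>bi (Suc n) = n + 1\<close>, this rests on the value chosen for \<open>reach\<close> in that
  case.\<close>

lemma \<nu>_top: "int n < j \<Longrightarrow> \<nu> n j = 0"
proof -
  assume j: "int n < j"
  have 1: "filled n j = 0"
    using bi_le[of n] j by (auto simp: filled_def)
  have 2: "filled (Suc n) j = 0"
  proof (cases "bi (Suc n) = int (Suc n)")
    case True
    then show ?thesis using j by (auto simp: filled_def reach_def)
  next
    case False
    then show ?thesis using bi_le[of "Suc n"] j by (auto simp: filled_def)
  qed
  show ?thesis using 1 2 by (simp add: \<nu>_def)
qed

lemma sum_\<nu>: "(\<Sum>n<N. \<nu> n j) = filled N j"
  by (induction N) (auto simp: \<nu>_def)

text \<open>If there is mass above \<open>j\<close>, the tail from \<open>j + 1\<close> has a finite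
  barycentre, which \<open>g N\<close> exceeds for some \<open>N\<close>, so that
  \<open>j < bi N\<close>. Otherwise \<open>j\<close> is massless or the top atom, and in the latter
  case \<open>bi N = j\<close> and \<open>reach N = 0\<close> for \<open>N > j\<close>.\<close>

lemma filled_eventually: "\<exists>N. filled N j = m j"
proof (cases "F (j + 1) = 0")
  case False
  then have F: "0 < F (j + 1)" using F_nonneg[of "j + 1"] by linarith
  define x where "x = G (j + 1) / F (j + 1)"
  obtain N where N: "0 < N" "x \<le> g (int N)"
  proof -
    obtain n where n: "x + 1 < \<rho> ^ n"
      using real_arch_pow[OF rho_gt_1] by blast
    also have "\<dots> \<le> \<rho> ^ Suc n"
      using rho_gt_1 by (intro power_increasing) auto
    finally show ?thesis
      by (intro that[of "Suc n"]) (auto simp: g_rho_def simp del: power_Suc of_nat_Suc)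
  qed
  have "bary_le (j + 1) x"
    using F by (simp add: bary_le_def x_def)
  then have "bary_le (j + 1) (g N)"
    using N(2) by (rule bary_le_mono)
  then have "j + 1 \<le> bi N"
    using bi(2)[OF N(1)] bary_le_antimono[of "j + 1" "g N" "bi N + 1"] by fastforce
  then show ?thesis
    using N(1) by (intro exI[of _ N]) (auto simp: filled_def)
next
  case True
  have Fj: "F j = m j" using F_rec[of j] True by simp
  show ?thesis
  proof (cases "m j = 0")
    case True
    then show ?thesis by (intro exI[of _ 0]) simp
  next
    case False
    then have Fpos: "0 < F j" using Fj m_nonneg[of j] by linarith
    define N where "N = nat (max 0 j) + 1"
    have N: "0 < N" "j < N" by (auto simp: N_def)
    have G1: "G (j + 1) = 0"
    proof -
      have "m i = 0" if "i \<in> {j + 1..}" for i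
        using nonneg_infsum_le_0D[of m "{j + 1..}" i] True that by (simp add: F_def)
      then show ?thesis
        unfolding G_def by (subst infsum_cong[of _ _ "\<lambda>_. 0"]) auto
    qed
    then have Gj: "G j = g j * F j" using G_rec[of j] Fj by simp
    have b: "bary_le j (g N)"
      using Fpos N Gj by (simp add: bary_le_def)
    have nb: "\<not> bary_le (j + 1) (g N)"
      using True by (simp add: bary_le_def)
    have "bi N = j"
      using bary_last_unique[OF b nb bi[OF N(1)]] by simp
    then have "reach N * (g N - g j) = 0"
      using reach_mult[OF N(1)] Gj by simp
    then have "reach N = 0" using N by simp
    then show ?thesis
      using \<open>bi N = j\<close> N Fj by (intro exI[of _ N]) (simp add: filled_def)
  qed
qed

section \<open>The lower bounds and the tail probabilities\<close>

text \<open>Ranks are counted from the top because \<open>V n\<close> is bounded above by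
  \<open>n + 1\<close> but may be infinite below.\<close>

definition rk :: "nat \<Rightarrow> int \<Rightarrow> nat" where "rk n j = card {i \<in> V n. j \<le> i}"
definition jb :: "nat \<Rightarrow> nat \<Rightarrow> int" where "jb n k = (THE j. j \<in> V n \<and> rk n j = k)"
definition valid :: "nat \<Rightarrow> nat \<Rightarrow> bool" where "valid n k \<longleftrightarrow> 1 \<le> k \<and> enat k \<le> ay_m \<rho> \<mu> n + 1"
abbreviation fi :: "nat \<Rightarrow> nat" where "fi \<equiv> ay_first \<rho> \<mu>"

lemma finite_V_above [simp]: "finite {i \<in> V n. j \<le> i}"
  by (rule finite_subset[of _ "{j..int n + 1}"]) (auto dest: V_le)

lemma V_subset_max:
  assumes "A \<subseteq> V n" "A \<noteq> {}"
  obtains j where "j \<in> A" "\<And>i. i \<in> A \<Longrightarrow> i \<le> j"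
proof -
  obtain c where c: "c \<in> A" using assms(2) by auto
  define B where "B = {i \<in> A. c \<le> i}"
  have B: "finite B" "B \<noteq> {}"
    using finite_subset[OF _ finite_V_above[of n c], of B] assms(1) c by (auto simp: B_def)
  show ?thesis
  proof (rule that[of "Max B"])
    show "Max B \<in> A" using Max_in[OF B] by (simp add: B_def)
    fix i assume "i \<in> A"
    show "i \<le> Max B"
    proof (cases "c \<le> i")
      case True
      then show ?thesis using \<open>i \<in> A\<close> B(1) by (intro Max_ge) (auto simp: B_def)
    next
      case False
      moreover have "c \<le> Max B" using c B(1) by (intro Max_ge) (auto simp: B_def)
      ultimately show ?thesis by simp
    qed
  qed
qed

lemma rk_antimono:
  assumes "i \<in> V n" "i < j"
  shows "rk n j < rk n i"
proof -
  have "{l \<in> V n. j \<le> l} \<subseteq> {l \<in> V n. i \<le> l}" "i \<in> {l \<in> V n. i \<le> l}" "i \<notin> {l \<in> V n. j \<le> l}"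
    using assms by auto
  then show ?thesis
    unfolding rk_def by (intro psubset_card_mono) (simp, blast)
qed

lemma rk_eqD: "i \<in> V n \<Longrightarrow> j \<in> V n \<Longrightarrow> rk n i = rk n j \<Longrightarrow> i = j"
  using rk_antimono[of i n j] rk_antimono[of j n i] by (cases i j rule: linorder_cases) auto

lemma jb_rk: "j \<in> V n \<Longrightarrow> jb n (rk n j) = j"
  unfolding jb_def by (rule the_equality) (auto intro: rk_eqD)

lemma V_nonempty: "V n \<noteq> {}"
  using bi_in_V(2) by blast

lemma finite_ay_values: "finite (ay_values \<rho> \<mu> n) \<longleftrightarrow> finite (V n)"
  and card_ay_values: "card (ay_values \<rho> \<mu> n) = card (V n)"
proof -
  have "inj_on g A" for A by (rule inj_onI) simp
  then show "finite (ay_values \<rho> \<mu> n) \<longleftrightarrow> finite (V n)" "card (ay_values \<rho> \<mu> n) = card (V n)"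
    unfolding ay_values_eq by (simp_all add: finite_image_iff card_image)
qed

lemma valid_iff: "valid n k \<longleftrightarrow> 1 \<le> k \<and> (finite (V n) \<longrightarrow> k \<le> card (V n))"
  \<comment> \<open>Nonemptiness makes the truncated subtraction in \<open>ay_m\<close>
    exact.\<close>
  using V_nonempty[of n]
  by (auto simp: valid_def ay_m_def finite_ay_values card_ay_values one_enat_def card_gt_0_iff Suc_le_eq)

lemma valid_rk:
  assumes "j \<in> V n"
  shows "valid n (rk n j)"
proof -
  have "0 < rk n j"
    unfolding rk_def using assms by (auto simp: card_gt_0_iff)
  moreover have "rk n j \<le> card (V n)" if "finite (V n)"
    unfolding rk_def using that by (intro card_mono) auto
  ultimately show ?thesis by (simp add: valid_iff)
qed

lemma jb_exists: "valid n k \<Longrightarrow> \<exists>j\<in>V n. rk n j = k"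
proof (induction k)
  case (Suc k)
  show ?case
  proof (cases "k = 0")
    case True
    obtain j where j: "j \<in> V n" "\<And>i. i \<in> V n \<Longrightarrow> i \<le> j"
      using V_subset_max[OF order_refl V_nonempty] by blast
    then have "{i \<in> V n. j \<le> i} = {j}" by (auto intro: antisym)
    then show ?thesis using j True by (intro bexI[of _ j]) (auto simp: rk_def)
  next
    case False
    then obtain j where j: "j \<in> V n" "rk n j = k"
      using Suc by (auto simp: valid_iff)
    have "{i \<in> V n. i < j} \<noteq> {}"
    proof
      assume "{i \<in> V n. i < j} = {}"
      then have *: "V n = {i \<in> V n. j \<le> i}" by (auto simp: not_less[symmetric])
      then have "finite (V n)" by (subst *) (rule finite_V_above)
      moreover have "card (V n) = rk n j" unfolding rk_def by (rule arg_cong[OF *])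
      ultimately show False using Suc.prems j(2) by (simp add: valid_iff)
    qed
    then obtain l where l: "l \<in> {i \<in> V n. i < j}" "\<And>i. i \<in> {i \<in> V n. i < j} \<Longrightarrow> i \<le> l"
      by (rule V_subset_max[rotated]) auto
    have "i \<in> V n \<and> l \<le> i \<longleftrightarrow> i = l \<or> i \<in> V n \<and> j \<le> i" for i
      using l(1) l(2)[of i] by (cases "i < j") auto
    then have "{i \<in> V n. l \<le> i} = insert l {i \<in> V n. j \<le> i}"
      by auto
    then have "rk n l = Suc (rk n j)"
      using l(1) by (simp add: rk_def)
    then show ?thesis using l(1) j(2) by (intro bexI[of _ l]) auto
  qed
qed (simp add: valid_def)

lemma jb: "valid n k \<Longrightarrow> jb n k \<in> V n" "valid n k \<Longrightarrow> rk n (jb n k) = k"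
  using jb_exists[of n k] jb_rk[of _ n] by auto

lemma ay_bound_eq:
  assumes "valid n k"
  shows "ay_bound \<rho> \<mu> n k = g (jb n k)"
  unfolding ay_bound_def
proof (rule the_equality)
  have *: "{w \<in> ay_values \<rho> \<mu> n. g j \<le> w} = g ` {i \<in> V n. j \<le> i}" for j
    by (auto simp: ay_values_eq)
  have inj: "inj_on g A" for A by (rule inj_onI) simp
  have c: "card {w \<in> ay_values \<rho> \<mu> n. g j \<le> w} = rk n j" for j
    unfolding * rk_def by (rule card_image[OF inj])
  show "g (jb n k) \<in> ay_values \<rho> \<mu> n \<and> finite {w \<in> ay_values \<rho> \<mu> n. g (jb n k) \<le> w} \<and>
    card {w \<in> ay_values \<rho> \<mu> n. g (jb n k) \<le> w} = k"
    using jb[OF assms] c[of "jb n k"] *[of "jb n k"] by (simp add: ay_values_eq)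
  fix v
  assume v: "v \<in> ay_values \<rho> \<mu> n \<and> finite {w \<in> ay_values \<rho> \<mu> n. v \<le> w} \<and>
    card {w \<in> ay_values \<rho> \<mu> n. v \<le> w} = k"
  then obtain j where j: "j \<in> V n" "v = g j" by (auto simp: ay_values_eq)
  then have "rk n j = k" using conjunct2[OF conjunct2[OF v]] c[of j] by metis
  then have "jb n k = j" using jb_rk[OF j(1)] by metis
  then show "v = g (jb n k)" by (metis j(2))
qed

lemma valid_Suc: "1 \<le> k \<Longrightarrow> enat k \<le> ay_m \<rho> \<mu> n \<Longrightarrow> valid n (Suc k)"
  by (cases "ay_m \<rho> \<mu> n") (auto simp: valid_def one_enat_def)

lemma valid_cases:
  assumes "valid n k"
  shows "(enat k \<le> ay_m \<rho> \<mu> n) = (enat k \<noteq> ay_m \<rho> \<mu> n + 1)"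
  using assms by (cases "ay_m \<rho> \<mu> n") (auto simp: valid_def one_enat_def)

lemma valid_SucD: "valid n (Suc k) \<Longrightarrow> 1 \<le> k \<Longrightarrow> valid n k \<and> enat k \<le> ay_m \<rho> \<mu> n"
  by (cases "ay_m \<rho> \<mu> n") (auto simp: valid_def one_enat_def)

lemma jb_Suc_less: "1 \<le> k \<Longrightarrow> valid n (Suc k) \<Longrightarrow> jb n (Suc k) < jb n k"
proof (rule ccontr)
  assume *: "1 \<le> k" "valid n (Suc k)" "\<not> jb n (Suc k) < jb n k"
  then have v: "valid n k" using valid_SucD[of n k] by simp
  have "rk n (jb n (Suc k)) \<le> rk n (jb n k)"
    using *(3) rk_antimono[OF jb(1)[OF v], of "jb n (Suc k)"] by (cases "jb n (Suc k) = jb n k") auto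
  then show False using jb(2)[OF *(2)] jb(2)[OF v] by simp
qed

lemma jb_le_iff:
  assumes "valid n k" "i \<in> V n"
  shows "i \<le> jb n k \<longleftrightarrow> k \<le> rk n i"
  using rk_antimono[OF assms(2), of "jb n k"] rk_antimono[OF jb(1)[OF assms(1)], of i] jb[OF assms(1)]
    jb_rk[OF assms(2)]
  by (cases i "jb n k" rule: linorder_cases) auto

lemma V_below:
  assumes "1 \<le> k" "valid n (Suc k)" "i \<in> V n"
  shows "i < jb n k \<longleftrightarrow> i \<le> jb n (Suc k)"
proof -
  have v: "valid n k" using valid_SucD[OF assms(2,1)] by simp
  have "rk n i = k \<longleftrightarrow> i = jb n k"
    using jb_rk[OF assms(3)] jb(2)[OF v] by auto
  then have "i < jb n k \<longleftrightarrow> Suc k \<le> rk n i"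
    using jb_le_iff[OF v assms(3)] by linarith
  then show ?thesis
    using jb_le_iff[OF assms(2,3)] by simp
qed

lemma jb_last:
  assumes "valid n k" "\<not> enat k \<le> ay_m \<rho> \<mu> n" "i \<in> V n"
  shows "jb n k \<le> i"
proof (rule ccontr)
  assume "\<not> jb n k \<le> i"
  then have "k < rk n i"
    using rk_antimono[OF assms(3), of "jb n k"] jb(2)[OF assms(1)] by simp
  then have "enat (Suc k) \<le> ay_m \<rho> \<mu> n + 1"
    using valid_rk[OF assms(3)] by (cases "ay_m \<rho> \<mu> n") (auto simp: valid_def one_enat_def)
  then show False
    using assms(2) by (cases "ay_m \<rho> \<mu> n") (auto simp: one_enat_def)
qed

text \<open>This guarantees that a bound remains when a first bound equal to \<open>n + 1\<close> is
  skipped. For \<open>n = 0\<close>, where \<open>bi\<close> may not be available, a position with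
  stopped mass serves: the positive sum in \<open>\<nu>_gap_has_sum\<close> has a nonzero
  term.\<close>

lemma V_exists_le: "\<exists>j\<in>V n. j \<le> int n"
proof (cases "n = 0")
  case True
  have "\<exists>j. \<nu> 0 j * gap 0 j \<noteq> 0"
  proof (rule ccontr)
    assume "\<not> ?thesis"
    then have "((\<lambda>j. \<nu> 0 j * gap 0 j) has_sum 0) UNIV" by (intro has_sum_0) auto
    then have "gap 0 0 = 0"
      using has_sum_unique[OF \<nu>_gap_has_sum[of 0]] by simp
    then show False using gap_pos[of 0 0] by simp
  qed
  then obtain j where "\<nu> 0 j \<noteq> 0" by auto
  then show ?thesis
    using \<nu>_in_V[of 0 j] \<nu>_top[of 0 j] True by (intro bexI[of _ j]) (auto simp: not_less[symmetric])
qed (use bi_le bi_in_V in blast)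

lemma valid_1: "valid n 1"
  using V_nonempty[of n] by (auto simp: valid_iff card_gt_0_iff Suc_le_eq)

lemma fi_eq: "fi n = (if jb n 1 = int n + 1 then 2 else 1)"
  using ay_bound_eq[OF valid_1, of n] by (simp add: ay_first_def)

lemma fi_ge_1 [simp]: "Suc 0 \<le> fi n" "0 < fi n"
  by (simp_all add: fi_eq)

lemma valid_fi: "valid n (fi n)"
proof (cases "jb n 1 = int n + 1")
  case True
  obtain j where j: "j \<in> V n" "j \<le> int n" using V_exists_le by blast
  have "rk n (jb n 1) < rk n j"
    using True j by (intro rk_antimono) auto
  then have "2 \<le> rk n j" using jb(2)[OF valid_1, of n] by simp
  then show ?thesis
    using valid_rk[OF j(1)] True by (auto simp: fi_eq valid_iff)
qed (use valid_1 fi_eq in simp)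

lemma jb_le: "valid n k \<Longrightarrow> fi n \<le> k \<Longrightarrow> jb n k \<le> int n"
proof (cases "k = 1")
  case True
  assume "fi n \<le> k"
  then show ?thesis
    using V_le[OF jb(1)[OF valid_1, of n]] True by (auto simp: fi_eq split: if_splits)
next
  case False
  assume k: "valid n k" "fi n \<le> k"
  then have "jb n k < jb n 1"
    using jb_le_iff[OF k(1) jb(1)[OF valid_1]] jb(2)[OF valid_1, of n] False V_le[OF jb(1)[OF valid_1, of n]]
    by (cases "jb n k < jb n 1") (auto simp: valid_def)
  then show ?thesis
    using V_le[OF jb(1)[OF valid_1, of n]] by simp
qed

lemma rk_ge_fi: "j \<in> V n \<Longrightarrow> j \<le> int n \<Longrightarrow> fi n \<le> rk n j"
  using rk_antimono[of j n "jb n 1"] jb(2)[OF valid_1, of n] valid_rk[of j n]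
  by (auto simp: fi_eq valid_def)

text \<open>\<open>rest n k\<close> is \<open>gap n (jb n k)\<close> times the probability of reaching the \<open>k\<close>-th lower bound of level \<open>n\<close>.
  If it vanishes, the value \<open>r n k = 0\<close> (from division by zero) is irrelevant.\<close>

definition rest :: "nat \<Rightarrow> nat \<Rightarrow> real" where
  "rest n k = (\<Sum>\<^sub>\<infinity>j\<in>{..jb n k}. \<nu> n j * gap n j)"

definition r :: "nat \<Rightarrow> nat \<Rightarrow> real" where
  "r n k = (if valid n k \<and> fi n \<le> k then \<nu> n (jb n k) * gap n (jb n k) / rest n k else 0)"

lemma \<nu>_gap_summable: "(\<lambda>j. \<nu> n j * gap n j) summable_on A"
  using \<nu>_gap_has_sum summable_on_subset_banach has_sum_imp_summable by blast

lemma \<nu>_gap_nonneg: "0 \<le> \<nu> n j * gap n j"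
  using \<nu>_nonneg[of n j] \<nu>_top[of n j] gap_nonneg[of j n]
  by (cases "j \<le> int n") (auto intro!: mult_nonneg_nonneg)

text \<open>A skipped bound \<open>n + 1\<close> carries no mass by \<open>\<nu>_top\<close>, so the
  tail from the first bound in use is the whole sum.\<close>

lemma rest_first: "rest n (fi n) = reach n * gap n n"
proof -
  have "\<nu> n j = 0" if "jb n (fi n) < j" for j
  proof (rule ccontr)
    assume nz: "\<nu> n j \<noteq> 0"
    then have j: "j \<in> V n" "j \<le> int n"
      using \<nu>_in_V \<nu>_top by (auto simp: not_less[symmetric])
    then show False
      using rk_ge_fi[OF j] jb_le_iff[OF valid_fi j(1)] that by simp
  qed
  then have "rest n (fi n) = (\<Sum>\<^sub>\<infinity>j. \<nu> n j * gap n j)"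
    unfolding rest_def by (intro infsum_cong_neutral) auto
  then show ?thesis
    using infsumI[OF \<nu>_gap_has_sum] by simp
qed

lemma rest_split: "rest n k = \<nu> n (jb n k) * gap n (jb n k) + (\<Sum>\<^sub>\<infinity>j\<in>{..<jb n k}. \<nu> n j * gap n j)"
proof -
  have "{..jb n k} = {jb n k} \<union> {..<jb n k}" by auto
  then show ?thesis
    unfolding rest_def by (simp only:) (subst infsum_Un_disjoint, auto intro: \<nu>_gap_summable)
qed

lemma rest_Suc:
  assumes "1 \<le> k" "valid n (Suc k)"
  shows "rest n k = \<nu> n (jb n k) * gap n (jb n k) + rest n (Suc k)"
proof -
  have "(\<Sum>\<^sub>\<infinity>j\<in>{..<jb n k}. \<nu> n j * gap n j) = rest n (Suc k)"
    unfolding rest_def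
  proof (rule infsum_cong_neutral)
    fix j assume "j \<in> {..<jb n k} - {..jb n (Suc k)}"
    then have "j \<notin> V n" using V_below[OF assms] by auto
    then show "\<nu> n j * gap n j = 0" using \<nu>_in_V by auto
  qed (use jb_Suc_less[OF assms] in auto)
  then show ?thesis using rest_split by simp
qed

lemma rest_last:
  assumes "valid n k" "\<not> enat k \<le> ay_m \<rho> \<mu> n"
  shows "rest n k = \<nu> n (jb n k) * gap n (jb n k)"
proof -
  have "\<nu> n j = 0" if "j < jb n k" for j
    using \<nu>_in_V jb_last[OF assms, of j] that by force
  then have "(\<Sum>\<^sub>\<infinity>j\<in>{..<jb n k}. \<nu> n j * gap n j) = 0"
    by (intro infsum_0) auto
  then show ?thesis using rest_split by simp
qed

lemma rest_ge: "\<nu> n (jb n k) * gap n (jb n k) \<le> rest n k"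
  unfolding rest_split by (simp add: infsum_nonneg \<nu>_gap_nonneg)

lemma r_bounds: "0 \<le> r n k" "r n k \<le> 1"
proof -
  show "0 \<le> r n k"
    unfolding r_def using \<nu>_gap_nonneg order_trans[OF \<nu>_gap_nonneg rest_ge] by (simp add: divide_nonneg_nonneg)
  show "r n k \<le> 1"
    unfolding r_def using rest_ge[of n k] \<nu>_gap_nonneg[of n "jb n k"] by (auto simp: divide_le_eq_1)
qed

text \<open>If \<open>rest n k = 0\<close>, its nonnegative summand on the right vanishes too, so
  the product form survives the division by zero. Later arguments use \<open>r\<close> in this
  form.\<close>

lemma r_rest:
  assumes "valid n k" "fi n \<le> k"
  shows "r n k * rest n k = \<nu> n (jb n k) * gap n (jb n k)"
  using rest_ge[of n k] \<nu>_gap_nonneg[of n "jb n k"] assms by (cases "rest n k = 0") (auto simp: r_def)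

section \<open>The killed chain of positions and states\<close>

definition kill :: "int \<Rightarrow> nat \<Rightarrow> nat \<Rightarrow> real" where
  "kill s n k = (if s = jb n k then if enat k \<le> ay_m \<rho> \<mu> n then r n k else 1 else 0)"

definition after_head :: "int \<Rightarrow> nat \<Rightarrow> nat \<Rightarrow> nat" where
  "after_head s n k = (if s = jb n k \<and> enat k \<le> ay_m \<rho> \<mu> n then Suc k else k)"

definition move :: "(int \<Rightarrow> nat \<Rightarrow> nat \<Rightarrow> real) \<Rightarrow> int \<Rightarrow> nat \<Rightarrow> nat \<Rightarrow> real" where
  "move \<phi> s n k = (if s = int n + 1 then \<phi> s (Suc n) (fi (Suc n)) else \<phi> s n k)"

definition step :: "(int \<Rightarrow> nat \<Rightarrow> nat \<Rightarrow> real) \<Rightarrow> int \<Rightarrow> nat \<Rightarrow> nat \<Rightarrow> real" where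
  "step \<phi> s n k = (1 - kill s n k) *
     (p * move \<phi> (s + 1) n (after_head s n k) + (1 - p) * move \<phi> (s - 1) n (after_head s n k))"

text \<open>\<open>alive t \<phi>\<close> is the expectation of \<open>\<phi>\<close> at the position and the state at time \<open>t\<close>, before the
  toss, restricted to the event that the process has not been stopped before time \<open>t\<close>.\<close>

primrec alive :: "nat \<Rightarrow> (int \<Rightarrow> nat \<Rightarrow> nat \<Rightarrow> real) \<Rightarrow> real" where
  "alive 0 \<phi> = \<phi> 0 0 (fi 0)"
| "alive (Suc t) \<phi> = alive t (step \<phi>)"

text \<open>An invariant of the unstopped chain: functions under \<open>alive\<close> are compared
  only where it holds. The bound \<open>- int t\<close> later makes sums over positions
  finite.\<close>

definition reachable :: "nat \<Rightarrow> int \<Rightarrow> nat \<Rightarrow> nat \<Rightarrow> bool" where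
  "reachable t s n k \<longleftrightarrow> - int t \<le> s \<and> s \<le> int n \<and> valid n k \<and> fi n \<le> k \<and> jb n k \<le> s"

lemma kill_bounds: "0 \<le> kill s n k" "kill s n k \<le> 1"
  using r_bounds by (auto simp: kill_def)

lemma reachable_0: "reachable 0 0 0 (fi 0)"
  using jb_le[OF valid_fi, of 0] valid_fi by (simp add: reachable_def)

lemma reachable_new: "reachable t (int n) n (fi n)"
  using jb_le[OF valid_fi, of n] valid_fi by (simp add: reachable_def)

text \<open>Survival at the current bound means a head, which puts the new bound strictly below
  \<open>s\<close>; a step down therefore cannot pass it.\<close>

lemma reachable_after_head:
  assumes "reachable t s n k" "kill s n k \<noteq> 1"
  shows "valid n (after_head s n k)" "fi n \<le> after_head s n k" "jb n (after_head s n k) < s"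
proof -
  have "1 \<le> k" using assms(1) by (simp add: reachable_def valid_def)
  then have *: "enat k \<le> ay_m \<rho> \<mu> n \<Longrightarrow> valid n (Suc k) \<and> jb n (Suc k) < jb n k"
    using valid_Suc jb_Suc_less by blast
  then show "valid n (after_head s n k)" "fi n \<le> after_head s n k" "jb n (after_head s n k) < s"
    using assms by (auto simp: after_head_def reachable_def kill_def split: if_splits)
qed

lemma step_mono:
  assumes "\<And>s n k. reachable (Suc t) s n k \<Longrightarrow> \<phi> s n k \<le> \<psi> s n k" "reachable t s n k"
  shows "step \<phi> s n k \<le> step \<psi> s n k"
proof (cases "kill s n k = 1")
  case False
  note h = reachable_after_head[OF assms(2) False]
  let ?k = "after_head s n k"
  have s: "- int t \<le> s" "s \<le> int n" using assms(2) by (auto simp: reachable_def)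
  have "move \<phi> (s + 1) n ?k \<le> move \<psi> (s + 1) n ?k"
  proof (cases "s = int n")
    case True
    then show ?thesis
      using assms(1)[of "s + 1" "Suc n" "fi (Suc n)"] reachable_new[of "Suc t" "Suc n"]
      by (simp add: move_def add.commute)
  next
    case False
    then have "reachable (Suc t) (s + 1) n ?k"
      using h s by (auto simp: reachable_def)
    then show ?thesis using assms(1) False by (simp add: move_def)
  qed
  moreover have "move \<phi> (s - 1) n ?k \<le> move \<psi> (s - 1) n ?k"
  proof -
    have "reachable (Suc t) (s - 1) n ?k"
      using h s by (auto simp: reachable_def)
    then show ?thesis using assms(1) s by (simp add: move_def)
  qed
  ultimately show ?thesis
    unfolding step_def using kill_bounds[of s n k] p_pos p_half
    by (intro mult_left_mono add_mono) auto
qed (simp add: step_def)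

lemma alive_mono:
  "(\<And>s n k. reachable t s n k \<Longrightarrow> \<phi> s n k \<le> \<psi> s n k) \<Longrightarrow> alive t \<phi> \<le> alive t \<psi>"
proof (induction t arbitrary: \<phi> \<psi>)
  case 0
  then show ?case using reachable_0 by simp
next
  case (Suc t)
  then show ?case using step_mono[of t \<phi> \<psi>] by simp
qed

lemma alive_cong:
  "(\<And>s n k. reachable t s n k \<Longrightarrow> \<phi> s n k = \<psi> s n k) \<Longrightarrow> alive t \<phi> = alive t \<psi>"
  by (intro antisym alive_mono) auto

lemma alive_add: "alive t (\<lambda>s n k. \<phi> s n k + \<psi> s n k) = alive t \<phi> + alive t \<psi>"
proof (induction t arbitrary: \<phi> \<psi>)
  case (Suc t)
  have "step (\<lambda>s n k. \<phi> s n k + \<psi> s n k) = (\<lambda>s n k. step \<phi> s n k + step \<psi> s n k)"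
    by (auto simp: fun_eq_iff step_def move_def algebra_simps)
  then show ?case using Suc by simp
qed simp

lemma alive_cmult: "alive t (\<lambda>s n k. c * \<phi> s n k) = c * alive t \<phi>"
proof (induction t arbitrary: \<phi>)
  case (Suc t)
  have "step (\<lambda>s n k. c * \<phi> s n k) = (\<lambda>s n k. c * step \<phi> s n k)"
    by (auto simp: fun_eq_iff step_def move_def algebra_simps)
  then show ?case using Suc by simp
qed simp

lemma alive_diff: "alive t (\<lambda>s n k. \<phi> s n k - \<psi> s n k) = alive t \<phi> - alive t \<psi>"
  using alive_add[of t \<phi> "\<lambda>s n k. - 1 * \<psi> s n k"] alive_cmult[of t "- 1" \<psi>] by simp

lemma alive_zero [simp]: "alive t (\<lambda>s n k. 0) = 0"
  using alive_cmult[of t 0 "\<lambda>_ _ _. 0"] by simp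

lemma alive_sum: "alive t (\<lambda>s n k. \<Sum>i\<in>A. \<phi> i s n k) = (\<Sum>i\<in>A. alive t (\<phi> i))"
  by (induction A rule: infinite_finite_induct) (auto simp: alive_add)

lemma alive_nonneg: "(\<And>s n k. reachable t s n k \<Longrightarrow> 0 \<le> \<phi> s n k) \<Longrightarrow> 0 \<le> alive t \<phi>"
  using alive_mono[of t "\<lambda>_ _ _. 0" \<phi>] by simp

text \<open>The mass that enters level \<open>n\<close> at time \<open>t\<close>, and the mass at the \<open>k\<close>-th lower bound of level
  \<open>n\<close> at time \<open>t\<close>.\<close>

definition ent :: "nat \<Rightarrow> nat \<Rightarrow> real" where
  "ent t n = (case t of 0 \<Rightarrow> if n = 0 then 1 else 0
     | Suc u \<Rightarrow> alive u (\<lambda>s n' k'. if Suc n' = n \<and> s = int n' then p * (1 - kill s n' k') else 0))"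

definition arr :: "nat \<Rightarrow> nat \<Rightarrow> nat \<Rightarrow> real" where
  "arr t n k = alive t (\<lambda>s n' k'. if n' = n \<and> k' = k \<and> s = jb n k then 1 else 0)"

section \<open>Balance equations for a single state and for a whole level\<close>

definition in_state :: "nat \<Rightarrow> nat \<Rightarrow> (int \<Rightarrow> real) \<Rightarrow> int \<Rightarrow> nat \<Rightarrow> nat \<Rightarrow> real" where
  "in_state n k f s n' k' = (if n' = n \<and> k' = k then f s else 0)"

definition in_level :: "nat \<Rightarrow> (int \<Rightarrow> real) \<Rightarrow> int \<Rightarrow> nat \<Rightarrow> nat \<Rightarrow> real" where
  "in_level n f s n' k' = (if n' = n then f s else 0)"

definition mean :: "(int \<Rightarrow> real) \<Rightarrow> int \<Rightarrow> real" where
  "mean f s = p * f (s + 1) + (1 - p) * f (s - 1)"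

lemma ent_nonneg: "0 \<le> ent t n"
  unfolding ent_def using kill_bounds p_pos by (auto split: nat.split intro!: alive_nonneg)

lemma arr_nonneg: "0 \<le> arr t n k"
  unfolding arr_def by (auto intro!: alive_nonneg)

lemma mean_gap: "mean (gap n) s = gap n s"
  using g_harmonic[of s] by (simp add: mean_def gap_def algebra_simps)

text \<open>The three terms are the mass that was already in the state, that comes from the previous state by a
  head, and that comes from the level below. Mass that moves to the level above is not seen because \<open>f\<close>
  vanishes at the upper bound.\<close>

lemma alive_Suc_in_state:
  assumes v: "valid n k" "fi n \<le> k" and f: "f (int n + 1) = 0"
  shows "alive (Suc t) (in_state n k f) =
    alive t (\<lambda>s n' k'. if n' = n \<and> k' = k \<and> s \<noteq> jb n k then mean f s else 0)
    + (if fi n < k then (1 - r n (k - 1)) * mean f (jb n (k - 1)) * arr t n (k - 1) else 0)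
    + (if k = fi n then f n * ent (Suc t) n else 0)"
proof -
  define a where "a = (\<lambda>s n' k'. if n' = n \<and> k' = k \<and> s \<noteq> jb n k then mean f s else 0)"
  define b where "b = (\<lambda>s n' k'. if n' = n \<and> k' = k - 1 \<and> s = jb n (k - 1) then 1 else (0 :: real))"
  define c where "c = (\<lambda>s n' k'. if Suc n' = n \<and> s = int n' then p * (1 - kill s n' k') else 0)"
  define \<beta> where "\<beta> = (if fi n < k then (1 - r n (k - 1)) * mean f (jb n (k - 1)) else 0)"
  define \<gamma> where "\<gamma> = (if k = fi n then f n else 0)"
  have "alive t (step (in_state n k f)) = alive t (\<lambda>s n' k'. a s n' k' + (\<beta> * b s n' k' + \<gamma> * c s n' k'))"
  proof (rule alive_cong)
    fix s n' k' assume R: "reachable t s n' k'"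
    then have R': "s \<le> int n'" "fi n' \<le> k'" "1 \<le> k'"
      by (auto simp: reachable_def valid_def)
    consider "n' = n" | "Suc n' = n" | "n' \<noteq> n" "Suc n' \<noteq> n" by blast
    then show "step (in_state n k f) s n' k' = a s n' k' + (\<beta> * b s n' k' + \<gamma> * c s n' k')"
    proof cases
      case 1
      have m: "enat k' \<le> ay_m \<rho> \<mu> n" if "Suc k' = k"
        using valid_SucD[of n k'] v(1) R'(3) that by simp
      have mv: "p * move (in_state n k f) (s + 1) n i + (1 - p) * move (in_state n k f) (s - 1) n i
        = (if i = k then mean f s else 0)" for i
        using f R' 1 by (auto simp: move_def in_state_def mean_def)
      have "step (in_state n k f) s n' k' = (1 - kill s n k') * (if after_head s n k' = k then mean f s else 0)"
        unfolding step_def 1 mv ..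
      moreover have "c s n' k' = 0" using 1 by (simp add: c_def)
      moreover have "k' = k - 1 \<longleftrightarrow> Suc k' = k"
        using R' v(2) fi_ge_1(1)[of n] by auto
      moreover have "fi n < k" if "Suc k' = k" using R' 1 that by simp
      ultimately show ?thesis
        using 1 m by (auto simp: a_def b_def \<beta>_def kill_def after_head_def)
    next
      case 2
      have mv: "p * move (in_state n k f) (s + 1) n' i + (1 - p) * move (in_state n k f) (s - 1) n' i
        = (if s = int n' then p * \<gamma> else 0)" for i
        using R' 2 by (auto simp: move_def in_state_def \<gamma>_def add.commute)
      have "step (in_state n k f) s n' k' = (1 - kill s n' k') * (if s = int n' then p * \<gamma> else 0)"
        unfolding step_def mv ..
      then show ?thesis using 2 by (simp add: a_def b_def c_def)
    next
      case 3
      then show ?thesis by (auto simp: step_def move_def in_state_def a_def b_def c_def)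
    qed
  qed
  also have "\<dots> = alive t a + (\<beta> * alive t b + \<gamma> * alive t c)"
    by (simp only: alive_add alive_cmult)
  finally show ?thesis
    by (auto simp: a_def b_def c_def \<beta>_def \<gamma>_def ent_def arr_def)
qed

text \<open>Heads do not leave the level, so they disappear from the balance. As \<open>f\<close> is
  arbitrary at \<open>n + 1\<close>, the mass that moves up has to be subtracted.\<close>

lemma alive_Suc_in_level:
  "alive (Suc t) (in_level n f) =
    alive t (in_level n (mean f)) - alive t (\<lambda>s n' k'. kill s n' k' * in_level n (mean f) s n' k')
    - f (int n + 1) * ent (Suc t) (Suc n) + f n * ent (Suc t) n"
proof -
  define c where "c = (\<lambda>i s n' k'. if Suc n' = i \<and> s = int n' then p * (1 - kill s n' k') else 0)"
  have "alive t (step (in_level n f)) = alive t (\<lambda>s n' k'. in_level n (mean f) s n' k'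
      - kill s n' k' * in_level n (mean f) s n' k' - f (int n + 1) * c (Suc n) s n' k' + f n * c n s n' k')"
  proof (rule alive_cong)
    fix s n' k' assume R: "reachable t s n' k'"
    then have R': "s \<le> int n'" by (auto simp: reachable_def)
    consider "n' = n" | "Suc n' = n" | "n' \<noteq> n" "Suc n' \<noteq> n" by blast
    then show "step (in_level n f) s n' k' = in_level n (mean f) s n' k'
      - kill s n' k' * in_level n (mean f) s n' k' - f (int n + 1) * c (Suc n) s n' k' + f n * c n s n' k'"
      using R' by cases (auto simp: step_def move_def in_level_def mean_def c_def algebra_simps)
  qed
  then show ?thesis
    by (simp add: alive_add alive_diff alive_cmult ent_def c_def)
qed

lemma ent_0: "ent 0 n = (if n = 0 then 1 else 0)"
  by (simp add: ent_def)

text \<open>Harmonicity of \<open>gap n\<close> conserves the weight away from the bound, and mass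
  at the bound leaves the state at once, by a stop or a head. Entries are summed up to and including
  time \<open>T\<close>, because mass that enters then is already in the state.\<close>

lemma gap_balance:
  assumes v: "valid n k" "fi n \<le> k"
  shows "gap n (jb n k) * (\<Sum>t<T. arr t n k) + alive T (in_state n k (gap n)) =
    (if fi n < k then (1 - r n (k - 1)) * gap n (jb n (k - 1)) * (\<Sum>t<T. arr t n (k - 1)) else 0)
    + (if k = fi n then gap n n * (\<Sum>t<Suc T. ent t n) else 0)"
proof (induction T)
  case 0
  show ?case by (auto simp: in_state_def ent_0)
next
  case (Suc T)
  have "alive T (\<lambda>s n' k'. if n' = n \<and> k' = k \<and> s \<noteq> jb n k then mean (gap n) s else 0) =
      alive T (\<lambda>s n' k'. in_state n k (gap n) s n' k' -
        gap n (jb n k) * (if n' = n \<and> k' = k \<and> s = jb n k then 1 else 0))"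
    by (rule alive_cong) (auto simp: in_state_def mean_gap)
  also have "\<dots> = alive T (in_state n k (gap n)) - gap n (jb n k) * arr T n k"
    unfolding alive_diff alive_cmult arr_def ..
  finally have *: "alive T (\<lambda>s n' k'. if n' = n \<and> k' = k \<and> s \<noteq> jb n k then mean (gap n) s else 0) =
    alive T (in_state n k (gap n)) - gap n (jb n k) * arr T n k" .
  have "gap n (int n + 1) = 0" by (simp add: gap_def)
  note step = alive_Suc_in_state[OF v, where f = "gap n" and t = T, OF this, unfolded *, unfolded mean_gap]
  have "gap n (jb n k) * (\<Sum>t<Suc T. arr t n k) + alive (Suc T) (in_state n k (gap n)) =
      (gap n (jb n k) * (\<Sum>t<T. arr t n k) + alive T (in_state n k (gap n))) +
      (if fi n < k then (1 - r n (k - 1)) * gap n (jb n (k - 1)) * arr T n (k - 1) else 0)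
      + (if k = fi n then gap n n * ent (Suc T) n else 0)"
    unfolding step by (simp add: distrib_left)
  then show ?case
    unfolding Suc by (simp only: sum.lessThan_Suc[of _ T] sum.lessThan_Suc[of _ "Suc T"] distrib_left split: if_split) simp
qed

text \<open>The height above the bound serves as a Lyapunov function: it falls by at least
  \<open>1 - 2 * p\<close> on average, so the total time in the state is controlled by the
  inflow.\<close>

lemma in_state_summable:
  assumes v: "valid n k" "fi n \<le> k"
    and "fi n < k \<Longrightarrow> summable (\<lambda>t. arr t n (k - 1))" "k = fi n \<Longrightarrow> summable (\<lambda>t. ent t n)"
  shows "summable (\<lambda>t. alive t (in_state n k (\<lambda>_. 1)))"
proof -
  \<comment> \<open>The cutoff at \<open>n + 1\<close> meets the hypothesis of
    \<open>alive_Suc_in_state\<close> and only helps the decrease. The added 1 pays for the time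
    spent at the bound itself.\<close>
  define f where "f = (\<lambda>s. if s \<le> int n then of_int (s - jb n k) + 1 else (0 :: real))"
  define u where "u = (\<lambda>t. (if fi n < k then (1 - r n (k - 1)) * mean f (jb n (k - 1)) * arr t n (k - 1) else 0)
    + (if k = fi n then f n * ent (Suc t) n else 0))"
  have f_nonneg: "0 \<le> f s" if "jb n k - 1 \<le> s" for s
    using that by (auto simp: f_def)
  have mean_nonneg: "0 \<le> mean f (jb n (k - 1))" if "fi n < k"
  proof -
    have "1 \<le> fi n" by simp
    then have "1 \<le> k - 1" "Suc (k - 1) = k" using that by linarith+
    then have "jb n k < jb n (k - 1)"
      using jb_Suc_less[of "k - 1" n] v by simp
    then show ?thesis
      unfolding mean_def using p_pos p_half by (intro add_nonneg_nonneg mult_nonneg_nonneg f_nonneg) simp_all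
  qed
  have u: "0 \<le> u t" for t
    unfolding u_def using mean_nonneg r_bounds[of n "k - 1"] arr_nonneg ent_nonneg f_nonneg[of n] jb_le[OF v]
    by (auto intro!: add_nonneg_nonneg mult_nonneg_nonneg)
  have "summable (\<lambda>t. (1 - 2 * p) * alive t (in_state n k (\<lambda>_. 1)))"
  proof (rule summable_of_decrease[where a = "\<lambda>t. alive t (in_state n k f)" and u = u])
    fix t
    have "alive t (\<lambda>s n' k'. if n' = n \<and> k' = k \<and> s \<noteq> jb n k then mean f s else 0) \<le>
      alive t (\<lambda>s n' k'. in_state n k f s n' k' - (1 - 2 * p) * in_state n k (\<lambda>_. 1) s n' k')"
    proof (rule alive_mono)
      fix s n' k' assume "reachable t s n' k'"
      then have "n' = n \<Longrightarrow> k' = k \<Longrightarrow> jb n k \<le> s \<and> s \<le> n" by (auto simp: reachable_def)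
      moreover have "mean f s \<le> f s - (1 - 2 * p)" if s: "jb n k < s" "s \<le> n"
      proof (cases "s = n")
        case True
        have "0 \<le> p * (real_of_int (s - jb n k) + 2)" using s p_pos by simp
        then show ?thesis using True by (simp add: mean_def f_def algebra_simps)
      next
        case False
        then show ?thesis using s by (simp add: mean_def f_def algebra_simps)
      qed
      ultimately show "(if n' = n \<and> k' = k \<and> s \<noteq> jb n k then mean f s else 0) \<le>
        in_state n k f s n' k' - (1 - 2 * p) * in_state n k (\<lambda>_. 1) s n' k'"
        using p_pos by (auto simp: in_state_def f_def)
    qed
    then show "alive (Suc t) (in_state n k f) \<le>
        alive t (in_state n k f) - (1 - 2 * p) * alive t (in_state n k (\<lambda>_. 1)) + u t"
      using alive_Suc_in_state[OF v, of f t] unfolding alive_diff alive_cmult u_def by (simp add: f_def)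
  next
    have "summable (\<lambda>t. if fi n < k then (1 - r n (k - 1)) * mean f (jb n (k - 1)) * arr t n (k - 1) else 0)"
      using summable_mult[OF assms(3)] by (cases "fi n < k") simp_all
    moreover have "summable (\<lambda>t. if k = fi n then f n * ent (Suc t) n else 0)"
      using summable_mult[OF summable_Suc_iff[THEN iffD2, OF assms(4)]] by (cases "k = fi n") simp_all
    ultimately show "summable u"
      unfolding u_def by (rule summable_add)
  qed (use p_half u f_nonneg in \<open>auto intro!: alive_nonneg mult_nonneg_nonneg simp: in_state_def reachable_def\<close>)
  then show ?thesis
    using p_half summable_mult_D by fastforce
qed

text \<open>The mass still in the state is the term of a convergent series, so it drops out of
  \<open>gap_balance\<close> in the limit and the total inflow, \<open>rest n k\<close>, has arrived
  at the bound.\<close>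

lemma arr_sums_aux:
  assumes v: "valid n k" "fi n \<le> k" and occ: "summable (\<lambda>t. alive t (in_state n k (\<lambda>_. 1)))"
    and lim: "(\<lambda>T. (if fi n < k then (1 - r n (k - 1)) * gap n (jb n (k - 1)) * (\<Sum>t<T. arr t n (k - 1)) else 0)
      + (if k = fi n then gap n n * (\<Sum>t<Suc T. ent t n) else 0)) \<longlonglongrightarrow> rest n k"
  shows "(\<lambda>t. arr t n k) sums (rest n k / gap n (jb n k))"
proof -
  have g: "0 < gap n (jb n k)" using gap_pos jb_le[OF v] by simp
  have X: "(\<lambda>T. alive T (in_state n k (gap n))) \<longlonglongrightarrow> 0"
  proof (rule real_tendsto_sandwich[where f = "\<lambda>_. 0" and h = "\<lambda>T. gap n (jb n k) * alive T (in_state n k (\<lambda>_. 1))"])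
    show "(\<lambda>T. gap n (jb n k) * alive T (in_state n k (\<lambda>_. 1))) \<longlonglongrightarrow> 0"
      by (rule tendsto_mult_right_zero[OF summable_LIMSEQ_zero[OF occ]])
    show "\<forall>\<^sub>F T in sequentially. 0 \<le> alive T (in_state n k (gap n))"
      by (intro always_eventually allI alive_nonneg) (auto simp: in_state_def reachable_def intro!: gap_nonneg)
    show "\<forall>\<^sub>F T in sequentially. alive T (in_state n k (gap n)) \<le> gap n (jb n k) * alive T (in_state n k (\<lambda>_. 1))"
      unfolding alive_cmult[symmetric]
      by (intro always_eventually allI alive_mono) (auto simp: in_state_def reachable_def gap_def)
  qed simp
  have "(\<lambda>T. gap n (jb n k) * (\<Sum>t<T. arr t n k)) \<longlonglongrightarrow> rest n k - 0"
  proof (rule Lim_transform_eventually[OF tendsto_diff[OF lim X]], intro always_eventually allI)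
    fix T
    show "(if fi n < k then (1 - r n (k - 1)) * gap n (jb n (k - 1)) * (\<Sum>t<T. arr t n (k - 1)) else 0)
      + (if k = fi n then gap n n * (\<Sum>t<Suc T. ent t n) else 0) - alive T (in_state n k (gap n))
      = gap n (jb n k) * (\<Sum>t<T. arr t n k)"
      using gap_balance[OF v, of T] by linarith
  qed
  then have "(\<lambda>T. gap n (jb n k) * (\<Sum>t<T. arr t n k) / gap n (jb n k)) \<longlonglongrightarrow> rest n k / gap n (jb n k)"
    using g by (intro tendsto_divide) auto
  then show ?thesis
    using g by (simp add: sums_def)
qed

text \<open>Once the share \<open>r n k\<close> is stopped, the weight
  \<open>(1 - r n k) * rest n k = rest n (Suc k)\<close> is passed on. Every bound has finite rank,
  so the induction also covers an infinite list.\<close>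

lemma arr_sums:
  assumes ent: "(\<lambda>t. ent t n) sums reach n" and "fi n \<le> k"
  shows "valid n k \<Longrightarrow> (\<lambda>t. arr t n k) sums (rest n k / gap n (jb n k))"
  using assms(2)
proof (induction k rule: dec_induct)
  case base
  have "(\<lambda>T. gap n n * (\<Sum>t<Suc T. ent t n)) \<longlonglongrightarrow> gap n n * reach n"
    using ent unfolding sums_def by (intro tendsto_mult tendsto_const LIMSEQ_Suc)
  then show ?case
    using in_state_summable[OF base order_refl] ent
    by (intro arr_sums_aux base order_refl) (auto simp: sums_iff rest_first mult.commute)
next
  case (step k)
  have k: "1 \<le> k" using step.hyps(1) by (simp add: fi_eq split: if_splits)
  then have v: "valid n k" using valid_SucD step.prems by blast
  note IH = step.IH[OF v]
  have g: "0 < gap n (jb n k)" using gap_pos jb_le[OF v step.hyps(1)] by simp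
  have "(\<lambda>T. (1 - r n k) * gap n (jb n k) * (\<Sum>t<T. arr t n k)) \<longlonglongrightarrow>
      (1 - r n k) * gap n (jb n k) * (rest n k / gap n (jb n k))"
    using IH unfolding sums_def by (intro tendsto_mult tendsto_const)
  moreover have "(1 - r n k) * gap n (jb n k) * (rest n k / gap n (jb n k)) = rest n (Suc k)"
  proof -
    have "(1 - r n k) * gap n (jb n k) * (rest n k / gap n (jb n k)) = (1 - r n k) * rest n k"
      using g by simp
    then show ?thesis
      using r_rest[OF v step.hyps(1)] rest_Suc[OF k step.prems] by (simp add: algebra_simps)
  qed
  ultimately show ?case
    using in_state_summable[OF step.prems] IH step.hyps(1)
    by (intro arr_sums_aux step.prems) (auto simp: sums_iff)
qed

definition stop_at :: "nat \<Rightarrow> nat \<Rightarrow> int \<Rightarrow> real" where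
  "stop_at t n j = alive t (\<lambda>s n' k'. if n' = n \<and> s = j then kill s n' k' else 0)"

text \<open>A toss stops the share \<open>r n k\<close> of the arriving mass. The last bound stops
  all of it, and there \<open>rest_last\<close> leaves a single summand of
  \<open>rest\<close>.\<close>

lemma stop_at_sums:
  assumes ent: "(\<lambda>t. ent t n) sums reach n"
  shows "(\<lambda>t. stop_at t n j) sums \<nu> n j"
proof (cases "j \<in> V n \<and> j \<le> int n")
  case True
  define k where "k = rk n j"
  have k: "valid n k" "fi n \<le> k" "jb n k = j"
    using True valid_rk[of j n] rk_ge_fi[of j n] jb_rk[of j n] by (simp_all add: k_def)
  define c where "c = (if enat k \<le> ay_m \<rho> \<mu> n then r n k else 1)"
  have g: "0 < gap n (jb n k)" using gap_pos True k by simp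
  have "stop_at t n j = c * arr t n k" for t
    unfolding stop_at_def arr_def alive_cmult[symmetric]
  proof (rule alive_cong)
    fix s n' k' assume "reachable t s n' k'"
    then have "n' = n \<Longrightarrow> rk n (jb n k') = k'"
      using jb(2)[of n k'] by (simp add: reachable_def)
    then have *: "n' = n \<Longrightarrow> jb n k' = j \<longleftrightarrow> k' = k"
      using k(3) k_def by metis
    show "(if n' = n \<and> s = j then kill s n' k' else 0) = c * (if n' = n \<and> k' = k \<and> s = jb n k then 1 else 0)"
      unfolding k(3) kill_def c_def using * by (cases "n' = n"; cases "s = j"; cases "k' = k") auto
  qed
  moreover have "(\<lambda>t. c * arr t n k) sums (c * (rest n k / gap n (jb n k)))"
    by (intro sums_mult arr_sums ent k)
  moreover have "c * rest n k = \<nu> n (jb n k) * gap n (jb n k)"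
    using rest_last[OF k(1)] r_rest[OF k(1,2)] by (auto simp: c_def)
  then have "c * (rest n k / gap n (jb n k)) = \<nu> n j"
    using g k(3) by (simp add: field_simps)
  ultimately show ?thesis by simp
next
  case False
  then have "\<nu> n j = 0"
    using \<nu>_in_V \<nu>_top by (auto simp: not_less[symmetric])
  moreover have "stop_at t n j = 0" for t
  proof -
    have "stop_at t n j = alive t (\<lambda>_ _ _. 0)"
      unfolding stop_at_def
    proof (rule alive_cong)
      fix s n' k' assume "reachable t s n' k'"
      then have "valid n' k'" "s \<le> int n'" by (auto simp: reachable_def)
      then show "(if n' = n \<and> s = j then kill s n' k' else 0) = 0"
        using False jb(1)[of n' k'] by (auto simp: kill_def)
    qed
    then show ?thesis by simp
  qed
  ultimately show ?thesis by simp
qed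

text \<open>Finiteness of \<open>J\<close> permits interchanging the sums, and \<open>c\<close> is
  nonnegative wherever the chain can be, so discarding the other positions only lowers the
  total.\<close>

lemma finite_\<nu>_le_sums:
  assumes ent: "(\<lambda>t. ent t n) sums reach n"
    and S: "(\<lambda>t. alive t (\<lambda>s n' k'. kill s n' k' * in_level n c s n' k')) sums S"
    and c: "\<And>s. s \<le> int n \<Longrightarrow> 0 \<le> c s" and J: "finite J"
  shows "(\<Sum>j\<in>J. c j * \<nu> n j) \<le> S"
proof (rule sums_le[OF _ _ S])
  show "(\<lambda>t. \<Sum>j\<in>J. c j * stop_at t n j) sums (\<Sum>j\<in>J. c j * \<nu> n j)"
    by (intro sums_sum sums_mult stop_at_sums ent)
  fix t
  have "(\<Sum>j\<in>J. c j * stop_at t n j) =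
      alive t (\<lambda>s n' k'. \<Sum>j\<in>J. c j * (if n' = n \<and> s = j then kill s n' k' else 0))"
    unfolding stop_at_def alive_sum alive_cmult ..
  also have "\<dots> \<le> alive t (\<lambda>s n' k'. kill s n' k' * in_level n c s n' k')"
  proof (rule alive_mono)
    fix s n' k' assume R: "reachable t s n' k'"
    have "(\<Sum>j\<in>J. c j * (if n' = n \<and> s = j then kill s n' k' else 0)) =
        (if n' = n \<and> s \<in> J then c s * kill s n' k' else 0)"
      using J by (cases "n' = n") (auto simp: sum.delta if_distrib cong: if_cong)
    then show "(\<Sum>j\<in>J. c j * (if n' = n \<and> s = j then kill s n' k' else 0)) \<le> kill s n' k' * in_level n c s n' k'"
      using R c[of s] kill_bounds(1)[of s n' k'] by (auto simp: in_level_def reachable_def)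
  qed
  finally show "(\<Sum>j\<in>J. c j * stop_at t n j) \<le> alive t (\<lambda>s n' k'. kill s n' k' * in_level n c s n' k')" .
qed

lemma level_balance:
  assumes "\<And>s. mean f s = f s"
  shows "alive T (in_level n f) + (\<Sum>t<T. alive t (\<lambda>s n' k'. kill s n' k' * in_level n f s n' k'))
    + f (int n + 1) * (\<Sum>t<Suc T. ent t (Suc n)) = f n * (\<Sum>t<Suc T. ent t n)"
proof (induction T)
  case 0
  show ?case by (auto simp: in_level_def ent_0)
next
  case (Suc T)
  have "mean f = f" using assms by auto
  then show ?case
    using Suc alive_Suc_in_level[of T n f] by (simp add: algebra_simps del: alive.simps)
qed

text \<open>The stopped \<open>gap n\<close> weight is at most the entering weight, because the
  remainder is nonnegative, and at least that by \<open>finite_\<nu>_le_sums\<close>. Hence the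
  remainder vanishes in the limit, and so does the mass in the level, since \<open>gap n\<close> is
  at least \<open>gap n n > 0\<close> there. The entering mass thus splits into the stopped mass
  \<open>s1\<close> and the mass that moves up.\<close>

lemma ent_sums_Suc:
  assumes ent: "(\<lambda>t. ent t n) sums reach n"
  shows "(\<lambda>t. ent t (Suc n)) sums reach (Suc n)"
proof -
  have g: "0 < gap n n" by (simp add: gap_pos)
  have ent_le: "(\<Sum>t<T. ent t n) \<le> reach n" for T
    using sum_le_suminf[of "\<lambda>t. ent t n" "{..<T}"] ent ent_nonneg by (simp add: sums_iff)
  define S where "S c = (\<lambda>t. alive t (\<lambda>s n' k'. kill s n' k' * in_level n c s n' k'))" for c
  have S_nonneg: "0 \<le> S c t" if "\<And>s. s \<le> int n \<Longrightarrow> 0 \<le> c s" for c t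
    unfolding S_def using that kill_bounds(1)
    by (intro alive_nonneg) (auto simp: in_level_def reachable_def)
  have lev_nonneg: "0 \<le> alive t (in_level n c)" if "\<And>s. s \<le> int n \<Longrightarrow> 0 \<le> c s" for c t
    using that by (intro alive_nonneg) (auto simp: in_level_def reachable_def)
  have gap0: "gap n (int n + 1) = 0" by (simp add: gap_def)
  have bal1: "alive T (in_level n (\<lambda>_. 1)) + (\<Sum>t<T. S (\<lambda>_. 1) t) + (\<Sum>t<Suc T. ent t (Suc n)) = (\<Sum>t<Suc T. ent t n)" for T
    using level_balance[of "\<lambda>_. 1" T n] by (simp add: mean_def S_def)
  have balg: "alive T (in_level n (gap n)) + (\<Sum>t<T. S (gap n) t) = gap n n * (\<Sum>t<Suc T. ent t n)" for T
    using level_balance[of "gap n" T n] by (simp add: mean_gap gap0 S_def)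
  have Sg_le: "(\<Sum>t<T. S (gap n) t) \<le> gap n n * reach n" for T
  proof -
    have "0 \<le> alive T (in_level n (gap n))"
      by (intro lev_nonneg gap_nonneg) simp
    moreover have "gap n n * (\<Sum>t<Suc T. ent t n) \<le> gap n n * reach n"
      using g by (intro mult_left_mono ent_le) simp
    ultimately show ?thesis using balg[of T] by linarith
  qed
  have S1_le: "(\<Sum>t<T. S (\<lambda>_. 1) t) \<le> reach n" for T
    using bal1[of T] lev_nonneg[of "\<lambda>_. 1" T] ent_le[of "Suc T"] sum_nonneg[of "{..<Suc T}" "\<lambda>t. ent t (Suc n)"] ent_nonneg
    by (simp del: sum.lessThan_Suc)
  note Sg = sums_of_bounded[OF S_nonneg Sg_le, OF gap_nonneg]
  note S1 = sums_of_bounded[OF S_nonneg S1_le]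
  define sg where "sg = suminf (S (gap n))"
  define s1 where "s1 = suminf (S (\<lambda>_. 1))"
  have Sg: "S (gap n) sums sg" "sg \<le> gap n n * reach n"
    unfolding sg_def by (rule Sg, simp)+
  have S1: "S (\<lambda>_. 1) sums s1"
    unfolding s1_def by (rule S1) simp
  have "reach n * gap n n \<le> sg"
  proof (rule has_sum_le_finite_sums[OF \<nu>_gap_has_sum])
    fix J :: "int set" assume J: "finite J" "J \<subseteq> UNIV"
    show "(\<Sum>j\<in>J. \<nu> n j * gap n j) \<le> sg"
      using finite_\<nu>_le_sums[OF ent Sg(1)[unfolded S_def] gap_nonneg J(1)] by (simp add: mult.commute)
  qed
  with Sg(2) have sg: "sg = gap n n * reach n" by (simp add: mult.commute)
  have Xg: "(\<lambda>T. alive T (in_level n (gap n))) \<longlonglongrightarrow> 0"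
  proof -
    have "(\<lambda>T. gap n n * (\<Sum>t<Suc T. ent t n) - (\<Sum>t<T. S (gap n) t)) \<longlonglongrightarrow> gap n n * reach n - sg"
      using ent Sg(1) unfolding sums_def by (intro tendsto_intros LIMSEQ_Suc)
    then show ?thesis
      unfolding balg[symmetric] sg by simp
  qed
  have L: "(\<lambda>T. alive T (in_level n (\<lambda>_. 1))) \<longlonglongrightarrow> 0"
  proof (rule real_tendsto_sandwich[where f = "\<lambda>_. 0" and h = "\<lambda>T. alive T (in_level n (gap n)) / gap n n"])
    show "(\<lambda>T. alive T (in_level n (gap n)) / gap n n) \<longlonglongrightarrow> 0"
      using tendsto_divide_zero[OF Xg] by simp
    show "\<forall>\<^sub>F T in sequentially. 0 \<le> alive T (in_level n (\<lambda>_. 1))"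
      using lev_nonneg by simp
    show "\<forall>\<^sub>F T in sequentially. alive T (in_level n (\<lambda>_. 1)) \<le> alive T (in_level n (gap n)) / gap n n"
    proof (intro always_eventually allI)
      fix T
      have "gap n n * alive T (in_level n (\<lambda>_. 1)) \<le> alive T (in_level n (gap n))"
        unfolding alive_cmult[symmetric]
        by (intro alive_mono) (auto simp: in_level_def reachable_def gap_def)
      then show "alive T (in_level n (\<lambda>_. 1)) \<le> alive T (in_level n (gap n)) / gap n n"
        using g by (simp add: field_simps)
    qed
  qed simp
  have "(\<lambda>T. (\<Sum>t<Suc T. ent t n) - (\<Sum>t<T. S (\<lambda>_. 1) t) - alive T (in_level n (\<lambda>_. 1)))
      \<longlonglongrightarrow> reach n - s1 - 0"
    using ent S1 L unfolding sums_def by (intro tendsto_intros LIMSEQ_Suc)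
  then have "(\<lambda>T. \<Sum>t<Suc T. ent t (Suc n)) \<longlonglongrightarrow> reach n - s1"
    unfolding bal1[symmetric] by (simp del: sum.lessThan_Suc)
  then have ent_Suc: "(\<lambda>t. ent t (Suc n)) sums (reach n - s1)"
    unfolding sums_def by (rule LIMSEQ_imp_Suc)
  have "reach n - reach (Suc n) \<le> s1"
  proof (rule has_sum_le_finite_sums[OF \<nu>_has_sum])
    fix J :: "int set" assume J: "finite J" "J \<subseteq> UNIV"
    show "sum (\<nu> n) J \<le> s1"
      using finite_\<nu>_le_sums[OF ent S1[unfolded S_def] _ J(1)] by simp
  qed
  \<comment> \<open>The constant function bounds \<open>s1\<close> only from below. The upper bound
    comes from the weight \<open>gap n s - gap n n = g n - g s\<close>, which is nonnegative on the
    level and contains the mass with a negative sign.\<close>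
  moreover have "reach n * gap n n - gap n n * (reach n - reach (Suc n)) \<le> sg - gap n n * s1"
  proof (rule has_sum_le_finite_sums)
    show "((\<lambda>j. \<nu> n j * gap n j - gap n n * \<nu> n j) has_sum
        reach n * gap n n - gap n n * (reach n - reach (Suc n))) UNIV"
      by (intro has_sum_minus has_sum_cmult_right \<nu>_gap_has_sum \<nu>_has_sum)
    fix J :: "int set" assume J: "finite J" "J \<subseteq> UNIV"
    have "(\<lambda>t. S (gap n) t - gap n n * S (\<lambda>_. 1) t) sums (sg - gap n n * s1)"
      by (intro sums_diff sums_mult Sg S1)
    moreover have "S (gap n) t - gap n n * S (\<lambda>_. 1) t = S (\<lambda>s. gap n s - gap n n) t" for t
      unfolding S_def alive_cmult[symmetric] alive_diff[symmetric]
      by (rule alive_cong) (auto simp: in_level_def algebra_simps)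
    ultimately have "(\<lambda>t. S (\<lambda>s. gap n s - gap n n) t) sums (sg - gap n n * s1)"
      by simp
    from finite_\<nu>_le_sums[OF ent this[unfolded S_def] _ J(1)]
    show "(\<Sum>j\<in>J. \<nu> n j * gap n j - gap n n * \<nu> n j) \<le> sg - gap n n * s1"
      by (simp add: gap_def algebra_simps)
  qed
  then have "gap n n * s1 \<le> gap n n * (reach n - reach (Suc n))"
    unfolding sg by (simp add: algebra_simps)
  then have "s1 \<le> reach n - reach (Suc n)"
    using g by (rule mult_left_le_imp_le)
  ultimately have "s1 = reach n - reach (Suc n)" by simp
  with ent_Suc show ?thesis by simp
qed

lemma ent_sums: "(\<lambda>t. ent t n) sums reach n"
proof (induction n)
  case 0
  have "(\<lambda>t. ent t 0) = (\<lambda>t. if t = 0 then 1 else 0)"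
    by (auto simp: ent_def fun_eq_iff split: nat.split)
  then show ?case
    using sums_single[of 0 "\<lambda>_. 1 :: real"] by simp
qed (rule ent_sums_Suc)

section \<open>The law and the mean of the stopping time\<close>

definition killed :: "nat \<Rightarrow> (int \<Rightarrow> real) \<Rightarrow> real" where
  "killed t f = alive t (\<lambda>s n k. kill s n k * f s)"

lemma alive_Suc_position: "alive (Suc t) (\<lambda>s _ _. f s) = alive t (\<lambda>s _ _. mean f s) - killed t (mean f)"
proof -
  have "step (\<lambda>s _ _. f s) = (\<lambda>s n k. mean f s - kill s n k * mean f s)"
    by (auto simp: fun_eq_iff step_def move_def mean_def algebra_simps)
  then show ?thesis
    by (simp add: alive_diff killed_def)
qed

lemma killed_nonneg: "(\<And>s. 0 \<le> f s) \<Longrightarrow> 0 \<le> killed t f"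
  unfolding killed_def using kill_bounds by (intro alive_nonneg) auto

lemma mean_const [simp]: "mean (\<lambda>_. c) = (\<lambda>_. c)"
  by (simp add: mean_def fun_eq_iff algebra_simps)

lemma alive_one: "alive T (\<lambda>_ _ _. 1) + (\<Sum>t<T. killed t (\<lambda>_. 1)) = 1"
proof (induction T)
  case (Suc T)
  then show ?case using alive_Suc_position[of T "\<lambda>_. 1"] by (simp del: alive.simps(2))
qed simp

lemma killed_le_1: "(\<Sum>t<T. killed t (\<lambda>_. 1)) \<le> 1"
  using alive_one[of T] alive_nonneg[of T "\<lambda>_ _ _. 1"] by simp

text \<open>By \<open>filled_eventually\<close> finitely many levels already stop mass
  \<open>m j\<close> at \<open>j\<close>, so the target is a lower bound everywhere. It has total
  mass 1 and the chain has no more than that, which forces equality at each \<open>j\<close> and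
  leaves nothing alive in the limit.\<close>

lemma killed_sums: "(\<lambda>t. killed t (\<lambda>s. of_bool (s = j))) sums m j"
  and killed_total: "(\<lambda>t. killed t (\<lambda>_. 1)) sums 1"
proof -
  define D where "D j t = killed t (\<lambda>s. of_bool (s = j))" for j t
  have D_nonneg: "0 \<le> D j t" for j t
    unfolding D_def by (rule killed_nonneg) simp
  have sum_D: "(\<Sum>j\<in>J. D j t) \<le> killed t (\<lambda>_. 1)" if "finite J" for J t
    unfolding D_def killed_def alive_sum[symmetric] using that kill_bounds(1)
    by (intro alive_mono) (simp add: sum_distrib_left[symmetric] of_bool_def if_distrib cong: if_cong)
  have total: "(\<lambda>t. killed t (\<lambda>_. 1)) sums suminf (\<lambda>t. killed t (\<lambda>_. 1))" "suminf (\<lambda>t. killed t (\<lambda>_. 1)) \<le> 1"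
    by (rule sums_of_bounded[OF killed_nonneg killed_le_1]; simp)+
  have D: "D j sums suminf (D j)" for j
  proof (rule sums_of_bounded(1)[OF D_nonneg])
    fix T
    have "(\<Sum>t<T. D j t) \<le> (\<Sum>t<T. killed t (\<lambda>_. 1))"
      using sum_D[of "{j}"] by (intro sum_mono) simp
    then show "(\<Sum>t<T. D j t) \<le> 1" using killed_le_1[of T] by simp
  qed
  have ge: "m j \<le> suminf (D j)" for j
  proof -
    obtain N where N: "filled N j = m j" using filled_eventually by blast
    have "(\<lambda>t. \<Sum>n<N. stop_at t n j) sums m j"
      unfolding N[symmetric] sum_\<nu>[symmetric] by (intro sums_sum stop_at_sums ent_sums)
    moreover have "(\<Sum>n<N. stop_at t n j) \<le> D j t" for t
      unfolding D_def killed_def stop_at_def alive_sum[symmetric] using kill_bounds(1)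
      by (intro alive_mono) (auto simp: sum.If_cases of_bool_def Int_insert_right)
    ultimately show ?thesis
      by (intro sums_le[OF _ _ D[of j]])
  qed
  have le: "(\<Sum>j\<in>J. suminf (D j)) \<le> suminf (\<lambda>t. killed t (\<lambda>_. 1))" if "finite J" for J
    by (rule sums_le[OF sum_D[OF that] sums_sum[OF D] total(1)])
  have "1 \<le> suminf (\<lambda>t. killed t (\<lambda>_. 1))"
  proof (rule has_sum_le_finite_sums[OF m_has_sum])
    fix J :: "int set" assume J: "finite J" "J \<subseteq> UNIV"
    have "sum m J \<le> (\<Sum>j\<in>J. suminf (D j))" by (intro sum_mono ge)
    also note le[OF J(1)]
    finally show "sum m J \<le> suminf (\<lambda>t. killed t (\<lambda>_. 1))" .
  qed
  with total show "(\<lambda>t. killed t (\<lambda>_. 1)) sums 1" by simp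
  \<comment> \<open>Replacing \<open>m j\<close> by \<open>suminf (D j)\<close> in the partial sums
    still keeps them at most 1, so the excess at \<open>j\<close> is not positive.\<close>
  have "1 \<le> 1 + m j - suminf (D j)"
  proof (rule has_sum_le_finite_sums[OF m_has_sum])
    fix J :: "int set" assume J: "finite J" "J \<subseteq> UNIV"
    have "sum m J \<le> sum m (J - {j}) + m j"
      using J by (cases "j \<in> J") (auto simp: sum.remove)
    moreover have "sum m (J - {j}) \<le> (\<Sum>i\<in>J - {j}. suminf (D i))"
      by (intro sum_mono ge)
    moreover have "suminf (D j) + (\<Sum>i\<in>J - {j}. suminf (D i)) = (\<Sum>i\<in>insert j (J - {j}). suminf (D i))"
      using J by (subst sum.insert) auto
    moreover have "\<dots> \<le> 1"
      using order_trans[OF le total(2)] J by simp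
    ultimately show "sum m J \<le> 1 + m j - suminf (D j)" by linarith
  qed
  then have "suminf (D j) = m j" using ge[of j] by simp
  then show "(\<lambda>t. killed t (\<lambda>s. of_bool (s = j))) sums m j"
    using D[of j] unfolding D_def by simp
qed

section \<open>Finite mean of the stopping time\<close>

lemma alive_one_tendsto: "(\<lambda>T. alive T (\<lambda>_ _ _. 1)) \<longlonglongrightarrow> 0"
proof -
  have "(\<lambda>T. 1 - (\<Sum>t<T. killed t (\<lambda>_. 1))) \<longlonglongrightarrow> 1 - 1"
    using killed_total unfolding sums_def by (intro tendsto_intros)
  moreover have "1 - (\<Sum>t<T. killed t (\<lambda>_. 1)) = alive T (\<lambda>_ _ _. 1)" for T
    using alive_one[of T] by linarith
  ultimately show ?thesis by simp
qed

text \<open>The functions \<open>cvx c\<close> are bounded and convex as functions of \<open>g\<close>, and agree with the negative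
  part on \<open>{- c..}\<close>. For bounded functions the mass that is still alive is negligible in the limit, so
  they transfer the integrability of the target to the stopped walk.\<close>

definition cvx :: "int \<Rightarrow> int \<Rightarrow> real" where
  "cvx c s = (if - c \<le> s then max 0 (- of_int s) else of_int c + (g (- c) - g s) / (g (1 - c) - g (- c)))"

lemma g_diff: "g (s + 1) - g s = (\<rho> - 1) * (g s + 1)"
  unfolding g_add_1 by (simp add: algebra_simps)

context
  fixes c :: int
  assumes c: "1 \<le> c"
begin

lemma cvx_denom: "0 < g (1 - c) - g (- c)"
  by simp

lemma cvx_nonneg: "0 \<le> cvx c s"
  using c by (auto simp: cvx_def intro!: add_nonneg_nonneg divide_nonneg_pos)

lemma cvx_ge: "- c \<le> s \<Longrightarrow> - of_int s \<le> cvx c s"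
  by (simp add: cvx_def)

lemma cvx_bounded: "cvx c s \<le> of_int c + (g (- c) + 1) / (g (1 - c) - g (- c))"
proof (cases "- c \<le> s")
  case True
  have "0 \<le> (g (- c) + 1) / (g (1 - c) - g (- c))"
    using g_gt[of "- c"] by (intro divide_nonneg_pos cvx_denom) simp
  then show ?thesis using True c by (simp add: cvx_def)
next
  case False
  then show ?thesis
    using g_gt[of s] by (simp add: cvx_def divide_right_mono)
qed

lemma cvx_below: "s \<le> - c \<Longrightarrow> cvx c s = of_int c + (g (- c) - g s) / (g (1 - c) - g (- c))"
  using c by (auto simp: cvx_def)

text \<open>The increments of \<open>g\<close> shrink downwards, so below \<open>- c\<close> each
  step down raises \<open>cvx c\<close> by at most 1, whereas it raises \<open>- s\<close> by
  exactly 1.\<close>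

lemma cvx_le: "cvx c s \<le> of_int \<bar>s\<bar>"
proof (cases "- c \<le> s")
  case False
  then have "s \<le> - c" by simp
  then have "cvx c s \<le> - of_int s"
  proof (induction s rule: int_le_induct)
    case (step i)
    have "g i - g (i - 1) \<le> g (1 - c) - g (- c)"
      using g_diff[of "i - 1"] g_diff[of "- c"] step.hyps rho_gt_1 by (simp add: add.commute)
    then have "(g i - g (i - 1)) / (g (1 - c) - g (- c)) \<le> 1"
      using cvx_denom by (simp only: divide_le_eq_1 simp_thms)
    moreover have "cvx c (i - 1) = cvx c i + (g i - g (i - 1)) / (g (1 - c) - g (- c))"
      using step.hyps by (simp add: cvx_below diff_divide_distrib)
    moreover have "real_of_int (i - 1) = of_int i - 1" by simp
    ultimately show ?case using step.IH by linarith
  qed (simp add: cvx_below)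
  then show ?thesis by linarith
qed (simp add: cvx_def)

text \<open>Below \<open>- c\<close> the graph over \<open>g\<close> continues the chord through
  \<open>- c\<close> and \<open>1 - c\<close>, so equality holds for \<open>s \<le> - c\<close>.
  Between \<open>- c\<close> and 0 the drift raises \<open>- s\<close>, and from 0 on the value is
  0.\<close>

lemma cvx_convex: "cvx c s \<le> mean (cvx c) s"
proof -
  consider "0 \<le> s" | "- c < s" "s < 0" | "s = - c" | "s < - c" by linarith
  then show ?thesis
  proof cases
    case 1
    then have "cvx c s = 0" using c by (simp add: cvx_def)
    then show ?thesis
      unfolding mean_def using cvx_nonneg p_pos p_half by simp
  next
    case 2
    then show ?thesis using p_half by (simp add: mean_def cvx_def algebra_simps)
  next
    case 3
    have e: "p * (g (1 - c) - g (- c)) = (1 - p) * (g (- c) - g (- c - 1))"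
      using g_harmonic[of "- c"] by (simp add: algebra_simps)
    define q where "q = (g (- c) - g (- c - 1)) / (g (1 - c) - g (- c))"
    have q: "(1 - p) * q = p"
      using e cvx_denom by (simp add: q_def field_simps)
    have f: "cvx c (s - 1) = of_int c + q" "cvx c (s + 1) = of_int c - 1" "cvx c s = of_int c"
      using 3 c by (auto simp: cvx_def q_def)
    show ?thesis
      unfolding mean_def f using q by (simp add: algebra_simps)
  next
    case 4
    define d where "d = g (1 - c) - g (- c)"
    have e: "cvx c (s + 1) = of_int c + (g (- c) - g (s + 1)) / d"
      "cvx c (s - 1) = of_int c + (g (- c) - g (s - 1)) / d"
      using 4 by (simp_all add: cvx_below d_def)
    have "mean (cvx c) s = of_int c + (g (- c) - (p * g (s + 1) + (1 - p) * g (s - 1))) / d"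
      unfolding mean_def e by (simp add: add_divide_distrib diff_divide_distrib algebra_simps)
    then show ?thesis
      using 4 cvx_below[of s] by (simp add: g_harmonic d_def)
  qed
qed

definition cvx_mass :: "nat \<Rightarrow> real" where
  "cvx_mass T = alive T (\<lambda>s _ _. cvx c s) + (\<Sum>t<T. killed t (cvx c))"

lemma cvx_mass_Suc: "cvx_mass T \<le> cvx_mass (Suc T)"
proof -
  have "alive T (\<lambda>s n k. cvx c s - kill s n k * cvx c s) \<le> alive T (\<lambda>s n k. mean (cvx c) s - kill s n k * mean (cvx c) s)"
  proof (rule alive_mono)
    fix s n k
    show "cvx c s - kill s n k * cvx c s \<le> mean (cvx c) s - kill s n k * mean (cvx c) s"
      using mult_left_mono[OF cvx_convex[of s], of "1 - kill s n k"] kill_bounds(2)[of s n k]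
      by (simp add: algebra_simps)
  qed
  then show ?thesis
    unfolding cvx_mass_def alive_Suc_position by (simp add: alive_diff killed_def)
qed

text \<open>Before time \<open>T\<close> only positions from \<open>- T\<close> to 0 contribute, and
  the mass stopped at \<open>j\<close> never exceeds its final value \<open>m j\<close>.\<close>

lemma killed_cvx_le: "(\<Sum>t<T. killed t (cvx c)) \<le> (\<Sum>\<^sub>\<infinity>j. of_int \<bar>j\<bar> * m j)"
proof -
  have "killed t (cvx c) = (\<Sum>j\<in>{- int T..0}. cvx c j * killed t (\<lambda>s. of_bool (s = j)))" if "t < T" for t
  proof -
    have "killed t (cvx c) = alive t (\<lambda>s n k. \<Sum>j\<in>{- int T..0}. cvx c j * (kill s n k * of_bool (s = j)))"
      unfolding killed_def
    proof (rule alive_cong)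
      fix s n k assume "reachable t s n k"
      then have "- int T \<le> s" using that by (simp add: reachable_def)
      moreover have "cvx c s = 0" if "0 < s" using that c by (simp add: cvx_def)
      ultimately show "kill s n k * cvx c s = (\<Sum>j\<in>{- int T..0}. cvx c j * (kill s n k * of_bool (s = j)))"
        by (cases "0 < s") (auto simp: of_bool_def if_distrib cong: if_cong)
    qed
    then show ?thesis
      unfolding killed_def by (simp only: alive_sum alive_cmult)
  qed
  then have "(\<Sum>t<T. killed t (cvx c)) = (\<Sum>t<T. \<Sum>j\<in>{- int T..0}. cvx c j * killed t (\<lambda>s. of_bool (s = j)))"
    by simp
  also have "\<dots> = (\<Sum>j\<in>{- int T..0}. cvx c j * (\<Sum>t<T. killed t (\<lambda>s. of_bool (s = j))))"
    by (subst sum.swap) (simp add: sum_distrib_left)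
  also have "\<dots> \<le> (\<Sum>j\<in>{- int T..0}. of_int \<bar>j\<bar> * m j)"
  proof (intro sum_mono mult_mono cvx_le)
    fix j
    show "(\<Sum>t<T. killed t (\<lambda>s. of_bool (s = j))) \<le> m j"
      using killed_sums[of j] sum_le_suminf[of "\<lambda>t. killed t (\<lambda>s. of_bool (s = j))" "{..<T}"]
      by (simp add: sums_iff killed_nonneg)
  qed (auto intro!: sum_nonneg killed_nonneg)
  also have "\<dots> \<le> (\<Sum>\<^sub>\<infinity>j. of_int \<bar>j\<bar> * m j)"
    using absm_summable by (intro finite_sum_le_infsum) auto
  finally show ?thesis .
qed

lemma cvx_mass_le: "cvx_mass T \<le> (\<Sum>\<^sub>\<infinity>j. of_int \<bar>j\<bar> * m j)"
proof -
  define C where "C = of_int c + (g (- c) + 1) / (g (1 - c) - g (- c))"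
  have lim: "(\<lambda>U. C * alive U (\<lambda>_ _ _. 1) + (\<Sum>\<^sub>\<infinity>j. of_int \<bar>j\<bar> * m j)) \<longlonglongrightarrow>
      C * 0 + (\<Sum>\<^sub>\<infinity>j. of_int \<bar>j\<bar> * m j)"
    by (intro tendsto_intros alive_one_tendsto)
  have "cvx_mass T \<le> C * alive U (\<lambda>_ _ _. 1) + (\<Sum>\<^sub>\<infinity>j. of_int \<bar>j\<bar> * m j)" if "T \<le> U" for U
  proof -
    have "cvx_mass T \<le> cvx_mass U"
      using that cvx_mass_Suc by (rule lift_Suc_mono_le[rotated])
    moreover have "alive U (\<lambda>s _ _. cvx c s) \<le> C * alive U (\<lambda>_ _ _. 1)"
      unfolding alive_cmult[symmetric] C_def using cvx_bounded by (intro alive_mono) simp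
    ultimately show ?thesis
      using killed_cvx_le[of U] by (simp add: cvx_mass_def)
  qed
  then have "cvx_mass T \<le> C * 0 + (\<Sum>\<^sub>\<infinity>j. of_int \<bar>j\<bar> * m j)"
    by (intro tendsto_lowerbound[OF lim] eventually_sequentiallyI[of T]) auto
  then show ?thesis by simp
qed

end

lemma mean_id: "mean of_int s = of_int s - (1 - 2 * p)"
  by (simp add: mean_def algebra_simps)

text \<open>The bound in \<open>cvx_mass_le\<close> does not depend on \<open>c\<close>, so
  \<open>c\<close> may grow with \<open>T\<close>: up to time \<open>T\<close> the walk stays above
  \<open>- (T + 1)\<close>, where \<open>cvx (T + 1)\<close> dominates \<open>- s\<close>.\<close>

lemma alive_one_summable: "summable (\<lambda>t. alive t (\<lambda>_ _ _. 1))"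
proof -
  define A where "A = (\<Sum>\<^sub>\<infinity>j. of_int \<bar>j\<bar> * m j)"
  have "(1 - 2 * p) * (\<Sum>t<T. alive (Suc t) (\<lambda>_ _ _. 1)) \<le> A" for T
  proof -
    \<comment> \<open>Each surviving step lowers the mean position by \<open>1 - 2 * p\<close>, and
      \<open>alive (Suc t)\<close> of the constant 1 is the mass that makes the step at time
      \<open>t\<close>.\<close>
    have bal: "alive T (\<lambda>s _ _. of_int s) + (\<Sum>t<T. killed t of_int) + (1 - 2 * p) * (\<Sum>t<T. alive (Suc t) (\<lambda>_ _ _. 1)) = 0"
    proof (induction T)
      case (Suc T)
      have "alive (Suc T) (\<lambda>s _ _. of_int s) = alive T (\<lambda>s n k. of_int s - kill s n k * of_int s
          - (1 - 2 * p) * (1 - kill s n k * 1))"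
        unfolding alive_Suc_position killed_def alive_diff[symmetric]
        by (rule alive_cong) (simp add: mean_id algebra_simps)
      also have "\<dots> = alive T (\<lambda>s _ _. of_int s) - killed T of_int - (1 - 2 * p) * alive (Suc T) (\<lambda>_ _ _. 1)"
        unfolding alive_diff alive_cmult alive_Suc_position killed_def mean_const ..
      finally show ?case using Suc by (simp add: algebra_simps del: alive.simps)
    qed simp
    have T: "1 \<le> int T + 1" by simp
    have neg: "- alive t (\<lambda>s n k. w s n k * of_int s) \<le> alive t (\<lambda>s n k. w s n k * cvx (int T + 1) s)"
      if "t \<le> T" "\<And>s n k. 0 \<le> w s n k" for t w
    proof -
      have "- 1 * alive t (\<lambda>s n k. w s n k * of_int s) = alive t (\<lambda>s n k. - 1 * (w s n k * of_int s))"
        unfolding alive_cmult ..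
      also have "\<dots> \<le> alive t (\<lambda>s n k. w s n k * cvx (int T + 1) s)"
      proof (rule alive_mono)
        fix s n k assume "reachable t s n k"
        then have "- (int T + 1) \<le> s" using that(1) by (simp add: reachable_def)
        from mult_left_mono[OF cvx_ge[OF T this] that(2)[of s n k]]
        show "- 1 * (w s n k * of_int s) \<le> w s n k * cvx (int T + 1) s" by simp
      qed
      finally show ?thesis by simp
    qed
    have "- (\<Sum>t<T. killed t of_int) \<le> (\<Sum>t<T. killed t (cvx (int T + 1)))"
      unfolding sum_negf[symmetric] killed_def using kill_bounds(1) by (intro sum_mono neg) auto
    moreover have "- alive T (\<lambda>s _ _. of_int s) \<le> alive T (\<lambda>s _ _. cvx (int T + 1) s)"
      using neg[of T "\<lambda>_ _ _. 1"] by simp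
    ultimately show ?thesis
      using bal cvx_mass_le[OF T, of T] unfolding cvx_mass_def[OF T] A_def by linarith
  qed
  then have "summable (\<lambda>t. alive (Suc t) (\<lambda>_ _ _. 1))"
    using p_half
    by (intro summableI_nonneg_bounded[where x = "A / (1 - 2 * p)"] alive_nonneg)
      (auto simp: pos_le_divide_eq mult.commute simp del: alive.simps)
  then show ?thesis
    by (rule summable_Suc_iff[THEN iffD1])
qed

end

section \<open>The walk and the coins\<close>

lemma length_history [simp]: "length (history S t \<omega>) = Suc t"
  by (simp add: history_def)

lemma history_nth [simp]: "s \<le> t \<Longrightarrow> history S t \<omega> ! s = S s \<omega>"
  by (simp add: history_def del: upt_Suc)

lemma history_neq_Nil [simp]: "history S t \<omega> \<noteq> []"
  by (simp add: history_def)

lemma last_history [simp]: "last (history S t \<omega>) = S t \<omega>"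
  by (simp add: last_conv_nth)

lemma history_Suc: "history S (Suc t) \<omega> = history S t \<omega> @ [S (Suc t) \<omega>]"
  by (simp add: history_def)

lemma take_history: "s \<le> t \<Longrightarrow> take (Suc s) (history S t \<omega>) = history S s \<omega>"
  by (rule nth_equalityI) auto

lemma history_eq_iff: "length h = Suc t \<Longrightarrow> history S t \<omega> = h \<longleftrightarrow> (\<forall>s\<le>t. S s \<omega> = h ! s)"
  by (auto simp: list_eq_iff_nth_eq less_Suc_eq_le)

lemma ay_state_cong: "(\<And>s. s \<le> t \<Longrightarrow> y s = y' s) \<Longrightarrow> ay_state \<rho> \<mu> y t = ay_state \<rho> \<mu> y' t"
  by (induction t) simp_all

context centred
begin

definition state :: "int list \<Rightarrow> nat \<times> nat" where
  "state h = ay_state \<rho> \<mu> (\<lambda>s. g (h ! s)) (length h - 1)"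

lemma state_history: "ay_state \<rho> \<mu> (\<lambda>s. g (S s \<omega>)) t = state (history S t \<omega>)"
  unfolding state_def by (rule trans[OF ay_state_cong]) auto

lemma ay_state_valid:
  "valid (fst (ay_state \<rho> \<mu> y t)) (snd (ay_state \<rho> \<mu> y t))"
proof (induction t)
  case 0
  then show ?case using valid_fi by simp
next
  case (Suc t)
  obtain n k where nk: "ay_state \<rho> \<mu> y t = (n, k)" by (cases "ay_state \<rho> \<mu> y t")
  have "valid n k" using Suc nk by simp
  then show ?case
    using nk valid_fi valid_Suc[of k n] by (auto simp: valid_def)
qed

definition sure :: "int list \<Rightarrow> bool" where
  "sure h = (case state h of (n, k) \<Rightarrow> last h = jb n k \<and> \<not> enat k \<le> ay_m \<rho> \<mu> n)"
definition toss :: "int list \<Rightarrow> bool" where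
  "toss h = (case state h of (n, k) \<Rightarrow> last h = jb n k \<and> enat k \<le> ay_m \<rho> \<mu> n)"
text \<open>Coins are indexed by histories; since the state is a function of the history, a tail
  probability that depends on the state is a legitimate choice for them.\<close>

definition coin_prob :: "int list \<Rightarrow> real" where
  "coin_prob h = (case state h of (n, k) \<Rightarrow> r n k)"
definition kill_hist :: "int list \<Rightarrow> real" where
  "kill_hist h = (case state h of (n, k) \<Rightarrow> kill (last h) n k)"

lemma state_valid: "state h = (n, k) \<Longrightarrow> valid n k"
  using ay_state_valid[of "\<lambda>s. g (h ! s)" "length h - 1"] by (simp add: state_def)

lemma ay_sure_stop_iff: "ay_sure_stop \<rho> \<mu> (\<lambda>s. g (S s \<omega>)) t \<longleftrightarrow> sure (history S t \<omega>)"
proof -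
  obtain n k where nk: "state (history S t \<omega>) = (n, k)" by (cases "state (history S t \<omega>)")
  show ?thesis
    using ay_bound_eq[OF state_valid[OF nk]] valid_cases[OF state_valid[OF nk]]
    by (simp add: ay_sure_stop_def sure_def state_history nk)
qed

lemma ay_toss_iff: "ay_toss \<rho> \<mu> (\<lambda>s. g (S s \<omega>)) t n k \<longleftrightarrow> toss (history S t \<omega>) \<and> state (history S t \<omega>) = (n, k)"
  using ay_bound_eq[OF state_valid, of "history S t \<omega>" n k]
  by (auto simp: ay_toss_def toss_def state_history)

lemma state_snoc:
  assumes "h \<noteq> []" "state h = (n, k)"
  shows "state (h @ [x]) = (if x = int n + 1 then (Suc n, fi (Suc n)) else (n, after_head (last h) n k))"
proof -
  obtain t where t: "length h = Suc t" using assms(1) by (cases h) auto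
  have "ay_state \<rho> \<mu> (\<lambda>s. g ((h @ [x]) ! s)) t = (n, k)"
    using assms(2) t unfolding state_def
    by (subst ay_state_cong[where y' = "\<lambda>s. g (h ! s)"]) (auto simp: nth_append)
  moreover have "(h @ [x]) ! t = last h" "(h @ [x]) ! Suc t = x"
    using t assms(1) by (auto simp: nth_append last_conv_nth)
  moreover have "g (last h) = ay_bound \<rho> \<mu> n k \<longleftrightarrow> last h = jb n k"
    using ay_bound_eq[OF state_valid[OF assms(2)]] by simp
  ultimately show ?thesis
    using t by (simp add: state_def after_head_def)
qed

section \<open>The functional \<open>alive\<close> as a sum over paths\<close>

text \<open>Histories with steps 1 and -1 only. Others may belong to \<open>histories M S\<close>,
  but they occur on a null set (\<open>AE_paths\<close>).\<close>

primrec paths :: "nat \<Rightarrow> int list set" where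
  "paths 0 = {[0]}"
| "paths (Suc t) = (\<lambda>(h, d). h @ [last h + d]) ` (paths t \<times> {1, - 1})"

lemma finite_paths [simp]: "finite (paths t)"
  by (induction t) auto

lemma length_paths: "h \<in> paths t \<Longrightarrow> length h = Suc t"
  by (induction t arbitrary: h) auto

lemma sum_paths_Suc:
  "(\<Sum>h\<in>paths (Suc t). f h) = (\<Sum>h\<in>paths t. f (h @ [last h + 1]) + f (h @ [last h - 1]))"
proof -
  have "inj_on (\<lambda>(h, d). h @ [last h + d]) (paths t \<times> {1, - 1})"
    by (auto simp: inj_on_def)
  then have "(\<Sum>h\<in>paths (Suc t). f h) = (\<Sum>(h, d)\<in>paths t \<times> {1, - 1}. f (h @ [last h + d]))"
    by (simp add: sum.reindex case_prod_unfold o_def)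
  then show ?thesis
    by (simp add: sum.cartesian_product[symmetric])
qed

primrec walk_weight :: "nat \<Rightarrow> int list \<Rightarrow> real" where
  "walk_weight 0 h = 1"
| "walk_weight (Suc t) h = walk_weight t h * (if h ! Suc t - h ! t = 1 then p else 1 - p)"

text \<open>The decision at time \<open>t\<close> itself is left out, in agreement with
  \<open>alive t\<close>.\<close>

definition coin_weight :: "nat \<Rightarrow> int list \<Rightarrow> real" where
  "coin_weight t h = (\<Prod>s<t. 1 - kill_hist (take (Suc s) h))"

lemma walk_weight_snoc: "length h = Suc t \<Longrightarrow> u \<le> t \<Longrightarrow> walk_weight u (h @ [x]) = walk_weight u h"
  by (induction u) (auto simp: nth_append)

lemma walk_weight_pos: "0 < walk_weight t h"
  using p_pos p_half by (induction t) auto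

lemma coin_weight_snoc: "length h = Suc t \<Longrightarrow> u \<le> Suc t \<Longrightarrow> coin_weight u (h @ [x]) = coin_weight u h"
  unfolding coin_weight_def by (intro prod.cong) auto

lemma coin_weight_Suc: "length h = Suc t \<Longrightarrow> coin_weight (Suc t) h = coin_weight t h * (1 - kill_hist h)"
  by (simp add: coin_weight_def)

text \<open>Both sides unfold at the last step: \<open>step\<close> sums over the two extensions of
  a path, with the survival factor of the old end point in front.\<close>

lemma alive_eq_sum_paths:
  "alive t \<phi> = (\<Sum>h\<in>paths t. walk_weight t h * coin_weight t h * (case state h of (n, k) \<Rightarrow> \<phi> (last h) n k))"
proof (induction t arbitrary: \<phi>)
  case 0
  show ?case by (simp add: coin_weight_def state_def)
next
  case (Suc t)
  show ?case
    unfolding sum_paths_Suc alive.simps Suc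
  proof (rule sum.cong)
    fix h assume "h \<in> paths t"
    then have l: "length h = Suc t" "h \<noteq> []" by (auto dest: length_paths)
    obtain n k where nk: "state h = (n, k)" by (cases "state h")
    let ?w = "walk_weight t h * coin_weight t h"
    have ht: "(h @ [x]) ! Suc t - (h @ [x]) ! t = x - last h" for x
      using l by (simp add: nth_append last_conv_nth)
    have w: "walk_weight (Suc t) (h @ [x]) * coin_weight (Suc t) (h @ [x]) =
        ?w * (1 - kill (last h) n k) * (if x - last h = 1 then p else 1 - p)" for x
      using l nk by (simp add: ht walk_weight_snoc coin_weight_snoc coin_weight_Suc kill_hist_def)
    have \<phi>: "(case state (h @ [x]) of (n, k) \<Rightarrow> \<phi> (last (h @ [x])) n k) = move \<phi> x n (after_head (last h) n k)" for x
      using state_snoc[OF l(2) nk] by (simp add: move_def)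
    show "?w * (case state h of (n, k) \<Rightarrow> step \<phi> (last h) n k) =
      walk_weight (Suc t) (h @ [last h + 1]) * coin_weight (Suc t) (h @ [last h + 1]) *
        (case state (h @ [last h + 1]) of (n, k) \<Rightarrow> \<phi> (last (h @ [last h + 1])) n k) +
      walk_weight (Suc t) (h @ [last h - 1]) * coin_weight (Suc t) (h @ [last h - 1]) *
        (case state (h @ [last h - 1]) of (n, k) \<Rightarrow> \<phi> (last (h @ [last h - 1])) n k)"
      unfolding w \<phi> nk by (simp add: step_def algebra_simps)
  qed simp
qed

end

section \<open>Probabilities of walk events and coin events\<close>

locale coin_walk = centred p \<rho> \<mu> + simple_random_walk M S p
  for p \<rho> :: real and \<mu> :: "int measure" and M :: "'a measure" and S :: "nat \<Rightarrow> 'a \<Rightarrow> int" +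
  fixes \<xi> :: "int list \<Rightarrow> 'a \<Rightarrow> bool"
  assumes coins: "coin_family M S coin_prob \<xi>"
begin

definition X :: "nat \<Rightarrow> 'a \<Rightarrow> int" where "X t \<omega> = S (Suc t) \<omega> - S t \<omega>"

lemma X_measurable [measurable]: "X t \<in> M \<rightarrow>\<^sub>M count_space UNIV"
  using indep_increments unfolding indep_vars_def X_def by simp

lemma S_measurable [measurable]: "S t \<in> M \<rightarrow>\<^sub>M count_space UNIV"
proof (induction t)
  case 0
  then show ?case
    using S_0 by (subst measurable_cong[where g = "\<lambda>_. 0"]) auto
next
  case (Suc t)
  have "(\<lambda>\<omega>. S t \<omega> + X t \<omega>) \<in> M \<rightarrow>\<^sub>M count_space UNIV"
    by (rule measurable_compose_countable[OF _ Suc])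
      (rule measurable_compose[OF X_measurable], simp)
  then show ?case by (simp add: X_def)
qed

definition at_hist :: "int list \<Rightarrow> 'a set" where
  "at_hist h = {\<omega> \<in> space M. \<forall>s<length h. S s \<omega> = h ! s}"

lemma at_hist_sets [measurable]: "at_hist h \<in> events"
  unfolding at_hist_def by measurable

lemma at_hist_eq: "length h = Suc t \<Longrightarrow> at_hist h = {\<omega> \<in> space M. history S t \<omega> = h}"
  by (auto simp: at_hist_def history_eq_iff less_Suc_eq_le)

lemma prob_X: "prob {\<omega> \<in> space M. X t \<omega> = d} = (if d = 1 then p else 1 - p)" if "d = 1 \<or> d = - 1"
  using that prob_up[of t] prob_down[of t] by (auto simp: X_def)

lemma prob_at_hist: "h \<in> paths t \<Longrightarrow> prob (at_hist h) = walk_weight t h"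
proof -
  assume h: "h \<in> paths t"
  then have l: "length h = Suc t" by (rule length_paths)
  have h0: "h ! 0 = 0 \<and> (\<forall>s<t. h ! Suc s - h ! s = 1 \<or> h ! Suc s - h ! s = - 1)"
    using h
  proof (induction t arbitrary: h)
    case (Suc t)
    then obtain h' d where h': "h' \<in> paths t" "h = h' @ [last h' + d]" "d = 1 \<or> d = - 1" by auto
    have l: "length h' = Suc t" using h'(1) by (rule length_paths)
    have "h ! Suc t - h ! t = d"
      using l h'(2) last_conv_nth[of h'] by (cases "h' = []") (auto simp: nth_append)
    moreover have "h ! s = h' ! s" if "s \<le> t" for s
      using that l h'(2) by (simp add: nth_append)
    ultimately show ?case
      using Suc.IH[OF h'(1)] h'(3) by (auto simp: less_Suc_eq)
  qed simp
  have eq: "at_hist h = (\<Inter>s\<in>{..<t}. X s -` {h ! Suc s - h ! s} \<inter> space M) \<inter> space M"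
  proof -
    have "(\<forall>s<length h. S s \<omega> = h ! s) \<longleftrightarrow> (\<forall>s<t. X s \<omega> = h ! Suc s - h ! s)" if \<omega>: "\<omega> \<in> space M" for \<omega>
    proof
      assume *: "\<forall>s<t. X s \<omega> = h ! Suc s - h ! s"
      have "s < length h \<longrightarrow> S s \<omega> = h ! s" for s
      proof (induction s)
        case 0
        then show ?case using h0 S_0[OF \<omega>] by simp
      next
        case (Suc s)
        then show ?case using * l by (force simp: X_def)
      qed
      then show "\<forall>s<length h. S s \<omega> = h ! s" by blast
    qed (use l in \<open>simp add: X_def\<close>)
    then show ?thesis by (auto simp: at_hist_def)
  qed
  have pX: "prob (X s -` {h ! Suc s - h ! s} \<inter> space M) = (if h ! Suc s - h ! s = 1 then p else 1 - p)" if "s < t" for s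
  proof -
    have "X s -` {h ! Suc s - h ! s} \<inter> space M = {\<omega> \<in> space M. X s \<omega> = h ! Suc s - h ! s}" by auto
    then show ?thesis using prob_X[of "h ! Suc s - h ! s" s] h0 that by simp
  qed
  have "prob (at_hist h) = (\<Prod>s<t. if h ! Suc s - h ! s = 1 then p else 1 - p)"
  proof (cases "t = 0")
    case True
    then show ?thesis unfolding eq by (simp add: prob_space)
  next
    case False
    have "indep_vars (\<lambda>_. count_space UNIV) X {..<t}"
      using indep_increments unfolding X_def[abs_def] by (rule indep_vars_subset) simp
    then have "prob (\<Inter>s\<in>{..<t}. X s -` {h ! Suc s - h ! s} \<inter> space M) =
        (\<Prod>s<t. prob (X s -` {h ! Suc s - h ! s} \<inter> space M))"
      using False by (intro indep_varsD_finite) auto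
    moreover have "(\<Inter>s\<in>{..<t}. X s -` {h ! Suc s - h ! s} \<inter> space M) \<subseteq> space M"
      using False by auto
    ultimately show ?thesis
      unfolding eq by (simp add: Int_absorb2 pX)
  qed
  also have "\<dots> = walk_weight t h"
    by (induction t) auto
  finally show ?thesis .
qed

text \<open>The properties of the coins are given only for histories that occur. A path does occur,
  because its event has positive probability.\<close>

lemma paths_histories:
  assumes "h \<in> paths t" "s \<le> t"
  shows "take (Suc s) h \<in> histories M S"
proof -
  have "at_hist h \<noteq> {}"
    using prob_at_hist[OF assms(1)] walk_weight_pos[of t h] by auto
  then obtain \<omega> where "\<omega> \<in> space M" "history S t \<omega> = h"
    using at_hist_eq[OF length_paths[OF assms(1)]] by auto
  then show ?thesis
    using take_history[OF assms(2), of S \<omega>] by (auto simp: histories_def)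
qed

text \<open>Stated for a fixed list rather than the random history, so that the event involves the
  coins alone and is independent of the walk.\<close>

definition heads :: "nat \<Rightarrow> int list \<Rightarrow> 'a set" where
  "heads t h = {\<omega> \<in> space M. \<forall>s<t. \<not> sure (take (Suc s) h) \<and> \<not> (toss (take (Suc s) h) \<and> \<xi> (take (Suc s) h) \<omega>)}"

lemma \<xi>_measurable: "h \<in> histories M S \<Longrightarrow> \<xi> h \<in> M \<rightarrow>\<^sub>M count_space UNIV"
  using coins unfolding coin_family_def indep_vars_def by blast

text \<open>Expressing a sure stop by the empty set and the absence of a toss by the full set turns
  every survival factor into the probability of an event of one coin.\<close>

lemma prob_\<xi>:
  assumes "h \<in> histories M S"
  shows "prob (\<xi> h -` (if sure h then {} else if toss h then {False} else UNIV) \<inter> space M) = 1 - kill_hist h"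
proof -
  obtain n k where nk: "state h = (n, k)" by (cases "state h")
  have "prob (\<xi> h -` {False} \<inter> space M) = measure (distr M (count_space UNIV) (\<xi> h)) {False}"
    using \<xi>_measurable[OF assms] by (simp add: measure_distr)
  also have "\<dots> = 1 - coin_prob h"
    using coins assms by (simp add: coin_family_def measure_pmf_single)
  finally have *: "prob (\<xi> h -` {False} \<inter> space M) = 1 - r n k"
    by (simp add: coin_prob_def nk)
  show ?thesis
    using * by (auto simp: kill_hist_def kill_def nk sure_def toss_def prob_space)
qed

lemma prob_heads:
  assumes h: "h \<in> paths t" and u: "u \<le> Suc t"
  shows "prob (heads u h) = coin_weight u h"
proof (cases "u = 0")
  case True
  then show ?thesis by (simp add: heads_def coin_weight_def prob_space)
next
  case False
  define A where "A h = (if sure h then {} else if toss h then {False} else UNIV)" for h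
  have l: "length h = Suc t" using h by (rule length_paths)
  let ?T = "\<lambda>s. take (Suc s) h"
  have len: "length (?T s) = Suc s" if "s < u" for s
    using that l u by simp
  \<comment> \<open>Prefixes of different lengths differ, so different times use different
    coins.\<close>
  have inj: "inj_on ?T {..<u}"
  proof (rule inj_onI)
    fix a b assume ab: "a \<in> {..<u}" "b \<in> {..<u}" "?T a = ?T b"
    have "Suc a = length (?T a)" using len[of a] ab(1) by simp
    also have "\<dots> = length (?T b)" by (simp only: ab(3))
    also have "\<dots> = Suc b" using len[of b] ab(2) by simp
    finally show "a = b" by simp
  qed
  have sub: "?T ` {..<u} \<subseteq> histories M S"
    using paths_histories[OF h] u by auto
  have "indep_vars (\<lambda>_. count_space UNIV) \<xi> (?T ` {..<u})"
    using coins sub unfolding coin_family_def by (blast intro: indep_vars_subset)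
  then have "prob (\<Inter>i\<in>?T ` {..<u}. \<xi> i -` A i \<inter> space M) = (\<Prod>i\<in>?T ` {..<u}. prob (\<xi> i -` A i \<inter> space M))"
    using False by (intro indep_varsD_finite) auto
  also have "\<dots> = (\<Prod>s<u. prob (\<xi> (?T s) -` A (?T s) \<inter> space M))"
    by (subst prod.reindex[OF inj]) (simp only: o_def)
  also have "\<dots> = coin_weight u h"
    unfolding coin_weight_def A_def using sub by (intro prod.cong refl prob_\<xi>) auto
  also have "(\<Inter>i\<in>?T ` {..<u}. \<xi> i -` A i \<inter> space M) = heads u h"
  proof -
    have *: "\<xi> i \<omega> \<in> A i \<longleftrightarrow> \<not> sure i \<and> \<not> (toss i \<and> \<xi> i \<omega>)" for i \<omega>
      by (simp add: A_def)
    show ?thesis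
      unfolding heads_def *[symmetric] using False by auto
  qed
  finally show ?thesis .
qed

lemma prob_at_hist_heads:
  assumes h: "h \<in> paths t" and u: "u \<le> Suc t"
  shows "prob (at_hist h \<inter> heads u h) = walk_weight t h * coin_weight u h"
proof -
  have l: "length h = Suc t" using h by (rule length_paths)
  have sub: "take (Suc s) h \<in> histories M S" if "s < u" for s
    using paths_histories[OF h] u that by auto
  have "at_hist h = (\<lambda>\<omega> t. S t \<omega>) -` {f \<in> space (\<Pi>\<^sub>M t\<in>UNIV. count_space UNIV). \<forall>s<length h. f s = h ! s} \<inter> space M"
    by (auto simp: at_hist_def space_PiM)
  also have "\<dots> \<in> sets (vimage_algebra (space M) (\<lambda>\<omega> t. S t \<omega>) (\<Pi>\<^sub>M t\<in>UNIV. count_space UNIV))"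
    by (intro in_vimage_algebra) measurable
  finally have 1: "at_hist h \<in> sets (vimage_algebra (space M) (\<lambda>\<omega> t. S t \<omega>) (\<Pi>\<^sub>M t\<in>UNIV. count_space UNIV))" .
  define P where "P f \<longleftrightarrow> (\<forall>s<u. \<not> sure (take (Suc s) h) \<and> \<not> (toss (take (Suc s) h) \<and> f (take (Suc s) h)))" for f
  have "heads u h = (\<lambda>\<omega>. \<lambda>h\<in>histories M S. \<xi> h \<omega>) -` {f \<in> space (\<Pi>\<^sub>M h\<in>histories M S. count_space UNIV). P f} \<inter> space M"
    using sub by (auto simp: heads_def space_PiM P_def)
  also have "\<dots> \<in> sets (vimage_algebra (space M) (\<lambda>\<omega>. \<lambda>h\<in>histories M S. \<xi> h \<omega>) (\<Pi>\<^sub>M h\<in>histories M S. count_space UNIV))"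
  proof (intro in_vimage_algebra)
    have [measurable]: "Measurable.pred (\<Pi>\<^sub>M h\<in>histories M S. count_space UNIV) (\<lambda>f. f (take (Suc s) h))" if "s < u" for s
      using measurable_component_singleton[OF sub[OF that], of "\<lambda>_. count_space UNIV"] by simp
    show "{f \<in> space (\<Pi>\<^sub>M h\<in>histories M S. count_space UNIV). P f} \<in> sets (\<Pi>\<^sub>M h\<in>histories M S. count_space UNIV)"
      unfolding P_def by measurable
  qed
  finally have 2: "heads u h \<in> sets (vimage_algebra (space M) (\<lambda>\<omega>. \<lambda>h\<in>histories M S. \<xi> h \<omega>) (\<Pi>\<^sub>M h\<in>histories M S. count_space UNIV))" .
  have "prob (at_hist h \<inter> heads u h) = prob (at_hist h) * prob (heads u h)"
    using coins unfolding coin_family_def by (intro indep_setD[OF _ 1 2]) blast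
  then show ?thesis
    by (simp add: prob_at_hist[OF h] prob_heads[OF h u])
qed

lemma AE_paths: "AE \<omega> in M. history S t \<omega> \<in> paths t"
proof -
  have "AE \<omega> in M. X s \<omega> = 1 \<or> X s \<omega> = - 1" for s
  proof -
    have "prob {\<omega> \<in> space M. X s \<omega> = 1 \<or> X s \<omega> = - 1} =
        prob ({\<omega> \<in> space M. X s \<omega> = 1} \<union> {\<omega> \<in> space M. X s \<omega> = - 1})"
      by (intro arg_cong[where f = prob]) auto
    also have "\<dots> = 1"
      by (subst finite_measure_Union) (auto simp: prob_X)
    finally show ?thesis
      by (subst prob_Collect_eq_1[symmetric]) auto
  qed
  then have "AE \<omega> in M. \<forall>s. X s \<omega> = 1 \<or> X s \<omega> = - 1"
    by (simp add: AE_all_countable)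
  then show ?thesis
  proof (rule AE_mp, intro AE_I2 impI)
    fix \<omega> assume \<omega>: "\<omega> \<in> space M" "\<forall>s. X s \<omega> = 1 \<or> X s \<omega> = - 1"
    show "history S t \<omega> \<in> paths t"
    proof (induction t)
      case 0
      then show ?case using S_0[OF \<omega>(1)] by (simp add: history_def)
    next
      case (Suc t)
      have "history S (Suc t) \<omega> = (\<lambda>(h, d). h @ [last h + d]) (history S t \<omega>, X t \<omega>)"
        by (simp add: history_Suc X_def)
      moreover have "X t \<omega> \<in> {1, - 1}" using \<omega>(2) by auto
      ultimately show ?case using Suc by (auto intro!: image_eqI[of _ _ "(history S t \<omega>, X t \<omega>)"])
    qed
  qed
qed

lemma prob_by_paths:
  assumes "A \<in> events"
  shows "prob A = (\<Sum>h\<in>paths t. prob (A \<inter> at_hist h))"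
proof -
  have "prob A = prob (\<Union>h\<in>paths t. A \<inter> at_hist h)"
  proof (rule finite_measure_eq_AE)
    show "AE \<omega> in M. \<omega> \<in> A \<longleftrightarrow> \<omega> \<in> (\<Union>h\<in>paths t. A \<inter> at_hist h)"
      using AE_paths[of t] AE_space
    proof eventually_elim
      case (elim \<omega>)
      have "\<omega> \<in> at_hist (history S t \<omega>)"
        using elim(2) by (simp add: at_hist_def less_Suc_eq_le)
      then show ?case using elim(1) by blast
    qed
  qed (intro assms sets.finite_UN sets.Int at_hist_sets finite_paths)+
  also have "\<dots> = (\<Sum>h\<in>paths t. prob (A \<inter> at_hist h))"
  proof (rule finite_measure_finite_Union)
    show "(\<lambda>h. A \<inter> at_hist h) ` paths t \<subseteq> events" using assms by auto
    show "disjoint_family_on (\<lambda>h. A \<inter> at_hist h) (paths t)"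
      by (auto simp: disjoint_family_on_def at_hist_eq[OF length_paths])
  qed simp
  finally show ?thesis .
qed

definition stopped :: "nat \<Rightarrow> 'a \<Rightarrow> bool" where
  "stopped t \<omega> \<longleftrightarrow> sure (history S t \<omega>) \<or> toss (history S t \<omega>) \<and> \<xi> (history S t \<omega>) \<omega>"

definition \<tau> :: "'a \<Rightarrow> enat" where
  "\<tau> \<omega> = Inf (enat ` {t. stopped t \<omega>})"

lemma \<tau>_le_iff: "\<tau> \<omega> \<le> enat t \<longleftrightarrow> (\<exists>s\<le>t. stopped s \<omega>)"
proof
  assume le: "\<tau> \<omega> \<le> enat t"
  then have ne: "enat ` {t. stopped t \<omega>} \<noteq> {}"
    by (auto simp: \<tau>_def Inf_enat_def split: if_splits)
  then have "\<tau> \<omega> \<in> enat ` {t. stopped t \<omega>}"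
    unfolding \<tau>_def Inf_enat_def by (auto intro: LeastI)
  then show "\<exists>s\<le>t. stopped s \<omega>" using le by auto
next
  assume "\<exists>s\<le>t. stopped s \<omega>"
  then obtain s where "s \<le> t" "stopped s \<omega>" by blast
  then have "\<tau> \<omega> \<le> enat s"
    unfolding \<tau>_def by (intro Inf_lower) auto
  then show "\<tau> \<omega> \<le> enat t" using \<open>s \<le> t\<close> by (meson enat_ord_simps(1) order_trans)
qed

lemma \<tau>_ge_iff: "enat t \<le> \<tau> \<omega> \<longleftrightarrow> (\<forall>s<t. \<not> stopped s \<omega>)"
proof (cases t)
  case (Suc u)
  have "enat t \<le> \<tau> \<omega> \<longleftrightarrow> \<not> \<tau> \<omega> \<le> enat u"
    using Suc by (cases "\<tau> \<omega>") auto
  then show ?thesis by (auto simp: \<tau>_le_iff Suc less_Suc_eq_le)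
qed (simp add: zero_enat_def[symmetric])

lemma history_measurable [measurable]: "Measurable.pred M (\<lambda>\<omega>. Q (history S t \<omega>))"
proof -
  have "{\<omega> \<in> space M. Q (history S t \<omega>)} = (\<Union>h\<in>{h. Q h \<and> length h = Suc t}. at_hist h)"
    by (auto simp: at_hist_eq)
  also have "\<dots> \<in> events" by (intro sets.countable_UN') auto
  finally show ?thesis by (simp add: pred_def)
qed

lemma stopped_measurable [measurable]: "Measurable.pred M (stopped t)"
proof -
  have "{\<omega> \<in> space M. toss (history S t \<omega>) \<and> \<xi> (history S t \<omega>) \<omega>} =
      (\<Union>h\<in>{h \<in> histories M S. toss h \<and> length h = Suc t}. at_hist h \<inter> (\<xi> h -` {True} \<inter> space M))"
    by (auto simp: at_hist_eq histories_def) blast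
  also have "\<dots> \<in> events"
    using \<xi>_measurable by (intro sets.countable_UN' sets.Int) (auto intro!: measurable_sets)
  finally have [measurable]: "Measurable.pred M (\<lambda>\<omega>. toss (history S t \<omega>) \<and> \<xi> (history S t \<omega>) \<omega>)"
    by (simp add: pred_def)
  show ?thesis unfolding stopped_def[abs_def] by measurable
qed

text \<open>On \<open>at_hist h\<close> the coins met by the random history are those at the
  prefixes of \<open>h\<close>, which reduces survival to \<open>heads u h\<close>.\<close>

lemma prob_hist_survives:
  assumes h: "h \<in> paths t" and u: "u \<le> Suc t"
  shows "prob ({\<omega> \<in> space M. enat u \<le> \<tau> \<omega>} \<inter> at_hist h) = walk_weight t h * coin_weight u h"
proof -
  have "{\<omega> \<in> space M. enat u \<le> \<tau> \<omega>} \<inter> at_hist h = at_hist h \<inter> heads u h"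
    using take_history[of _ t S] u
    by (auto simp: at_hist_eq[OF length_paths[OF h]] heads_def \<tau>_ge_iff stopped_def)
  then show ?thesis using prob_at_hist_heads[OF h u] by simp
qed

lemma \<tau>_ge_measurable [measurable]: "Measurable.pred M (\<lambda>\<omega>. enat t \<le> \<tau> \<omega>)"
  unfolding \<tau>_ge_iff by measurable

lemma prob_\<tau>_ge: "prob {\<omega> \<in> space M. enat t \<le> \<tau> \<omega>} = alive t (\<lambda>_ _ _. 1)"
proof -
  have "prob {\<omega> \<in> space M. enat t \<le> \<tau> \<omega>} = (\<Sum>h\<in>paths t. walk_weight t h * coin_weight t h)"
    by (subst prob_by_paths[of _ t]) (auto intro!: sum.cong prob_hist_survives)
  then show ?thesis
    by (simp add: alive_eq_sum_paths case_prod_unfold)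
qed

lemma prob_stop_at: "prob {\<omega> \<in> space M. \<tau> \<omega> = enat t \<and> S t \<omega> = j} = killed t (\<lambda>s. of_bool (s = j))"
proof -
  have eq: "\<tau> \<omega> = enat t \<longleftrightarrow> enat t \<le> \<tau> \<omega> \<and> \<not> enat (Suc t) \<le> \<tau> \<omega>" for \<omega>
    by (cases "\<tau> \<omega>") auto
  have [measurable]: "{\<omega> \<in> space M. \<tau> \<omega> = enat t \<and> S t \<omega> = j} \<in> events"
    unfolding eq by measurable
  have "prob ({\<omega> \<in> space M. \<tau> \<omega> = enat t \<and> S t \<omega> = j} \<inter> at_hist h) =
      walk_weight t h * coin_weight t h * (kill_hist h * of_bool (last h = j))" if h: "h \<in> paths t" for h
  proof (cases "last h = j")
    case True
    have l: "length h = Suc t" using h by (rule length_paths)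
    have "{\<omega> \<in> space M. \<tau> \<omega> = enat t \<and> S t \<omega> = j} \<inter> at_hist h =
      ({\<omega> \<in> space M. enat t \<le> \<tau> \<omega>} \<inter> at_hist h) - ({\<omega> \<in> space M. enat (Suc t) \<le> \<tau> \<omega>} \<inter> at_hist h)"
      using True by (auto simp: eq at_hist_eq[OF l])
    also have "prob \<dots> = walk_weight t h * coin_weight t h - walk_weight t h * coin_weight (Suc t) h"
      by (subst finite_measure_Diff)
        (auto simp: prob_hist_survives[OF h] intro: order_trans[rotated])
    finally show ?thesis
      using True coin_weight_Suc[OF l] by (simp add: algebra_simps)
  next
    case False
    then have "{\<omega> \<in> space M. \<tau> \<omega> = enat t \<and> S t \<omega> = j} \<inter> at_hist h = {}"
      by (auto simp: at_hist_eq[OF length_paths[OF h]])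
    then show ?thesis using False by simp
  qed
  then have "prob {\<omega> \<in> space M. \<tau> \<omega> = enat t \<and> S t \<omega> = j} =
      (\<Sum>h\<in>paths t. walk_weight t h * coin_weight t h * (kill_hist h * of_bool (last h = j)))"
    by (subst prob_by_paths[of _ t]) auto
  then show ?thesis
    by (simp add: killed_def alive_eq_sum_paths kill_hist_def case_prod_unfold)
qed

lemma \<tau>_eq_infinity_iff: "\<tau> \<omega> = \<infinity> \<longleftrightarrow> (\<forall>t. enat t \<le> \<tau> \<omega>)"
proof (cases "\<tau> \<omega>")
  case (enat u)
  then have "\<not> enat (Suc u) \<le> \<tau> \<omega>" "\<tau> \<omega> \<noteq> \<infinity>" by simp_all
  then show ?thesis by blast
qed simp

section \<open>Law and uniform integrability of the stopped walk\<close>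

lemma \<tau>_finite: "AE \<omega> in M. \<tau> \<omega> \<noteq> \<infinity>"
proof -
  have [measurable]: "{\<omega> \<in> space M. \<tau> \<omega> = \<infinity>} \<in> events"
    unfolding \<tau>_eq_infinity_iff by measurable
  have "prob {\<omega> \<in> space M. \<tau> \<omega> = \<infinity>} \<le> alive t (\<lambda>_ _ _. 1)" for t
    unfolding prob_\<tau>_ge[symmetric] by (intro finite_measure_mono) auto
  then have "prob {\<omega> \<in> space M. \<tau> \<omega> = \<infinity>} \<le> 0"
    by (intro tendsto_lowerbound[OF alive_one_tendsto]) auto
  then have "prob {\<omega> \<in> space M. \<tau> \<omega> = \<infinity>} = 0"
    using measure_nonneg[of M] by (intro antisym)
  then show ?thesis
    by (subst prob_Collect_eq_0[symmetric]) auto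
qed

definition \<tau>_nat :: "'a \<Rightarrow> nat" where "\<tau>_nat \<omega> = the_enat (\<tau> \<omega>)"

lemma \<tau>_measurable [measurable]: "\<tau> \<in> M \<rightarrow>\<^sub>M count_space UNIV"
proof -
  have "{\<omega> \<in> space M. \<tau> \<omega> = x} \<in> events" for x
  proof (cases x)
    case (enat t)
    have "\<tau> \<omega> = enat t \<longleftrightarrow> enat t \<le> \<tau> \<omega> \<and> \<not> enat (Suc t) \<le> \<tau> \<omega>" for \<omega>
      by (cases "\<tau> \<omega>") auto
    then show ?thesis using enat by simp
  qed (simp add: \<tau>_eq_infinity_iff)
  moreover have "\<tau> -` {x} \<inter> space M = {\<omega> \<in> space M. \<tau> \<omega> = x}" for x by auto
  ultimately show ?thesis
    by (subst measurable_count_space_eq2_countable) auto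
qed

lemma \<tau>_nat_measurable [measurable]: "\<tau>_nat \<in> M \<rightarrow>\<^sub>M count_space UNIV"
  unfolding \<tau>_nat_def[abs_def] by measurable

lemma stopped_position_measurable [measurable]: "(\<lambda>\<omega>. S (\<tau>_nat \<omega>) \<omega>) \<in> M \<rightarrow>\<^sub>M count_space UNIV"
  by (rule measurable_compose_countable[OF S_measurable \<tau>_nat_measurable])

lemma prob_stopped_position: "prob {\<omega> \<in> space M. S (\<tau>_nat \<omega>) \<omega> = j} = m j"
proof -
  define A where "A t = {\<omega> \<in> space M. \<tau> \<omega> = enat t \<and> S t \<omega> = j}" for t
  have A: "A t \<in> events" for t unfolding A_def by measurable
  have "prob {\<omega> \<in> space M. S (\<tau>_nat \<omega>) \<omega> = j} = prob (\<Union>t. A t)"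
  proof (rule finite_measure_eq_AE)
    show "AE \<omega> in M. \<omega> \<in> {\<omega> \<in> space M. S (\<tau>_nat \<omega>) \<omega> = j} \<longleftrightarrow> \<omega> \<in> (\<Union>t. A t)"
      using \<tau>_finite by eventually_elim (auto simp: A_def \<tau>_nat_def)
  qed (use A in auto)
  moreover have "(\<lambda>t. prob (A t)) sums prob (\<Union>t. A t)"
    using A by (intro finite_measure_UNION) (auto simp: A_def disjoint_family_on_def)
  then have "(\<lambda>t. killed t (\<lambda>s. of_bool (s = j))) sums prob (\<Union>t. A t)"
    by (simp add: A_def prob_stop_at)
  then have "prob (\<Union>t. A t) = m j"
    using killed_sums sums_unique2 by blast
  ultimately show ?thesis by simp
qed

lemma \<tau>_embeds: "embeds M S \<tau> \<mu>"
proof -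
  have *: "distr M (count_space UNIV) (\<lambda>\<omega>. S (\<tau>_nat \<omega>) \<omega>) = \<mu>"
  proof (rule measure_eqI_countable[where A = UNIV])
    fix j
    interpret mu: prob_space \<mu> by (rule prob_space_mu)
    have "(\<lambda>\<omega>. S (\<tau>_nat \<omega>) \<omega>) -` {j} \<inter> space M = {\<omega> \<in> space M. S (\<tau>_nat \<omega>) \<omega> = j}" by auto
    then show "emeasure (distr M (count_space UNIV) (\<lambda>\<omega>. S (\<tau>_nat \<omega>) \<omega>)) {j} = emeasure \<mu> {j}"
      using prob_stopped_position[of j]
      by (simp add: emeasure_distr emeasure_eq_measure mu.emeasure_eq_measure m_def)
  qed (auto simp: sets_mu)
  have meas: "(\<lambda>k :: int. ereal (of_int k)) \<in> count_space UNIV \<rightarrow>\<^sub>M borel" by simp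
  have "(\<lambda>\<omega>. case \<tau> \<omega> of enat t \<Rightarrow> ereal (of_int (S t \<omega>)) | \<infinity> \<Rightarrow> - \<infinity>) \<in> M \<rightarrow>\<^sub>M borel"
    by (rule measurable_compose_countable[OF _ \<tau>_measurable])
      (auto split: enat.split intro!: measurable_compose[OF S_measurable])
  then have sv: "stopped_value S \<tau> \<in> M \<rightarrow>\<^sub>M borel"
    by (simp add: stopped_value_def[abs_def])
  have "distr M borel (stopped_value S \<tau>) = distr M borel (\<lambda>\<omega>. ereal (of_int (S (\<tau>_nat \<omega>) \<omega>)))"
  proof (rule distr_cong_AE)
    show "AE \<omega> in M. stopped_value S \<tau> \<omega> = ereal (of_int (S (\<tau>_nat \<omega>) \<omega>))"
      using \<tau>_finite by eventually_elim (auto simp: stopped_value_def \<tau>_nat_def)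
  qed (use sv measurable_compose[OF stopped_position_measurable meas] in simp_all)
  also have "\<dots> = distr (distr M (count_space UNIV) (\<lambda>\<omega>. S (\<tau>_nat \<omega>) \<omega>)) borel (\<lambda>k. ereal (of_int k))"
    by (subst distr_distr[OF meas stopped_position_measurable]) (simp add: o_def)
  finally show ?thesis
    by (simp add: embeds_def *)
qed

text \<open>The mean is the sum of the tail probabilities, and \<open>t < \<tau>\<close> is
  contained in \<open>t \<le> \<tau>\<close>, whose probability \<open>alive t\<close> is summable
  in \<open>t\<close>.\<close>

lemma integrable_\<tau>: "integrable M (\<lambda>\<omega>. real (\<tau>_nat \<omega>))"
proof (rule integrableI_nonneg)
  have "(\<integral>\<^sup>+ \<omega>. ennreal (real (\<tau>_nat \<omega>)) \<partial>M) = (\<Sum>t. emeasure M {\<omega> \<in> space M. t < \<tau>_nat \<omega>})"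
    by (simp add: nn_integral_nat_function ennreal_of_nat_eq_real_of_nat[symmetric])
  also have "\<dots> \<le> (\<Sum>t. ennreal (alive t (\<lambda>_ _ _. 1)))"
  proof (intro suminf_le summableI)
    fix t
    have "{\<omega> \<in> space M. t < \<tau>_nat \<omega>} \<subseteq> {\<omega> \<in> space M. enat t \<le> \<tau> \<omega>}"
    proof safe
      fix \<omega> assume "t < \<tau>_nat \<omega>"
      then show "enat t \<le> \<tau> \<omega>" by (cases "\<tau> \<omega>") (auto simp: \<tau>_nat_def)
    qed
    then have "emeasure M {\<omega> \<in> space M. t < \<tau>_nat \<omega>} \<le> emeasure M {\<omega> \<in> space M. enat t \<le> \<tau> \<omega>}"
      by (intro emeasure_mono) auto
    then show "emeasure M {\<omega> \<in> space M. t < \<tau>_nat \<omega>} \<le> ennreal (alive t (\<lambda>_ _ _. 1))"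
      by (simp add: emeasure_eq_measure prob_\<tau>_ge)
  qed
  also have "\<dots> = ennreal (\<Sum>t. alive t (\<lambda>_ _ _. 1))"
    using alive_one_summable by (intro suminf_ennreal2) (auto intro: alive_nonneg)
  also have "\<dots> < \<infinity>" by simp
  finally show "(\<integral>\<^sup>+ \<omega>. ennreal (real (\<tau>_nat \<omega>)) \<partial>M) < \<infinity>" .
qed auto

lemma stopped_walk_le: "AE \<omega> in M. \<forall>t. \<bar>stopped_walk S \<tau> t \<omega>\<bar> \<le> real (\<tau>_nat \<omega>)"
proof -
  have bound: "\<bar>S t \<omega>\<bar> \<le> int t" if H: "\<And>u. history S u \<omega> \<in> paths u" for t \<omega>
  proof (induction t)
    case 0
    have "history S 0 \<omega> = [0]" using H[of 0] by simp
    then show ?case using history_nth[of 0 0 S \<omega>] by simp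
  next
    case (Suc t)
    obtain h d where "history S (Suc t) \<omega> = h @ [last h + d]" "d = 1 \<or> d = - 1"
      using H[of "Suc t"] by auto
    then have "\<bar>S (Suc t) \<omega> - S t \<omega>\<bar> = 1" by (auto simp: history_Suc)
    then show ?case using Suc by simp
  qed
  have "AE \<omega> in M. \<forall>t. history S t \<omega> \<in> paths t"
    using AE_paths by (simp add: AE_all_countable)
  then show ?thesis
    using \<tau>_finite
  proof eventually_elim
    case (elim \<omega>)
    then obtain u where u: "\<tau> \<omega> = enat u" by auto
    show ?case
    proof
      fix t
      have "\<bar>S (min u t) \<omega>\<bar> \<le> int (min u t)" using bound elim(1) by blast
      then show "\<bar>stopped_walk S \<tau> t \<omega>\<bar> \<le> real (\<tau>_nat \<omega>)"
        using u by (simp add: stopped_walk_def \<tau>_nat_def)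
    qed
  qed
qed

text \<open>The single integrable variable \<open>\<tau>_nat\<close> dominates the whole family, so
  its truncated tails, which vanish by dominated convergence, serve for all times.\<close>

lemma stopped_walk_uniformly_integrable: "uniformly_integrable M (stopped_walk S \<tau>)"
proof -
  let ?Z = "\<lambda>\<omega>. real (\<tau>_nat \<omega>)"
  have meas [measurable]: "stopped_walk S \<tau> t \<in> borel_measurable M" for t
  proof -
    have "(\<lambda>\<omega>. the_enat (min (\<tau> \<omega>) (enat t))) \<in> M \<rightarrow>\<^sub>M count_space UNIV"
      by (rule measurable_compose[OF \<tau>_measurable]) simp
    from measurable_compose_countable[OF S_measurable this]
    have "(\<lambda>\<omega>. S (the_enat (min (\<tau> \<omega>) (enat t))) \<omega>) \<in> M \<rightarrow>\<^sub>M count_space UNIV" .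
    then show ?thesis
      unfolding stopped_walk_def[abs_def] by measurable
  qed
  have int: "integrable M (stopped_walk S \<tau> t)" for t
    using stopped_walk_le by (intro Bochner_Integration.integrable_bound[OF integrable_\<tau>]) auto
  have tail: "(\<lambda>K. \<integral>\<omega>. ?Z \<omega> * indicator {\<omega>. ?Z \<omega> > real K} \<omega> \<partial>M) \<longlonglongrightarrow> (\<integral>\<omega>. 0 \<partial>M)"
  proof (rule integral_dominated_convergence[where w = ?Z])
    show "AE \<omega> in M. (\<lambda>K. ?Z \<omega> * indicator {\<omega>. ?Z \<omega> > real K} \<omega>) \<longlonglongrightarrow> 0"
    proof (rule AE_I2)
      fix \<omega>
      show "(\<lambda>K. ?Z \<omega> * indicator {\<omega>. ?Z \<omega> > real K} \<omega>) \<longlonglongrightarrow> 0"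
        by (rule tendsto_eventually, rule eventually_sequentiallyI[of "\<tau>_nat \<omega>"]) (simp add: indicator_def)
    qed
  qed (auto simp: integrable_\<tau> indicator_def)
  show ?thesis
    unfolding uniformly_integrable_def
  proof (intro conjI allI impI int)
    fix \<epsilon> :: real assume "0 < \<epsilon>"
    then obtain K :: nat where K: "(\<integral>\<omega>. ?Z \<omega> * indicator {\<omega>. ?Z \<omega> > real K} \<omega> \<partial>M) < \<epsilon>"
      using order_tendstoD(2)[OF tail, of \<epsilon>] eventually_happens[of _ sequentially] by auto
    have "(\<integral>\<omega>. \<bar>stopped_walk S \<tau> t \<omega>\<bar> * indicator {\<omega>. \<bar>stopped_walk S \<tau> t \<omega>\<bar> > real K} \<omega> \<partial>M)
        \<le> (\<integral>\<omega>. ?Z \<omega> * indicator {\<omega>. ?Z \<omega> > real K} \<omega> \<partial>M)" for t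
    proof (rule integral_mono_AE)
      show "integrable M (\<lambda>\<omega>. \<bar>stopped_walk S \<tau> t \<omega>\<bar> * indicator {\<omega>. \<bar>stopped_walk S \<tau> t \<omega>\<bar> > real K} \<omega>)"
        by (rule Bochner_Integration.integrable_bound[OF integrable_abs[OF int[of t]]]) (auto simp: indicator_def)
      show "integrable M (\<lambda>\<omega>. ?Z \<omega> * indicator {\<omega>. ?Z \<omega> > real K} \<omega>)"
        by (rule Bochner_Integration.integrable_bound[OF integrable_\<tau>]) (auto simp: indicator_def)
      show "AE \<omega> in M. \<bar>stopped_walk S \<tau> t \<omega>\<bar> * indicator {\<omega>. \<bar>stopped_walk S \<tau> t \<omega>\<bar> > real K} \<omega>
          \<le> ?Z \<omega> * indicator {\<omega>. ?Z \<omega> > real K} \<omega>"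
        using stopped_walk_le
      proof eventually_elim
        case (elim \<omega>)
        then have le: "\<bar>stopped_walk S \<tau> t \<omega>\<bar> \<le> ?Z \<omega>" by blast
        show ?case
        proof (cases "real K < \<bar>stopped_walk S \<tau> t \<omega>\<bar>")
          case True
          then have "real K < ?Z \<omega>" using le by linarith
          then show ?thesis using le True by (simp add: indicator_def)
        qed (simp add: indicator_def)
      qed
    qed
    then show "\<exists>K. \<forall>t. (\<integral>\<omega>. \<bar>stopped_walk S \<tau> t \<omega>\<bar> * indicator {\<omega>. \<bar>stopped_walk S \<tau> t \<omega>\<bar> > K} \<omega> \<partial>M) < \<epsilon>"
      using K by (intro exI[of _ "real K"] allI) (rule le_less_trans)
  qed
qed

section \<open>Adaptedness and the Azema--Yor rule\<close>

lemma \<tau>_stopping_time: "coin_stopping_time M S \<xi> \<tau>"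
  unfolding coin_stopping_time_def
proof
  fix t
  let ?W = "walk_filtration M S t" and ?C = "coin_filtration M S \<xi> t"
  have space: "space ?W = space M" "space ?C = space M"
    by (auto simp: walk_filtration_def coin_filtration_def space_measure_of_conv)
  have setsW: "sets ?W = sigma_sets (space M) (\<Union>s\<in>{..t}. {S s -` A \<inter> space M | A. True})"
    unfolding walk_filtration_def by (rule sets_measure_of) auto
  have "sets ?W \<subseteq> Pow (space M)" using sets.space_closed[of ?W] space by simp
  then have setsC: "sets ?C = sigma_sets (space M) (sets ?W \<union> (\<Union>s\<in>{..t}. {(\<lambda>\<omega>. \<xi> (history S s \<omega>) \<omega>) -` A \<inter> space M | A. True}))"
    unfolding coin_filtration_def by (intro sets_measure_of) auto
  have hist: "{\<omega> \<in> space M. Q (history S s \<omega>)} \<in> sets ?C" if "s \<le> t" for Q s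
  proof -
    have "{\<omega> \<in> space M. S u \<omega> = a} \<in> sets ?W" if "u \<le> s" for u a
      unfolding setsW using that \<open>s \<le> t\<close>
      by (intro sigma_sets.Basic UN_I[of u]) (auto intro!: exI[of _ "{a}"])
    then have "(\<Inter>u\<in>{..s}. {\<omega> \<in> space M. S u \<omega> = h ! u}) \<in> sets ?W" for h
      by (intro sets.finite_INT) auto
    then have "(\<Union>h\<in>{h. Q h \<and> length h = Suc s}. \<Inter>u\<in>{..s}. {\<omega> \<in> space M. S u \<omega> = h ! u}) \<in> sets ?W"
      by (intro sets.countable_UN') auto
    moreover have "(\<Inter>u\<in>{..s}. {\<omega> \<in> space M. S u \<omega> = h ! u}) = {\<omega> \<in> space M. history S s \<omega> = h}"
      if "length h = Suc s" for h
      by (auto simp: history_eq_iff[OF that])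
    then have "(\<Union>h\<in>{h. Q h \<and> length h = Suc s}. \<Inter>u\<in>{..s}. {\<omega> \<in> space M. S u \<omega> = h ! u}) =
        {\<omega> \<in> space M. Q (history S s \<omega>)}"
      by auto
    ultimately show ?thesis
      unfolding setsC by (intro sigma_sets.Basic) simp
  qed
  have coin: "{\<omega> \<in> space M. \<xi> (history S s \<omega>) \<omega>} \<in> sets ?C" if "s \<le> t" for s
    unfolding setsC using that
    by (intro sigma_sets.Basic UnI2 UN_I[of s]) (auto intro!: exI[of _ "{True}"])
  have "{\<omega> \<in> space M. \<tau> \<omega> \<le> enat t} = (\<Union>s\<in>{..t}. {\<omega> \<in> space M. sure (history S s \<omega>)} \<union>
      ({\<omega> \<in> space M. toss (history S s \<omega>)} \<inter> {\<omega> \<in> space M. \<xi> (history S s \<omega>) \<omega>}))"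
    by (auto simp: \<tau>_le_iff stopped_def)
  also have "\<dots> \<in> sets ?C"
    by (intro sets.finite_UN sets.Un sets.Int hist coin) auto
  finally show "Measurable.pred ?C (\<lambda>\<omega>. \<tau> \<omega> \<le> enat t)"
    by (simp add: pred_def space)
qed

lemma \<tau>_randomized: "randomized_stopping_time M S \<tau>"
  unfolding randomized_stopping_time_def using coins \<tau>_stopping_time by blast

lemma \<tau>_AY: "randomized_AY_time M S \<rho> \<mu> \<tau>"
  unfolding randomized_AY_time_def Let_def
proof (intro exI[of _ coin_prob] exI[of _ \<xi>] exI[of _ r] conjI coins \<tau>_stopping_time allI impI ballI)
  fix \<omega> t n k
  assume "ay_toss \<rho> \<mu> (\<lambda>t. g (S t \<omega>)) t n k"
  then show "coin_prob (history S t \<omega>) = r n k"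
    by (simp add: ay_toss_iff coin_prob_def)
next
  fix \<omega>
  show "\<tau> \<omega> = Inf (enat ` {t. ay_sure_stop \<rho> \<mu> (\<lambda>t. g (S t \<omega>)) t \<or>
      (\<exists>n k. ay_toss \<rho> \<mu> (\<lambda>t. g (S t \<omega>)) t n k) \<and> \<xi> (history S t \<omega>) \<omega>})"
    by (simp add: \<tau>_def stopped_def ay_sure_stop_iff ay_toss_iff)
qed (simp_all add: r_bounds)

end

theorem proposition3p2:
  fixes M :: "'a measure" and S :: "nat \<Rightarrow> 'a \<Rightarrow> int" and p \<rho> :: real
  assumes "0 < p" and "p < 1 / 2" and "\<rho> = (1 - p) / p"
    and "walk_with_coins M S p"
  shows "centred_measures \<rho> \<subseteq> embeddable M S \<and>
    (\<forall>\<mu>\<in>centred_measures \<rho>. \<exists>\<tau>. randomized_AY_time M S \<rho> \<mu> \<tau> \<and> embeds M S \<tau> \<mu>)"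
proof -
  interpret walk_with_coins M S p by (rule assms(4))
  have "\<mu> \<in> embeddable M S \<and> (\<exists>\<tau>. randomized_AY_time M S \<rho> \<mu> \<tau> \<and> embeds M S \<tau> \<mu>)"
    if "\<mu> \<in> centred_measures \<rho>" for \<mu>
  proof -
    interpret centred p \<rho> \<mu>
      by unfold_locales (use assms that in auto)
    \<comment> \<open>\<open>coins_exist\<close> asks for admissible probabilities at every list,
      including lists that are not histories; \<open>r_bounds\<close> holds for all indices.\<close>
    have "0 \<le> coin_prob h \<and> coin_prob h \<le> 1" for h
      using r_bounds by (simp add: coin_prob_def case_prod_unfold)
    then obtain \<xi> where "coin_family M S coin_prob \<xi>"
      using coins_exist[of coin_prob] by blast
    then interpret coin_walk p \<rho> \<mu> M S \<xi>
      by unfold_locales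
    show ?thesis
      using \<tau>_randomized \<tau>_embeds stopped_walk_uniformly_integrable \<tau>_AY prob_space_mu sets_mu
      unfolding embeddable_def by blast
  qed
  then show ?thesis by blast
qed

end
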